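(* Let $\omega$ be any positive quadratic form on $\mathbb{R}^d$ and let $g\in L^2(\mathbb{R}^d)$ be such that $\{ g_{m,n} : m,n \in \mathbb{Z}^d\}$ is an exact frame for $L^2(\mathbb{R}^d)$, where $g_{m,n}(x) = e^{2\pi i n\cdot x} g(x-m)$. Then $$\left( \int_{\mathbb{R}^d} \omega(x) |g(x)|^2\, dx \right) \left( \int_{\mathbb{R}^d} \omega(\xi) |\hat g(\xi)|^2\, d\xi \right) = \infty .$$
   Context: A collection $\{f_k\}\subset L^2(\mathbb{R}^d)$ is a frame for $L^2(\mathbb{R}^d)$ if there are constants $0<A\le B<\infty$ with $A\|f\|_2^2 \le \sum_k |\langle f,f_k\rangle|^2 \le B\|f\|_2^2$ for all $f\in L^2(\mathbb{R}^d)$; it is exact if it is no longer a frame after removal of any one of its elements. The Fourier transform is $\hat f(\xi) = \int_{\mathbb{R}^d} f(x) e^{2\pi i x\cdot \xi}\,dx$, extended to a unitary operator on $L^2(\mathbb{R}^d)$. A positive quadratic form on $\mathbb{R}^d$ here means a real quadratic form $\omega$ that is non-negative and not identically zero, i.e. $\omega(x) = \sum_{k=1}^d \alpha_k (v_k\cdot x)^2$ with $\alpha_k\ge 0$, $v_k\in\mathbb{R}^d$, $\omega\not\equiv 0$. *)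

theory Defs
  imports "HOL-Analysis.Analysis"
begin

(* L^2 is handled through representatives: an element is a square-integrable
   Lebesgue measurable function, and functions equal almost everywhere stand for the
   same vector.  All notions below are invariant under changes on null sets. *)

definition L2 :: "('a::euclidean_space \<Rightarrow> complex) set" where
  "L2 = {f \<in> borel_measurable lebesgue. integrable lebesgue (\<lambda>x. (norm (f x))\<^sup>2)}"

definition norm_L2 :: "('a::euclidean_space \<Rightarrow> complex) \<Rightarrow> real" where
  "norm_L2 f = sqrt (LINT x|lebesgue. (norm (f x))\<^sup>2)"

definition inner_L2 :: "('a::euclidean_space \<Rightarrow> complex) \<Rightarrow> ('a \<Rightarrow> complex) \<Rightarrow> complex" where
  "inner_L2 f g = (LINT x|lebesgue. f x * cnj (g x))"

definition tendsto_L2 ::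
    "(nat \<Rightarrow> 'a::euclidean_space \<Rightarrow> complex) \<Rightarrow> ('a \<Rightarrow> complex) \<Rightarrow> bool" where
  "tendsto_L2 s f \<longleftrightarrow>
     (\<forall>n. s n \<in> L2) \<and> f \<in> L2 \<and> (\<lambda>n. norm_L2 (\<lambda>x. s n x - f x)) \<longlonglongrightarrow> 0"

(* Collections are indexed families, so removing an element means removing an index. *)

definition is_frame :: "'k set \<Rightarrow> ('k \<Rightarrow> 'a::euclidean_space \<Rightarrow> complex) \<Rightarrow> bool" where
  "is_frame I \<phi> \<longleftrightarrow>
     (\<forall>k\<in>I. \<phi> k \<in> L2) \<and>
     (\<exists>A B. 0 < A \<and> A \<le> B \<and>
       (\<forall>f\<in>L2.
          (\<lambda>k. (norm (inner_L2 f (\<phi> k)))\<^sup>2) summable_on I \<and>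
          A * (norm_L2 f)\<^sup>2 \<le> (\<Sum>\<^sub>\<infinity>k\<in>I. (norm (inner_L2 f (\<phi> k)))\<^sup>2) \<and>
          (\<Sum>\<^sub>\<infinity>k\<in>I. (norm (inner_L2 f (\<phi> k)))\<^sup>2) \<le> B * (norm_L2 f)\<^sup>2))"

definition is_exact_frame :: "'k set \<Rightarrow> ('k \<Rightarrow> 'a::euclidean_space \<Rightarrow> complex) \<Rightarrow> bool" where
  "is_exact_frame I \<phi> \<longleftrightarrow> is_frame I \<phi> \<and> (\<forall>k\<in>I. \<not> is_frame (I - {k}) \<phi>)"

definition fourier_L1 :: "('a::euclidean_space \<Rightarrow> complex) \<Rightarrow> 'a \<Rightarrow> complex" where
  "fourier_L1 f \<xi> =
     (LINT x|lebesgue. f x * exp (2 * complex_of_real pi * \<i> * complex_of_real (x \<bullet> \<xi>)))"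

(* The continuous extension from (L^1 \<inter> L^2) to L^2: F represents the transform of f
   if it is the L^2 limit of the transforms of some L^2 approximation of f from that
   dense subspace. By Plancherel's theorem such an F exists for every f in L^2 and is
   unique up to a null set, so the choice in fourier_L2 is only one of representative. *)

definition is_fourier_L2 ::
    "('a::euclidean_space \<Rightarrow> complex) \<Rightarrow> ('a \<Rightarrow> complex) \<Rightarrow> bool" where
  "is_fourier_L2 f F \<longleftrightarrow>
     (\<exists>s. (\<forall>n. integrable lebesgue (s n)) \<and> tendsto_L2 s f \<and>
          tendsto_L2 (\<lambda>n. fourier_L1 (s n)) F)"

definition fourier_L2 :: "('a::euclidean_space \<Rightarrow> complex) \<Rightarrow> 'a \<Rightarrow> complex" where
  "fourier_L2 f = (SOME F. is_fourier_L2 f F)"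

definition int_vec :: "int ^ 'd \<Rightarrow> real ^ 'd" where
  "int_vec m = (\<chi> i. real_of_int (m $ i))"

definition gabor ::
    "(real ^ 'd \<Rightarrow> complex) \<Rightarrow> (int ^ 'd) \<times> (int ^ 'd) \<Rightarrow> real ^ 'd::finite \<Rightarrow> complex" where
  "gabor g = (\<lambda>(m, n) x.
     exp (2 * complex_of_real pi * \<i> * complex_of_real (int_vec n \<bullet> x)) * g (x - int_vec m))"

definition quadratic_form :: "('a::euclidean_space \<Rightarrow> real) \<Rightarrow> bool" where
  "quadratic_form \<omega> \<longleftrightarrow> (\<exists>b. bilinear b \<and> (\<forall>x. \<omega> x = b x x))"

(* "Positive" means non-negative and not identically zero, not positive definite. *)

definition positive_quadratic_form :: "('a::euclidean_space \<Rightarrow> real) \<Rightarrow> bool" where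
  "positive_quadratic_form \<omega> \<longleftrightarrow>
     quadratic_form \<omega> \<and> (\<forall>x. 0 \<le> \<omega> x) \<and> (\<exists>x. \<omega> x \<noteq> 0)"

lemma positive_quadratic_form_sum_squares:
  fixes \<alpha> :: "'k \<Rightarrow> real" and v :: "'k \<Rightarrow> 'a::euclidean_space"
  assumes "\<And>k. k \<in> K \<Longrightarrow> 0 \<le> \<alpha> k"
    and "\<exists>x. (\<Sum>k\<in>K. \<alpha> k * (v k \<bullet> x)\<^sup>2) \<noteq> 0"
  shows "positive_quadratic_form (\<lambda>x. \<Sum>k\<in>K. \<alpha> k * (v k \<bullet> x)\<^sup>2)"
proof -
  let ?b = "\<lambda>x y. \<Sum>k\<in>K. \<alpha> k * (v k \<bullet> x) * (v k \<bullet> y)"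
  have "bilinear ?b"
    unfolding bilinear_def
    by (auto intro!: linearI simp: inner_add_right algebra_simps sum.distrib sum_distrib_left)
  moreover have "\<forall>x. (\<Sum>k\<in>K. \<alpha> k * (v k \<bullet> x)\<^sup>2) = ?b x x"
    by (simp add: power2_eq_square mult.assoc)
  ultimately have "quadratic_form (\<lambda>x. \<Sum>k\<in>K. \<alpha> k * (v k \<bullet> x)\<^sup>2)"
    unfolding quadratic_form_def by blast
  then show ?thesis
    using assms by (auto simp: positive_quadratic_form_def intro!: sum_nonneg)
qed

end

theory Submission
  imports Defs "HOL-Probability.Characteristic_Functions"
begin

text \<open>
  This is Battle's commutator argument for the Balian--Low theorem. A positive form dominates
  \<open>(v \<bullet> x)\<^sup>2\<close> for some \<open>v \<noteq> 0\<close>, so if both integrals were finite, then \<open>(v \<bullet> x) g \<in> L\<^sup>2\<close> and, by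
  Plancherel, translating \<open>g\<close> by \<open>t v\<close> changes it by \<open>O(t)\<close> in norm. Exactness provides a \<open>d\<close> whose time-frequency
  shifts \<open>d\<^sub>k\<close> are biorthogonal to the \<open>g\<^sub>k\<close>, which gives \<open>\<langle>f, p\<rangle> = \<Sum>\<^sub>k \<langle>f, d\<^sub>k\<rangle> \<langle>g\<^sub>k, p\<rangle>\<close>. The
  integer time-frequency shifts commute with each other, and they commute up to a phase with the
  modulation \<open>U\<^sub>t\<close> by \<open>e\<^bsup>2 \<pi> i t v \<bullet> x\<^esup>\<close> and the translation \<open>R\<^sub>t\<close> by \<open>t v\<close>. Hence
  \<open>\<langle>(R\<^sub>t U\<^sub>t - U\<^sub>t R\<^sub>t) g, d\<rangle>\<close> is the sum over \<open>k\<close> of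
  \<open>\<langle>(U\<^sub>t - 1) g, d\<^sub>k\<rangle> \<langle>(R\<^sub>t - 1) g, d\<^bsub>-k\<^esub>\<rangle>\<close> times a difference of two phases that tends to 0. Divided by
  \<open>t\<^sup>2\<close>, the sum tends to 0, but the commutator tends to \<open>2 \<pi> i |v|\<^sup>2 \<langle>g, d\<rangle> = 2 \<pi> i |v|\<^sup>2 \<noteq> 0\<close>.
  No regularity of \<open>d\<close> is needed.
\<close>


section \<open>The space \<open>L\<^sup>2\<close>\<close>

text \<open>Taking finite \<open>t\<close> and unitary operators, instead of the unbounded position
  and momentum operators, avoids all domain questions for \<open>d\<close>: adjoints are put on
  \<open>d\<close>, and commutation with the integer shifts carries them back to \<open>g\<close>.
  The two finiteness assumptions enter with different strength. The weight on \<open>g\<close> makes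
  the difference quotients of the modulation converge in norm; the weight on the transform gives a
  uniform norm bound for those of the translation. The sum vanishes in the limit because its phase
  factors are bounded by 2 and tend to 0 for each fixed \<open>k\<close>, while the convergent
  coefficients have uniformly small l2 tails. Square summability against the dual system is itself a
  consequence, by duality, of the lower frame bound. Refuting finiteness of both integrals is not
  the whole claim, since 0 times infinity is 0 in \<open>ennreal\<close>: neither factor vanishes,
  because \<open>g\<close> has nonzero norm and a hyperplane is a null set. Plancherel's theorem is
  obtained by damping the transform with a Gaussian, which makes Fubini applicable before the
  transform is known to be square integrable.\<close>

lemma L2_measurable: "f \<in> L2 \<Longrightarrow> f \<in> borel_measurable lebesgue"
  by (simp add: L2_def)

lemma L2_integrable_norm_sq: "f \<in> L2 \<Longrightarrow> integrable lebesgue (\<lambda>x. (norm (f x))\<^sup>2)"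
  by (simp add: L2_def)

lemma L2_I:
  assumes "f \<in> borel_measurable lebesgue" "(\<integral>\<^sup>+x. ennreal ((norm (f x))\<^sup>2) \<partial>lebesgue) < \<infinity>"
  shows "f \<in> L2"
  using assms unfolding L2_def by (auto intro!: integrableI_nonneg borel_measurable_power borel_measurable_norm)

lemma norm_L2_nonneg [simp]: "0 \<le> norm_L2 f"
  by (simp add: norm_L2_def)

lemma norm_L2_sq: "(norm_L2 f)\<^sup>2 = (LINT x|lebesgue. (norm (f x))\<^sup>2)"
  by (simp add: norm_L2_def)

lemma nn_integral_norm_L2:
  "f \<in> L2 \<Longrightarrow> (\<integral>\<^sup>+x. ennreal ((norm (f x))\<^sup>2) \<partial>lebesgue) = ennreal ((norm_L2 f)\<^sup>2)"
  by (simp add: norm_L2_sq nn_integral_eq_integral L2_integrable_norm_sq)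

lemma norm_L2_sq_enn2real: 
  "f \<in> borel_measurable lebesgue \<Longrightarrow> (norm_L2 f)\<^sup>2 = enn2real (\<integral>\<^sup>+x. ennreal ((norm (f x))\<^sup>2) \<partial>lebesgue)"
  unfolding norm_L2_sq by (subst integral_eq_nn_integral) auto

lemma L2_dominated:
  assumes "f \<in> L2" "g \<in> borel_measurable lebesgue" "\<And>x. norm (g x) \<le> norm (f x)"
  shows "g \<in> L2"
proof -
  note [measurable] = assms(2)
  have "integrable lebesgue (\<lambda>x. (norm (g x))\<^sup>2)"
    by (rule Bochner_Integration.integrable_bound[OF L2_integrable_norm_sq[OF assms(1)]])
       (auto intro!: always_eventually power_mono assms(3))
  then show ?thesis using assms by (simp add: L2_def)
qed

lemma L2_add:
  assumes "f \<in> L2" "g \<in> L2" shows "(\<lambda>x. f x + g x) \<in> L2"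
proof -
  note [measurable] = assms[THEN L2_measurable]
  have "integrable lebesgue (\<lambda>x. 2 * (norm (f x))\<^sup>2 + 2 * (norm (g x))\<^sup>2)"
    using assms by (auto simp: L2_def)
  moreover have "(norm (f x + g x))\<^sup>2 \<le> 2 * (norm (f x))\<^sup>2 + 2 * (norm (g x))\<^sup>2" for x
  proof -
    have "(norm (f x + g x))\<^sup>2 \<le> (norm (f x) + norm (g x))\<^sup>2"
      by (intro power_mono norm_triangle_ineq) auto
    also have "\<dots> \<le> 2 * (norm (f x))\<^sup>2 + 2 * (norm (g x))\<^sup>2"
      using sum_squares_bound[of "norm (f x)" "norm (g x)"] by (simp add: power2_sum)
    finally show ?thesis .
  qed
  ultimately have "integrable lebesgue (\<lambda>x. (norm (f x + g x))\<^sup>2)"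
    by (elim Bochner_Integration.integrable_bound) (auto intro!: always_eventually)
  then show ?thesis by (simp add: L2_def)
qed

lemma L2_zero [simp]: "(\<lambda>x. 0) \<in> L2"
  by (simp add: L2_def)

lemma L2_scale: "f \<in> L2 \<Longrightarrow> (\<lambda>x. c * f x) \<in> L2"
  by (auto simp: L2_def norm_mult power_mult_distrib)

lemma L2_uminus: "f \<in> L2 \<Longrightarrow> (\<lambda>x. - f x) \<in> L2"
  by (auto simp: L2_def)

lemma L2_diff:
  assumes "f \<in> L2" "g \<in> L2" shows "(\<lambda>x. f x - g x) \<in> L2"
  using L2_add[OF assms(1) L2_uminus[OF assms(2)]] by simp

lemma L2_sum: "(\<And>i. i \<in> I \<Longrightarrow> f i \<in> L2) \<Longrightarrow> (\<lambda>x. \<Sum>i\<in>I. f i x) \<in> L2"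
  by (induction I rule: infinite_finite_induct) (auto intro: L2_add)

lemma borel_measurable_cnj [measurable (raw)]:
  "f \<in> borel_measurable M \<Longrightarrow> (\<lambda>x. cnj (f x)) \<in> borel_measurable M"
  by (rule borel_measurable_continuous_on[OF continuous_on_cnj[OF continuous_on_id]])

lemma L2_inner_integrable:
  assumes "f \<in> L2" "g \<in> L2" shows "integrable lebesgue (\<lambda>x. f x * cnj (g x))"
proof -
  note [measurable] = assms[THEN L2_measurable]
  have "integrable lebesgue (\<lambda>x. (norm (f x))\<^sup>2 + (norm (g x))\<^sup>2)"
    using assms by (auto simp: L2_def)
  moreover have "norm (f x * cnj (g x)) \<le> (norm (f x))\<^sup>2 + (norm (g x))\<^sup>2" for x
  proof -
    have "2 * (norm (f x) * norm (g x)) \<le> (norm (f x))\<^sup>2 + (norm (g x))\<^sup>2"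
      using sum_squares_bound[of "norm (f x)" "norm (g x)"] by simp
    moreover have "0 \<le> norm (f x) * norm (g x)" by simp
    ultimately show ?thesis unfolding norm_mult complex_mod_cnj by linarith
  qed
  ultimately show ?thesis
    by (elim Bochner_Integration.integrable_bound) (auto intro!: always_eventually order.trans[OF _ abs_ge_self])
qed

section \<open>Inner product and norm\<close>

lemma inner_L2_self: "inner_L2 f f = of_real ((norm_L2 f)\<^sup>2)"
  unfolding inner_L2_def norm_L2_sq complex_norm_square[symmetric] of_real_power[symmetric]
  by (rule integral_complex_of_real)

lemma inner_L2_commute: "inner_L2 g f = cnj (inner_L2 f g)"
  unfolding inner_L2_def by (subst Bochner_Integration.integral_cnj[symmetric]) (simp add: mult.commute)

lemma inner_L2_add_left:
  "f \<in> L2 \<Longrightarrow> g \<in> L2 \<Longrightarrow> h \<in> L2 \<Longrightarrow> inner_L2 (\<lambda>x. f x + g x) h = inner_L2 f h + inner_L2 g h"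
  unfolding inner_L2_def by (simp add: distrib_right L2_inner_integrable)

lemma inner_L2_diff_left:
  "f \<in> L2 \<Longrightarrow> g \<in> L2 \<Longrightarrow> h \<in> L2 \<Longrightarrow> inner_L2 (\<lambda>x. f x - g x) h = inner_L2 f h - inner_L2 g h"
  unfolding inner_L2_def by (simp add: left_diff_distrib L2_inner_integrable)

lemma inner_L2_diff_right:
  "f \<in> L2 \<Longrightarrow> g \<in> L2 \<Longrightarrow> h \<in> L2 \<Longrightarrow> inner_L2 h (\<lambda>x. f x - g x) = inner_L2 h f - inner_L2 h g"
  unfolding inner_L2_def by (simp add: right_diff_distrib L2_inner_integrable)

lemma inner_L2_scale_left: "inner_L2 (\<lambda>x. c * f x) h = c * inner_L2 f h"
  unfolding inner_L2_def by (simp add: mult.assoc)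

lemma inner_L2_scale_right: "inner_L2 h (\<lambda>x. c * f x) = cnj c * inner_L2 h f"
  unfolding inner_L2_def by (simp add: mult.left_commute)

lemma inner_L2_sum_left:
  assumes "\<And>i. i \<in> I \<Longrightarrow> f i \<in> L2" "h \<in> L2"
  shows "inner_L2 (\<lambda>x. \<Sum>i\<in>I. f i x) h = (\<Sum>i\<in>I. inner_L2 (f i) h)"
  unfolding inner_L2_def using assms by (simp add: sum_distrib_right L2_inner_integrable)

lemma inner_L2_sum_right:
  assumes "\<And>i. i \<in> I \<Longrightarrow> f i \<in> L2" "h \<in> L2"
  shows "inner_L2 h (\<lambda>x. \<Sum>i\<in>I. f i x) = (\<Sum>i\<in>I. inner_L2 h (f i))"
  unfolding inner_L2_def using assms by (simp add: sum_distrib_left L2_inner_integrable)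

lemma norm_inner_L2_le:
  assumes "f \<in> L2" "g \<in> L2"
  shows "norm (inner_L2 f g) \<le> norm_L2 f * norm_L2 g"
proof -
  note [measurable] = assms[THEN L2_measurable]
  have "ennreal (norm (inner_L2 f g)) \<le> (\<integral>\<^sup>+x. ennreal (norm (f x * cnj (g x))) \<partial>lebesgue)"
    unfolding inner_L2_def by (intro integral_norm_bound_ennreal L2_inner_integrable assms)
  also have "\<dots> = (\<integral>\<^sup>+x. ennreal (norm (f x)) * ennreal (norm (g x)) \<partial>lebesgue)"
    by (simp add: norm_mult ennreal_mult)
  finally have "(ennreal (norm (inner_L2 f g)))\<^sup>2 \<le> (\<integral>\<^sup>+x. ennreal (norm (f x)) * ennreal (norm (g x)) \<partial>lebesgue)\<^sup>2"
    by (intro power_mono) auto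
  also have "\<dots> \<le> (\<integral>\<^sup>+x. (ennreal (norm (f x)))\<^sup>2 \<partial>lebesgue) * (\<integral>\<^sup>+x. (ennreal (norm (g x)))\<^sup>2 \<partial>lebesgue)"
    by (intro Cauchy_Schwarz_nn_integral) measurable
  also have "\<dots> = ennreal ((norm_L2 f * norm_L2 g)\<^sup>2)"
    using assms by (simp add: ennreal_power nn_integral_norm_L2 power_mult_distrib ennreal_mult)
  finally have "(norm (inner_L2 f g))\<^sup>2 \<le> (norm_L2 f * norm_L2 g)\<^sup>2"
    by (simp add: ennreal_power)
  then show ?thesis by (rule power2_le_imp_le) simp
qed

text \<open>With s = f + g, Cauchy-Schwarz bounds both terms of <s, s> = <f, s> + <g, s>; then one
  factor ||s|| cancels.\<close>

lemma norm_L2_triangle: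
  assumes "f \<in> L2" "g \<in> L2"
  shows "norm_L2 (\<lambda>x. f x + g x) \<le> norm_L2 f + norm_L2 g"
proof -
  let ?s = "\<lambda>x. f x + g x"
  have s: "?s \<in> L2" using assms by (rule L2_add)
  have "(norm_L2 ?s)\<^sup>2 = norm (inner_L2 ?s ?s)"
    by (simp add: inner_L2_self norm_power)
  also have "\<dots> = norm (inner_L2 f ?s + inner_L2 g ?s)"
    using assms s by (simp add: inner_L2_add_left)
  also have "\<dots> \<le> norm_L2 f * norm_L2 ?s + norm_L2 g * norm_L2 ?s"
    using assms s by (intro norm_triangle_le add_mono norm_inner_L2_le)
  finally have "norm_L2 ?s * norm_L2 ?s \<le> (norm_L2 f + norm_L2 g) * norm_L2 ?s"
    by (simp add: power2_eq_square algebra_simps)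
  then show ?thesis
    using norm_L2_nonneg[of ?s] norm_L2_nonneg[of f] norm_L2_nonneg[of g]
    by (cases "norm_L2 ?s = 0") (simp_all add: mult_le_cancel_right)
qed

lemma norm_L2_scale: "norm_L2 (\<lambda>x. c * f x) = norm c * norm_L2 f"
  unfolding norm_L2_def by (simp add: norm_mult power_mult_distrib real_sqrt_mult)

lemma norm_L2_minus_commute: "norm_L2 (\<lambda>x. f x - g x) = norm_L2 (\<lambda>x. g x - f x)"
  unfolding norm_L2_def by (simp add: norm_minus_commute)

lemma norm_L2_triangle_diff:
  assumes "f \<in> L2" "g \<in> L2" "h \<in> L2"
  shows "norm_L2 (\<lambda>x. f x - h x) \<le> norm_L2 (\<lambda>x. f x - g x) + norm_L2 (\<lambda>x. g x - h x)"
  using norm_L2_triangle[of "\<lambda>x. f x - g x" "\<lambda>x. g x - h x"] assms by (simp add: L2_diff)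

lemma norm_L2_diff_le:
  assumes "f \<in> L2" "g \<in> L2"
  shows "norm_L2 (\<lambda>x. f x - g x) \<le> norm_L2 f + norm_L2 g"
  using norm_L2_triangle_diff[of f "\<lambda>x. 0" g] assms norm_L2_minus_commute[of "\<lambda>x. 0" g] by simp

lemma norm_L2_triangle_ineq3:
  assumes "f \<in> L2" "g \<in> L2"
  shows "\<bar>norm_L2 f - norm_L2 g\<bar> \<le> norm_L2 (\<lambda>x. f x - g x)"
  using norm_L2_triangle_diff[of f g "\<lambda>x. 0"] norm_L2_triangle_diff[of g f "\<lambda>x. 0"]
    norm_L2_minus_commute[of f g] assms by simp

section \<open>Continuity of norm and inner product\<close>

lemma tendsto_L2_norm:
  assumes "tendsto_L2 s f" shows "(\<lambda>n. norm_L2 (s n)) \<longlonglongrightarrow> norm_L2 f"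
proof -
  have "(\<lambda>n. norm_L2 (\<lambda>x. s n x - f x)) \<longlonglongrightarrow> 0"
    using assms by (simp add: tendsto_L2_def)
  then have "(\<lambda>n. norm_L2 (s n) - norm_L2 f) \<longlonglongrightarrow> 0"
    using assms norm_L2_triangle_ineq3
    by (rule_tac Lim_null_comparison[OF always_eventually, OF allI, rotated]) (auto simp: tendsto_L2_def)
  then show ?thesis by (simp add: LIM_zero_iff)
qed

lemma tendsto_L2_inner_left:
  assumes "tendsto_L2 s f" "h \<in> L2" shows "(\<lambda>n. inner_L2 (s n) h) \<longlonglongrightarrow> inner_L2 f h"
proof -
  have "(\<lambda>n. norm_L2 (\<lambda>x. s n x - f x) * norm_L2 h) \<longlonglongrightarrow> 0"
    using assms unfolding tendsto_L2_def by (intro tendsto_mult_left_zero) auto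
  moreover have "norm (inner_L2 (s n) h - inner_L2 f h) \<le> norm_L2 (\<lambda>x. s n x - f x) * norm_L2 h" for n
    using assms norm_inner_L2_le[of "\<lambda>x. s n x - f x" h]
    by (simp add: tendsto_L2_def inner_L2_diff_left L2_diff)
  ultimately have "(\<lambda>n. inner_L2 (s n) h - inner_L2 f h) \<longlonglongrightarrow> 0"
    by (rule Lim_null_comparison[OF always_eventually, OF allI, rotated])
  then show ?thesis by (simp add: LIM_zero_iff)
qed

lemma tendsto_L2_inner_right:
  assumes "tendsto_L2 s f" "h \<in> L2" shows "(\<lambda>n. inner_L2 h (s n)) \<longlonglongrightarrow> inner_L2 h f"
  using tendsto_cnj[OF tendsto_L2_inner_left[OF assms]] by (simp add: inner_L2_commute[symmetric])


section \<open>Null vectors and completeness\<close>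

lemma norm_L2_eq_0_iff:
  assumes "f \<in> L2" shows "norm_L2 f = 0 \<longleftrightarrow> (AE x in lebesgue. f x = 0)"
  using integral_nonneg_eq_0_iff_AE[OF L2_integrable_norm_sq[OF assms]]
  by (simp add: norm_L2_def)

text \<open>Riesz-Fischer: a subsequence with geometrically small increments converges almost
  everywhere, and Fatou's lemma shows that its pointwise limit is the norm limit of the whole
  sequence.\<close>

lemma L2_complete:
  fixes s :: "nat \<Rightarrow> 'a::euclidean_space \<Rightarrow> complex"
  assumes s: "\<And>n. s n \<in> L2"
    and cauchy: "\<And>e. 0 < e \<Longrightarrow> \<exists>N. \<forall>m\<ge>N. \<forall>n\<ge>N. norm_L2 (\<lambda>x. s m x - s n x) < e"
  obtains f where "tendsto_L2 s f"
proof -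
  note [measurable] = L2_measurable[OF s]
  have "\<exists>N. \<forall>m\<ge>N. \<forall>n\<ge>N. norm_L2 (\<lambda>x. s m x - s n x) < (1/4)^k" for k
    by (rule cauchy) simp
  then obtain N where N: "\<And>k m n. m \<ge> N k \<Longrightarrow> n \<ge> N k \<Longrightarrow> norm_L2 (\<lambda>x. s m x - s n x) < (1/4)^k"
    by metis
  \<comment> \<open>The sum makes \<open>r\<close> nondecreasing and at least \<open>N k\<close>;
    the extra \<open>k\<close> sends the indices to infinity.\<close>
  define r where "r k = (\<Sum>i\<le>k. N i) + k" for k
  have r_ge: "N k \<le> r k" "k \<le> r k" "r k \<le> r (Suc k)" for k
    using member_le_sum[of k "{..k}" N] by (auto simp: r_def)
  define u where "u k = s (r k)" for k
  have u: "u k \<in> L2" for k by (simp add: u_def s)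
  note [measurable] = L2_measurable[OF u]
  have step: "norm_L2 (\<lambda>x. u (Suc k) x - u k x) < (1/4)^k" for k
    unfolding u_def using r_ge[of k] by (intro N) auto
  \<comment> \<open>The squared increments have integral at most 16^-k, so the weight 4^k leaves a
    convergent series. Where the weighted series is finite, the increments are O(2^-k), hence
    summable.\<close>
  let ?d = "\<lambda>k x. ennreal (4^k * (norm (u (Suc k) x - u k x))\<^sup>2)"
  have int_d: "(\<integral>\<^sup>+x. ?d k x \<partial>lebesgue) \<le> ennreal ((1/4)^k)" for k
  proof -
    have "(\<integral>\<^sup>+x. ?d k x \<partial>lebesgue) = ennreal (4^k) * (\<integral>\<^sup>+x. ennreal ((norm (u (Suc k) x - u k x))\<^sup>2) \<partial>lebesgue)"
      by (subst nn_integral_cmult[symmetric]) (auto simp: ennreal_mult)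
    also have "\<dots> = ennreal (4^k * (norm_L2 (\<lambda>x. u (Suc k) x - u k x))\<^sup>2)"
      by (subst nn_integral_norm_L2) (auto simp: u L2_diff ennreal_mult)
    also have "\<dots> \<le> ennreal (4^k * ((1/4)^k)\<^sup>2)"
      using step[of k] by (intro ennreal_leI mult_left_mono power_mono) auto
    also have "4^k * ((1/4)^k)\<^sup>2 = ((1/4)^k::real)"
      by (simp add: power2_eq_square power_divide)
    finally show ?thesis .
  qed
  have "(\<integral>\<^sup>+x. (\<Sum>k. ?d k x) \<partial>lebesgue) = (\<Sum>k. \<integral>\<^sup>+x. ?d k x \<partial>lebesgue)"
    by (rule nn_integral_suminf) measurable
  also have "\<dots> \<le> (\<Sum>k. ennreal ((1/4)^k))"
    by (intro suminf_le int_d) auto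
  also have "\<dots> = ennreal (\<Sum>k. (1/4)^k)"
    by (intro suminf_ennreal2 summable_geometric) auto
  also have "\<dots> < \<infinity>" by simp
  finally have "AE x in lebesgue. (\<Sum>k. ?d k x) \<noteq> \<infinity>"
    by (intro nn_integral_PInf_AE) auto
  then have conv: "AE x in lebesgue. convergent (\<lambda>k. u k x)"
  proof (rule AE_mp, intro AE_I2 impI)
    fix x assume fin: "(\<Sum>k. ?d k x) \<noteq> \<infinity>"
    define M where "M = enn2real (\<Sum>k. ?d k x)"
    have M: "(\<Sum>k. ?d k x) = ennreal M" "0 \<le> M"
      using fin by (auto simp: M_def less_top)
    have "norm (u (Suc k) x - u k x) \<le> sqrt M * (1/2)^k" for k
    proof -
      have four: "(2^k)\<^sup>2 = (4::real)^k"
        by (simp add: power2_eq_square flip: power_mult_distrib)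
      have "(\<Sum>j\<in>{k}. ?d j x) \<le> (\<Sum>k. ?d k x)"
        by (intro sum_le_suminf) (rule summableI, simp_all)
      then have "?d k x \<le> (\<Sum>k. ?d k x)"
        by (simp only: sum.insert finite.emptyI empty_iff sum.empty add_0_right not_False_eq_True)
      then have "4^k * (norm (u (Suc k) x - u k x))\<^sup>2 \<le> M"
        using M by (simp add: ennreal_le_iff)
      then have "(2^k * norm (u (Suc k) x - u k x))\<^sup>2 \<le> M"
        by (simp only: power_mult_distrib four)
      then have "2^k * norm (u (Suc k) x - u k x) \<le> sqrt M"
        by (rule real_le_rsqrt)
      then show ?thesis by (simp add: field_simps power_divide)
    qed
    then have "summable (\<lambda>k. u (Suc k) x - u k x)"
      by (intro summable_comparison_test'[OF summable_mult[OF summable_geometric]]) auto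
    then have "convergent (\<lambda>n. \<Sum>k<n. u (Suc k) x - u k x)"
      by (simp add: summable_iff_convergent)
    then have "convergent (\<lambda>n. u n x - u 0 x)"
      by (simp only: sum_lessThan_telescope[of "\<lambda>k. u k x"])
    then show "convergent (\<lambda>n. u n x)"
      by (subst (asm) convergent_diff_const_right_iff)
  qed
  \<comment> \<open>On the null set of divergence \<open>f\<close> takes the unspecified value of
    \<open>lim\<close>, which is harmless; the definition gives measurability at once.\<close>
  define f where "f x = lim (\<lambda>k. u k x)" for x
  have f_meas [measurable]: "f \<in> borel_measurable lebesgue"
    unfolding f_def by measurable
  have lim: "AE x in lebesgue. (\<lambda>k. u k x) \<longlonglongrightarrow> f x"
    using conv by (rule AE_mp) (auto simp: f_def convergent_LIMSEQ_iff)
  \<comment> \<open>Fatou's lemma in the second argument, along the subsequence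
    \<open>u\<close>.\<close>
  have bound: "(\<integral>\<^sup>+x. ennreal ((norm (s n x - f x))\<^sup>2) \<partial>lebesgue) \<le> ennreal (e\<^sup>2)"
    if e: "0 < e" and M: "\<forall>m\<ge>M. \<forall>n\<ge>M. norm_L2 (\<lambda>x. s m x - s n x) < e" and n: "n \<ge> M" for e n M
  proof -
    have "(\<integral>\<^sup>+x. ennreal ((norm (s n x - f x))\<^sup>2) \<partial>lebesgue)
        = (\<integral>\<^sup>+x. liminf (\<lambda>k. ennreal ((norm (s n x - u k x))\<^sup>2)) \<partial>lebesgue)"
    proof (intro nn_integral_cong_AE, rule AE_mp[OF lim], intro AE_I2 impI)
      fix x assume *: "(\<lambda>k. u k x) \<longlonglongrightarrow> f x"
      have "(\<lambda>k. ennreal ((norm (s n x - u k x))\<^sup>2)) \<longlonglongrightarrow> ennreal ((norm (s n x - f x))\<^sup>2)"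
        by (intro tendsto_intros *)
      then show "ennreal ((norm (s n x - f x))\<^sup>2) = liminf (\<lambda>k. ennreal ((norm (s n x - u k x))\<^sup>2))"
        by (rule lim_imp_Liminf[OF trivial_limit_sequentially, symmetric])
    qed
    also have "\<dots> \<le> liminf (\<lambda>k. \<integral>\<^sup>+x. ennreal ((norm (s n x - u k x))\<^sup>2) \<partial>lebesgue)"
      by (intro nn_integral_liminf) measurable
    also have "\<dots> = liminf (\<lambda>k. ennreal ((norm_L2 (\<lambda>x. s n x - u k x))\<^sup>2))"
      by (subst nn_integral_norm_L2) (auto intro!: L2_diff s u)
    also have "\<dots> \<le> ennreal (e\<^sup>2)"
    proof (rule order_trans[OF Liminf_le_Limsup Limsup_bounded])
      have "norm_L2 (\<lambda>x. s n x - u k x) \<le> e" if "k \<ge> M" for k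
        using M n that r_ge(2)[of k] unfolding u_def by (meson less_imp_le order_trans)
      then show "\<forall>\<^sub>F k in sequentially. ennreal ((norm_L2 (\<lambda>x. s n x - u k x))\<^sup>2) \<le> ennreal (e\<^sup>2)"
        by (intro eventually_sequentiallyI[of M] ennreal_leI power_mono) auto
    qed auto
    finally show ?thesis .
  qed
  obtain M0 where M0: "\<forall>m\<ge>M0. \<forall>n\<ge>M0. norm_L2 (\<lambda>x. s m x - s n x) < 1"
    using cauchy[of 1] by auto
  have "(\<lambda>x. s M0 x - f x) \<in> L2"
    by (rule L2_I) (use bound[OF _ M0, of M0] in \<open>auto simp: less_top[symmetric] top_unique\<close>)
  then have f: "f \<in> L2"
    using L2_diff[OF s[of M0], of "\<lambda>x. s M0 x - f x"] by simp
  have "(\<lambda>n. norm_L2 (\<lambda>x. s n x - f x)) \<longlonglongrightarrow> 0"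
  proof (rule LIMSEQ_I)
    fix e :: real assume e: "0 < e"
    then obtain M where M: "\<forall>m\<ge>M. \<forall>n\<ge>M. norm_L2 (\<lambda>x. s m x - s n x) < e/2"
      using cauchy[of "e/2"] by auto
    have "norm_L2 (\<lambda>x. s n x - f x) \<le> e/2" if "n \<ge> M" for n
    proof -
      have "ennreal ((norm_L2 (\<lambda>x. s n x - f x))\<^sup>2) \<le> ennreal ((e/2)\<^sup>2)"
        using bound[OF _ M that] e
        by (subst nn_integral_norm_L2[symmetric]) (simp_all add: L2_diff s f)
      then show ?thesis
        using e by (simp add: ennreal_le_iff power2_le_iff_abs_le)
    qed
    then show "\<exists>no. \<forall>n\<ge>no. norm (norm_L2 (\<lambda>x. s n x - f x) - 0) < e"
      using e by (intro exI[of _ M]) force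
  qed
  then show ?thesis using that s f by (auto simp: tendsto_L2_def)
qed

section \<open>Translations and phases\<close>

lemma measurable_lebesgue_translation [measurable]:
  "(\<lambda>x. x + a) \<in> (lebesgue :: 'a::euclidean_space measure) \<rightarrow>\<^sub>M lebesgue"
  using lebesgue_affine_measurable[of "\<lambda>_. 1" a] by (simp add: euclidean_representation add.commute)

lemma lebesgue_distr_translation:
  "distr lebesgue lebesgue (\<lambda>x. x + a) = (lebesgue :: 'a::euclidean_space measure)"
  using lebesgue_affine_euclidean[of "\<lambda>_. 1" a]
  by (simp add: euclidean_representation add.commute density_1)

lemma borel_measurable_translate:
  assumes "f \<in> borel_measurable lebesgue" shows "(\<lambda>x. f (x + a)) \<in> borel_measurable lebesgue"
  using measurable_comp[OF measurable_lebesgue_translation assms] by (simp add: comp_def)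

lemma nn_integral_translate:
  assumes "f \<in> borel_measurable lebesgue"
  shows "(\<integral>\<^sup>+x. f (x + a) \<partial>lebesgue) = (\<integral>\<^sup>+x. f x \<partial>lebesgue)"
  using nn_integral_distr[OF measurable_lebesgue_translation, of f a] assms
  by (simp add: lebesgue_distr_translation)

lemma integral_translate:
  fixes f :: "'a::euclidean_space \<Rightarrow> 'b::{banach, second_countable_topology}"
  assumes "f \<in> borel_measurable lebesgue"
  shows "(LINT x|lebesgue. f (x + a)) = (LINT x|lebesgue. f x)"
  using integral_distr[OF measurable_lebesgue_translation, of f a] assms
  by (simp add: lebesgue_distr_translation)

lemma L2_translate:
  assumes "f \<in> L2" shows "(\<lambda>x. f (x + a)) \<in> L2"
proof (rule L2_I)
  note [measurable] = L2_measurable[OF assms]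
  show "(\<lambda>x. f (x + a)) \<in> borel_measurable lebesgue"
    by (rule borel_measurable_translate) measurable
  show "(\<integral>\<^sup>+x. ennreal ((norm (f (x + a)))\<^sup>2) \<partial>lebesgue) < \<infinity>"
    by (subst nn_integral_translate[of "\<lambda>x. ennreal ((norm (f x))\<^sup>2)"])
       (auto simp: nn_integral_norm_L2 assms)
qed

lemma inner_L2_translate:
  assumes "f \<in> L2" "g \<in> L2"
  shows "inner_L2 (\<lambda>x. f (x + a)) (\<lambda>x. g (x + a)) = inner_L2 f g"
proof -
  note [measurable] = assms[THEN L2_measurable]
  show ?thesis unfolding inner_L2_def
    by (rule integral_translate[of "\<lambda>x. f x * cnj (g x)"]) measurable
qed

lemma norm_L2_translate:
  assumes "f \<in> L2" shows "norm_L2 (\<lambda>x. f (x + a)) = norm_L2 f"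
  using inner_L2_translate[OF assms assms, of a] norm_L2_nonneg[of f]
  by (simp add: inner_L2_self flip: of_real_power)

section \<open>Unimodular factors and phases\<close>

lemma L2_unimodular:
  assumes "f \<in> L2" "c \<in> borel_measurable lebesgue" "\<And>x. norm (c x) = 1"
  shows "(\<lambda>x. c x * f x) \<in> L2"
proof -
  note [measurable] = L2_measurable[OF assms(1)] assms(2)
  show ?thesis
    by (rule L2_dominated[OF assms(1)]) (auto simp: assms(3) norm_mult)
qed

lemma inner_L2_unimodular:
  assumes "\<And>x. norm (c x) = 1"
  shows "inner_L2 (\<lambda>x. c x * f x) (\<lambda>x. c x * g x) = inner_L2 f g"
proof -
  have 1: "c x * cnj (c x) = 1" for x
    using assms[of x] by (simp add: complex_norm_square[symmetric])
  have "c x * f x * cnj (c x * g x) = f x * cnj (g x)" for x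
  proof -
    have "c x * f x * cnj (c x * g x) = (c x * cnj (c x)) * (f x * cnj (g x))"
      by simp
    then show ?thesis by (simp only: 1 mult_1)
  qed
  then show ?thesis unfolding inner_L2_def by (simp only:)
qed

lemma norm_L2_unimodular:
  assumes "\<And>x. norm (c x) = 1" shows "norm_L2 (\<lambda>x. c x * f x) = norm_L2 f"
  by (simp add: norm_L2_def norm_mult assms)

text \<open>Period 1 is the normalisation under which translations and modulations by integer
  vectors commute exactly.\<close>

definition phase :: "real \<Rightarrow> complex" where
  "phase \<theta> = cis (2 * pi * \<theta>)"

lemma phase_exp: "exp (2 * complex_of_real pi * \<i> * complex_of_real \<theta>) = phase \<theta>"
  by (simp add: phase_def cis_conv_exp mult_ac)

lemma norm_phase [simp]: "norm (phase \<theta>) = 1"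
  by (simp add: phase_def)

lemma phase_0 [simp]: "phase 0 = 1"
  by (simp add: phase_def)

lemma phase_add: "phase (a + b) = phase a * phase b"
  by (simp add: phase_def cis_mult ring_distribs)

lemma cnj_phase: "cnj (phase a) = phase (- a)"
  by (simp add: phase_def cis_cnj)

lemma phase_Ints: "a \<in> \<int> \<Longrightarrow> phase a = 1"
  unfolding phase_def by (auto elim!: Ints_cases simp: cis_multiple_2pi)

lemma continuous_phase [continuous_intros]:
  "continuous_on S f \<Longrightarrow> continuous_on S (\<lambda>x. phase (f x))"
  unfolding phase_def by (intro continuous_intros)

lemma tendsto_phase [tendsto_intros]:
  "(f \<longlongrightarrow> a) F \<Longrightarrow> ((\<lambda>x. phase (f x)) \<longlongrightarrow> phase a) F"
  unfolding phase_def by (intro tendsto_intros)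

lemma borel_measurable_phase [measurable (raw)]:
  "f \<in> borel_measurable M \<Longrightarrow> (\<lambda>x. phase (f x)) \<in> borel_measurable M"
  by (rule borel_measurable_continuous_on[OF continuous_phase[OF continuous_on_id]])

lemma borel_measurable_lebesgue_continuous:
  "continuous_on UNIV f \<Longrightarrow> f \<in> borel_measurable lebesgue"
  by (intro measurable_completion) (simp add: borel_measurable_continuous_onI)

lemma borel_measurable_phase_inner [measurable]:
  "(\<lambda>x. phase (w \<bullet> x)) \<in> borel_measurable lebesgue"
  by (intro borel_measurable_lebesgue_continuous continuous_intros)

lemma norm_phase_minus_1_le: "norm (phase \<theta> - 1) \<le> 2 * pi * \<bar>\<theta>\<bar>"
  using iexp_approx1[of "2*pi*\<theta>" 0] by (simp add: phase_def cis_conv_exp abs_mult)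

lemma norm_phase_approx: "norm (phase \<theta> - 1 - 2 * pi * \<i> * \<theta>) \<le> (2 * pi * \<theta>)\<^sup>2 / 2"
  using iexp_approx1[of "2*pi*\<theta>" 1]
  by (simp add: phase_def cis_conv_exp mult_ac diff_diff_eq power2_eq_square)

text \<open>Second-order Taylor remainder divided by \<open>t\<close>. It serves twice: pointwise
  for the difference quotients of the modulation, and with the square of the time step in place of
  \<open>t\<close> for the scalar of the commutator.\<close>

lemma phase_difference_quotient:
  assumes "t \<noteq> 0"
  shows "norm ((phase (t * a) - 1) / t - 2 * pi * \<i> * a) \<le> 2 * (pi * a)\<^sup>2 * \<bar>t\<bar>"
proof -
  have "(phase (t * a) - 1) / t - 2 * pi * \<i> * a = (phase (t * a) - 1 - 2 * pi * \<i> * (t * a)) / t"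
    using assms by (simp add: field_simps)
  then have "norm ((phase (t * a) - 1) / t - 2 * pi * \<i> * a)
      = norm (phase (t * a) - 1 - 2 * pi * \<i> * (t * a)) / \<bar>t\<bar>"
    by (simp add: norm_divide)
  also have "\<dots> \<le> (2 * pi * (t * a))\<^sup>2 / 2 / \<bar>t\<bar>"
    using norm_phase_approx[of "t * a"] by (intro divide_right_mono) simp_all
  also have "\<dots> = 2 * (pi * a)\<^sup>2 * \<bar>t\<bar>"
    using assms by (auto simp: power2_eq_square field_simps abs_if)
  finally show ?thesis .
qed

section \<open>Quadratic forms\<close>

text \<open>Cauchy-Schwarz for a semidefinite form: pairing with a fixed \<open>z\<close> where the
  form is positive, divided by the square root of its value there, is a linear functional whose
  square is dominated by the form.\<close>

lemma positive_quadratic_form_ge_square: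
  fixes \<omega> :: "'a::euclidean_space \<Rightarrow> real"
  assumes "positive_quadratic_form \<omega>"
  obtains v where "v \<noteq> 0" "\<And>x. (v \<bullet> x)\<^sup>2 \<le> \<omega> x"
proof -
  obtain b where b: "bilinear b" "\<And>x. \<omega> x = b x x"
    using assms by (auto simp: positive_quadratic_form_def quadratic_form_def)
  obtain z where "\<omega> z \<noteq> 0" and nonneg: "\<And>x. 0 \<le> \<omega> x"
    using assms by (auto simp: positive_quadratic_form_def)
  then have z: "0 < \<omega> z" by (simp add: less_le)
  \<comment> \<open>The bilinear map \<open>b\<close> may be asymmetric; \<open>L\<close> is twice
    the pairing of its symmetric part with \<open>z\<close>. Below, \<open>adjoint L 1\<close> is
    the vector representing this functional.\<close>
  define L where "L y = b z y + b y z" for y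
  have "linear L"
    unfolding L_def using b(1) by (intro linear_compose_add) (auto simp: bilinear_def)
  then have w: "adjoint L 1 \<bullet> y = L y" for y
    using adjoint_works[of L y 1] by (simp add: inner_commute)
  define v where "v = (1 / (2 * sqrt (\<omega> z))) *\<^sub>R adjoint L 1"
  have Lz: "L z = 2 * \<omega> z" by (simp add: L_def b)
  show ?thesis
  proof (rule that[of v])
    have "adjoint L 1 \<noteq> 0" using w[of z] Lz z by auto
    then show "v \<noteq> 0" using z by (simp add: v_def)
    fix y
    \<comment> \<open>The minimiser of the quadratic polynomial t \<mapsto>
      \<open>\<omega> (y - t *\<^sub>R z)\<close>.\<close>
    define t where "t = L y / (2 * \<omega> z)"
    have "0 \<le> \<omega> (y - t *\<^sub>R z)" by (rule nonneg)
    also have "\<dots> = \<omega> y - t * L y + t\<^sup>2 * \<omega> z"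
      unfolding b(2) L_def using b(1)
      by (simp add: bilinear_lsub bilinear_rsub bilinear_lmul bilinear_rmul algebra_simps power2_eq_square)
    also have "\<dots> = \<omega> y - (v \<bullet> y)\<^sup>2"
      using z by (simp add: v_def w t_def field_simps power2_eq_square)
    finally show "(v \<bullet> y)\<^sup>2 \<le> \<omega> y" by simp
  qed
qed

section \<open>Frames and biorthogonal systems\<close>

text \<open>If the frame without \<open>\<phi> k\<close> has no lower bound, there are \<open>h\<^sub>n\<close> with \<open>\<langle>h\<^sub>n, \<phi> k\<rangle> = 1\<close> whose
  remaining coefficients tend to 0 in \<open>\<ell>\<^sup>2\<close>; the lower bound of the full frame makes \<open>h\<^sub>n\<close> a
  Cauchy sequence, and its limit is the required vector.\<close>

lemma exact_frame_biorthogonal: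
  assumes exact: "is_exact_frame I \<phi>" and k: "k \<in> I"
  obtains d where "d \<in> L2" "inner_L2 (\<phi> k) d = 1"
    "\<And>j. j \<in> I \<Longrightarrow> j \<noteq> k \<Longrightarrow> inner_L2 (\<phi> j) d = 0"
proof -
  define S where "S J f = (\<Sum>\<^sub>\<infinity>j\<in>J. (norm (inner_L2 f (\<phi> j)))\<^sup>2)" for J f
  obtain A B where phi: "\<And>j. j \<in> I \<Longrightarrow> \<phi> j \<in> L2" and A: "0 < A" "A \<le> B"
    and summ: "\<And>f. f \<in> L2 \<Longrightarrow> (\<lambda>j. (norm (inner_L2 f (\<phi> j)))\<^sup>2) summable_on I"
    and lower: "\<And>f. f \<in> L2 \<Longrightarrow> A * (norm_L2 f)\<^sup>2 \<le> S I f"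
    and upper: "\<And>f. f \<in> L2 \<Longrightarrow> S I f \<le> B * (norm_L2 f)\<^sup>2"
    using exact unfolding is_exact_frame_def is_frame_def S_def by blast
  let ?J = "I - {k}"
  have summJ: "(\<lambda>j. (norm (inner_L2 f (\<phi> j)))\<^sup>2) summable_on ?J" if "f \<in> L2" for f
    using summ[OF that] by (rule summable_on_subset_banach) auto
  have split: "S I f = (norm (inner_L2 f (\<phi> k)))\<^sup>2 + S ?J f" if "f \<in> L2" for f
    unfolding S_def using k summJ[OF that]
    by (subst infsum_insert[symmetric]) (auto simp: insert_absorb)
  have S_nonneg: "0 \<le> S J f" for J f
    unfolding S_def by (intro infsum_nonneg) auto
  have le_S: "(norm (inner_L2 f (\<phi> j)))\<^sup>2 \<le> S ?J f" if "f \<in> L2" "j \<in> ?J" for f j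
  proof -
    have "(\<Sum>j\<in>{j}. (norm (inner_L2 f (\<phi> j)))\<^sup>2) \<le> S ?J f"
      unfolding S_def by (intro finite_sum_le_infsum summJ) (use that in auto)
    then show ?thesis by simp
  qed
  have "\<exists>h\<in>L2. inner_L2 h (\<phi> k) = 1 \<and> S ?J h \<le> 2 / (real n + 2)" for n
  proof -
    \<comment> \<open>The denominator is at least 2, so \<open>A'\<close> uses up at most half of
      the lower bound \<open>A\<close>; the other half bounds the norm by the coefficient at
      \<open>k\<close>. Normalising that coefficient to 1 turns \<open>A'\<close> into the bound 2 /
      (n + 2).\<close>
    define A' where "A' = A / (real n + 2)"
    have A': "0 < A'" "A' \<le> A / 2" "A' \<le> B" 
      using A by (auto simp: A'_def field_simps intro: order_trans)
    have "\<not> is_frame ?J \<phi>" using exact k by (auto simp: is_exact_frame_def)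
    \<comment> \<open>Membership, summability and the upper bound survive the removal of
      \<open>k\<close>, so it is the lower bound with constant \<open>A'\<close> that must
      fail.\<close>
    then have "\<not> (\<forall>f\<in>L2. A' * (norm_L2 f)\<^sup>2 \<le> S ?J f \<and> S ?J f \<le> B * (norm_L2 f)\<^sup>2)"
      unfolding is_frame_def S_def using phi summJ A' by blast
    moreover have "S ?J f \<le> B * (norm_L2 f)\<^sup>2" if "f \<in> L2" for f
      using upper[OF that] split[OF that] by (smt (verit) zero_le_power2)
    ultimately obtain f where f: "f \<in> L2" "S ?J f < A' * (norm_L2 f)\<^sup>2"
      by force
    define c where "c = inner_L2 f (\<phi> k)"
    have "A * (norm_L2 f)\<^sup>2 \<le> (norm c)\<^sup>2 + A' * (norm_L2 f)\<^sup>2"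
      using lower[OF f(1)] split[OF f(1)] f(2) by (simp add: c_def)
    moreover have "A' * (norm_L2 f)\<^sup>2 \<le> A / 2 * (norm_L2 f)\<^sup>2"
      using A' by (intro mult_right_mono) auto
    ultimately have c: "A / 2 * (norm_L2 f)\<^sup>2 \<le> (norm c)\<^sup>2" by (simp add: field_simps)
    have "0 < (norm_L2 f)\<^sup>2"
      using f(2) S_nonneg[of ?J f] A' by (smt (verit) mult_nonneg_nonneg zero_less_mult_iff zero_le_power2)
    then have "0 < (norm c)\<^sup>2" using c A by (smt (verit) half_gt_zero mult_pos_pos)
    then have c0: "c \<noteq> 0" by auto
    define h where "h = (\<lambda>x. inverse c * f x)"
    have h: "h \<in> L2" unfolding h_def by (rule L2_scale[OF f(1)])
    have ih: "inner_L2 h p = inverse c * inner_L2 f p" for p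
      by (simp add: h_def inner_L2_scale_left)
    have "S ?J h = S ?J f / (norm c)\<^sup>2"
      unfolding S_def ih norm_mult power_mult_distrib
      by (simp only: infsum_cmult_right' norm_inverse power_inverse divide_inverse mult.commute)
    also have "\<dots> \<le> A' * (norm_L2 f)\<^sup>2 / (norm c)\<^sup>2"
      using f(2) by (intro divide_right_mono) auto
    also have "\<dots> \<le> A' * (2 / A)"
      using c A A' \<open>0 < (norm c)\<^sup>2\<close> by (simp add: field_simps)
    also have "\<dots> = 2 / (real n + 2)"
      using A by (simp add: A'_def)
    finally show ?thesis using h ih[of "\<phi> k"] c0 by (intro bexI[of _ h]) (auto simp: c_def[symmetric])
  qed
  then obtain h where h: "\<And>n. h n \<in> L2" "\<And>n. inner_L2 (h n) (\<phi> k) = 1"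
      "\<And>n. S ?J (h n) \<le> 2 / (real n + 2)"
    by metis
  \<comment> \<open>Both functions have coefficient 1 at \<open>k\<close>, so their difference has
    coefficient 0 there, and the full frame sum is the sum over the other indices.\<close>
  have dist: "A * (norm_L2 (\<lambda>x. h m x - h n x))\<^sup>2 \<le> 4 / (real m + 2) + 4 / (real n + 2)" for m n
  proof -
    let ?f = "\<lambda>x. h m x - h n x"
    have f: "?f \<in> L2" by (intro L2_diff h)
    have "A * (norm_L2 ?f)\<^sup>2 \<le> S I ?f" by (rule lower[OF f])
    also have "\<dots> = S ?J ?f"
      using h phi[OF k] by (simp add: split[OF f] inner_L2_diff_left)
    also have "\<dots> \<le> (\<Sum>\<^sub>\<infinity>j\<in>?J. 2 * (norm (inner_L2 (h m) (\<phi> j)))\<^sup>2 + 2 * (norm (inner_L2 (h n) (\<phi> j)))\<^sup>2)"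
      unfolding S_def
    proof (intro infsum_mono summJ f summable_on_add summable_on_cmult_right h)
      fix j assume "j \<in> ?J"
      then have "norm (inner_L2 ?f (\<phi> j)) \<le> norm (inner_L2 (h m) (\<phi> j)) + norm (inner_L2 (h n) (\<phi> j))"
        using h phi by (simp add: inner_L2_diff_left norm_triangle_ineq4)
      then have "(norm (inner_L2 ?f (\<phi> j)))\<^sup>2 \<le> (norm (inner_L2 (h m) (\<phi> j)) + norm (inner_L2 (h n) (\<phi> j)))\<^sup>2"
        by (intro power_mono) auto
      also have "\<dots> \<le> 2 * (norm (inner_L2 (h m) (\<phi> j)))\<^sup>2 + 2 * (norm (inner_L2 (h n) (\<phi> j)))\<^sup>2"
        using sum_squares_bound[of "norm (inner_L2 (h m) (\<phi> j))" "norm (inner_L2 (h n) (\<phi> j))"]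
        by (simp add: power2_sum)
      finally show "(norm (inner_L2 ?f (\<phi> j)))\<^sup>2 \<le> 2 * (norm (inner_L2 (h m) (\<phi> j)))\<^sup>2 + 2 * (norm (inner_L2 (h n) (\<phi> j)))\<^sup>2" .
    qed
    also have "\<dots> = 2 * S ?J (h m) + 2 * S ?J (h n)"
      unfolding S_def
      by (subst infsum_add) (auto intro!: summable_on_cmult_right summJ h simp: infsum_cmult_right')
    also have "\<dots> \<le> 4 / (real m + 2) + 4 / (real n + 2)"
      using h(3)[of m] h(3)[of n] by simp
    finally show ?thesis .
  qed
  obtain d where d: "tendsto_L2 h d"
  proof (rule L2_complete[OF h(1)])
    fix e :: real assume e: "0 < e"
    obtain N :: nat where N: "8 / (A * e\<^sup>2) < real N"
      using reals_Archimedean2 by blast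
    have "norm_L2 (\<lambda>x. h m x - h n x) < e" if "m \<ge> N" "n \<ge> N" for m n
    proof -
      have "A * (norm_L2 (\<lambda>x. h m x - h n x))\<^sup>2 \<le> 4 / (real N + 2) + 4 / (real N + 2)"
        using dist[of m n] that
        by (elim order_trans) (intro add_mono divide_left_mono, auto)
      also have "\<dots> = 8 / (real N + 2)" by simp
      also have "\<dots> < A * e\<^sup>2"
      proof -
        have "8 < A * e\<^sup>2 * real N" using N A e by (simp add: field_simps)
        also have "\<dots> \<le> A * e\<^sup>2 * (real N + 2)" using A by (intro mult_left_mono) auto
        finally show ?thesis by (simp add: field_simps)
      qed
      finally have "(norm_L2 (\<lambda>x. h m x - h n x))\<^sup>2 < e\<^sup>2" using A by simp
      then show ?thesis using e by (simp add: power2_less_imp_less)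
    qed
    then show "\<exists>N. \<forall>m\<ge>N. \<forall>n\<ge>N. norm_L2 (\<lambda>x. h m x - h n x) < e" by blast
  qed
  have dL: "d \<in> L2" using d by (simp add: tendsto_L2_def)
  show ?thesis
  proof (rule that[OF dL])
    have "(\<lambda>n. 1) \<longlonglongrightarrow> inner_L2 d (\<phi> k)"
      using tendsto_L2_inner_left[OF d phi[OF k]] by (simp add: h)
    then have "inner_L2 d (\<phi> k) = 1" by (simp add: LIMSEQ_const_iff)
    then show "inner_L2 (\<phi> k) d = 1" by (subst inner_L2_commute) simp
    fix j assume j: "j \<in> I" "j \<noteq> k"
    have "(\<lambda>n. (norm (inner_L2 (h n) (\<phi> j)))\<^sup>2) \<longlonglongrightarrow> 0"
    proof (rule Lim_null_comparison[OF always_eventually, OF allI])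
      show "norm ((norm (inner_L2 (h n) (\<phi> j)))\<^sup>2) \<le> 2 / (real n + 2)" for n
        using le_S[OF h(1)[of n], of j] h(3)[of n] j by simp
      show "(\<lambda>n. 2 / (real n + 2)) \<longlonglongrightarrow> 0"
        by real_asymp
    qed
    then have "(\<lambda>n. inner_L2 (h n) (\<phi> j)) \<longlonglongrightarrow> 0"
      by (simp add: tendsto_norm_zero_iff)
    then have "inner_L2 d (\<phi> j) = 0"
      using tendsto_L2_inner_left[OF d phi[OF j(1)]] LIMSEQ_unique by blast
    then show "inner_L2 (\<phi> j) d = 0" by (subst inner_L2_commute) simp
  qed
qed

text \<open>Duality. The combination \<open>q\<close> of the \<open>\<psi> i\<close> with the
  coefficients of \<open>f\<close> has exactly these coefficients against \<open>\<phi>\<close>, so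
  the lower bound gives A ||q||^2 \<le> C for their square sum C. As <f, q> = C, Cauchy-Schwarz
  gives C \<le> ||f|| ||q||, and the claim follows.\<close>

lemma biorthogonal_bessel:
  fixes \<phi> \<psi> :: "'k \<Rightarrow> 'a::euclidean_space \<Rightarrow> complex"
  assumes phi: "\<And>i. \<phi> i \<in> L2" and psi: "\<And>i. \<psi> i \<in> L2"
    and A: "0 < A"
    and lower: "\<And>f. f \<in> L2 \<Longrightarrow> A * (norm_L2 f)\<^sup>2 \<le> (\<Sum>\<^sub>\<infinity>i. (norm (inner_L2 f (\<phi> i)))\<^sup>2)"
    and biorth: "\<And>i j. inner_L2 (\<phi> i) (\<psi> j) = (if i = j then 1 else 0)"
    and f: "f \<in> L2" and F: "finite F"
  shows "(\<Sum>i\<in>F. (norm (inner_L2 f (\<psi> i)))\<^sup>2) \<le> (norm_L2 f)\<^sup>2 / A"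
proof -
  define c where "c i = inner_L2 f (\<psi> i)" for i
  define q where "q = (\<lambda>x. \<Sum>i\<in>F. c i * \<psi> i x)"
  have q: "q \<in> L2" unfolding q_def by (intro L2_sum L2_scale psi)
  have biorth': "inner_L2 (\<psi> j) (\<phi> i) = (if i = j then 1 else 0)" for i j
    by (subst inner_L2_commute) (simp add: biorth)
  have qi: "inner_L2 q (\<phi> i) = (if i \<in> F then c i else 0)" for i
  proof -
    have "inner_L2 q (\<phi> i) = (\<Sum>j\<in>F. c j * inner_L2 (\<psi> j) (\<phi> i))"
      unfolding q_def by (simp add: inner_L2_sum_left L2_scale psi phi inner_L2_scale_left)
    also have "\<dots> = (\<Sum>j\<in>F. if i = j then c j else 0)"
      by (intro sum.cong) (auto simp: biorth')
    finally show ?thesis using F by simp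
  qed
  define C where "C = (\<Sum>i\<in>F. (norm (c i))\<^sup>2)"
  have C0: "0 \<le> C" unfolding C_def by (intro sum_nonneg) simp
  have "A * (norm_L2 q)\<^sup>2 \<le> (\<Sum>\<^sub>\<infinity>i. (norm (inner_L2 q (\<phi> i)))\<^sup>2)"
    by (rule lower[OF q])
  also have "\<dots> = (\<Sum>\<^sub>\<infinity>i\<in>F. (norm (c i))\<^sup>2)"
    by (intro infsum_cong_neutral) (auto simp: qi)
  also have "\<dots> = C" using F by (simp add: C_def)
  finally have 1: "A * (norm_L2 q)\<^sup>2 \<le> C" .
  have "inner_L2 f q = (\<Sum>i\<in>F. cnj (c i) * c i)"
    unfolding q_def by (simp add: inner_L2_sum_right L2_scale psi f inner_L2_scale_right c_def)
  also have "\<dots> = of_real C"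
    unfolding C_def of_real_sum by (intro sum.cong refl) (simp only: complex_norm_square mult.commute)
  finally have "norm (inner_L2 f q) = C"
    using C0 by simp
  then have "C \<le> norm_L2 f * norm_L2 q"
    using norm_inner_L2_le[OF f q] by simp
  then have "C\<^sup>2 \<le> (norm_L2 f)\<^sup>2 * (norm_L2 q)\<^sup>2"
    using C0 by (subst power_mult_distrib[symmetric]) (intro power_mono)
  also have "\<dots> \<le> (norm_L2 f)\<^sup>2 * (C / A)"
    using 1 A by (intro mult_left_mono) (auto simp: field_simps)
  finally have "C * C \<le> ((norm_L2 f)\<^sup>2 / A) * C"
    by (simp add: power2_eq_square field_simps)
  then have "C \<le> (norm_L2 f)\<^sup>2 / A"
    using C0 A by (cases "C = 0") (simp_all only: mult_le_cancel_right, auto)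
  then show ?thesis by (simp add: C_def c_def)
qed

text \<open>A finite partial sum equals <f, q F>, where \<open>q F\<close> is a partial expansion of
  \<open>p\<close> in the dual system. The coefficients of \<open>q F - p\<close> against
  \<open>\<phi>\<close> vanish on \<open>F\<close> and are those of \<open>-p\<close> elsewhere, so
  the lower bound controls the error by the tail of a convergent sum.\<close>

lemma biorthogonal_expansion:
  fixes \<phi> \<psi> :: "'k \<Rightarrow> 'a::euclidean_space \<Rightarrow> complex"
  assumes phi: "\<And>i. \<phi> i \<in> L2" and psi: "\<And>i. \<psi> i \<in> L2"
    and A: "0 < A"
    and summ: "\<And>f. f \<in> L2 \<Longrightarrow> (\<lambda>i. (norm (inner_L2 f (\<phi> i)))\<^sup>2) summable_on UNIV"
    and lower: "\<And>f. f \<in> L2 \<Longrightarrow> A * (norm_L2 f)\<^sup>2 \<le> (\<Sum>\<^sub>\<infinity>i. (norm (inner_L2 f (\<phi> i)))\<^sup>2)"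
    and biorth: "\<And>i j. inner_L2 (\<phi> i) (\<psi> j) = (if i = j then 1 else 0)"
    and f: "f \<in> L2" and p: "p \<in> L2"
  shows "((\<lambda>i. inner_L2 f (\<psi> i) * inner_L2 (\<phi> i) p) has_sum inner_L2 f p) UNIV"
proof -
  define c where "c i = inner_L2 p (\<phi> i)" for i
  define q where "q F = (\<lambda>x. \<Sum>i\<in>F. c i * \<psi> i x)" for F
  have q: "q F \<in> L2" for F unfolding q_def by (intro L2_sum L2_scale psi)
  have biorth': "inner_L2 (\<psi> j) (\<phi> i) = (if i = j then 1 else 0)" for i j
    by (subst inner_L2_commute) (simp add: biorth)
  have qi: "inner_L2 (q F) (\<phi> i) = (if i \<in> F then c i else 0)" if "finite F" for F i
  proof -
    have "inner_L2 (q F) (\<phi> i) = (\<Sum>j\<in>F. c j * inner_L2 (\<psi> j) (\<phi> i))"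
      unfolding q_def by (simp add: inner_L2_sum_left L2_scale psi phi inner_L2_scale_left)
    also have "\<dots> = (\<Sum>j\<in>F. if i = j then c j else 0)"
      by (intro sum.cong) (auto simp: biorth')
    finally show ?thesis using that by simp
  qed
  define S where "S = (\<Sum>\<^sub>\<infinity>i. (norm (c i))\<^sup>2)"
  have hs: "((\<lambda>i. (norm (c i))\<^sup>2) has_sum S) UNIV"
    unfolding S_def c_def using summ[OF p] by (rule has_sum_infsum)
  define r where "r F = S - (\<Sum>i\<in>F. (norm (c i))\<^sup>2)" for F
  have r0: "(r \<longlongrightarrow> 0) (finite_subsets_at_top UNIV)"
  proof -
    have "((\<lambda>F. S - (\<Sum>i\<in>F. (norm (c i))\<^sup>2)) \<longlongrightarrow> S - S) (finite_subsets_at_top UNIV)"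
      using hs unfolding has_sum_def by (intro tendsto_intros)
    then show ?thesis by (simp add: r_def[abs_def])
  qed
  have bound: "norm ((\<Sum>i\<in>F. inner_L2 f (\<psi> i) * inner_L2 (\<phi> i) p) - inner_L2 f p)
      \<le> norm_L2 f * sqrt (r F / A)" if F: "finite F" for F
  proof -
    let ?e = "\<lambda>x. q F x - p x"
    have e: "?e \<in> L2" by (intro L2_diff q p)
    have "A * (norm_L2 ?e)\<^sup>2 \<le> (\<Sum>\<^sub>\<infinity>i. (norm (inner_L2 ?e (\<phi> i)))\<^sup>2)"
      by (rule lower[OF e])
    also have "\<dots> = (\<Sum>\<^sub>\<infinity>i\<in>UNIV-F. (norm (c i))\<^sup>2)"
      by (intro infsum_cong_neutral)
         (auto simp: inner_L2_diff_left q p phi qi[OF F] c_def[symmetric])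
    also have "\<dots> = r F"
      unfolding r_def S_def
      using summ[OF p] F by (subst infsum_Diff) (auto simp: c_def)
    finally have "(norm_L2 ?e)\<^sup>2 \<le> r F / A" using A by (simp add: field_simps)
    then have "norm_L2 ?e \<le> sqrt (r F / A)" by (rule real_le_rsqrt)
    moreover have "(\<Sum>i\<in>F. inner_L2 f (\<psi> i) * inner_L2 (\<phi> i) p) = inner_L2 f (q F)"
    proof -
      have "inner_L2 f (q F) = (\<Sum>i\<in>F. cnj (c i) * inner_L2 f (\<psi> i))"
        unfolding q_def by (simp add: inner_L2_sum_right L2_scale psi f inner_L2_scale_right)
      then show ?thesis
        unfolding c_def inner_L2_commute[symmetric] by (simp add: mult.commute)
    qed
    ultimately show ?thesis
      using norm_inner_L2_le[OF f e]
      by (simp add: inner_L2_diff_right q p f order_trans[OF _ mult_left_mono])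
  qed
  have "((\<lambda>F. norm_L2 f * sqrt (r F / A)) \<longlongrightarrow> norm_L2 f * sqrt (0 / A)) (finite_subsets_at_top UNIV)"
    using A by (intro tendsto_intros r0) auto
  then have "((\<lambda>F. norm_L2 f * sqrt (r F / A)) \<longlongrightarrow> 0) (finite_subsets_at_top UNIV)" by simp
  then have "((\<lambda>F. (\<Sum>i\<in>F. inner_L2 f (\<psi> i) * inner_L2 (\<phi> i) p) - inner_L2 f p) \<longlongrightarrow> 0) (finite_subsets_at_top UNIV)"
    by (rule Lim_null_comparison[rotated]) (use bound in \<open>auto intro!: eventually_finite_subsets_at_top_weakI\<close>)
  then show ?thesis unfolding has_sum_def by (simp add: LIM_zero_iff)
qed

section \<open>Limits of sums of l2 products\<close>

lemma sum_mult_le_sqrt: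
  fixes a b :: "'k \<Rightarrow> real"
  assumes "(\<Sum>i\<in>F. (a i)\<^sup>2) \<le> A\<^sup>2" "(\<Sum>i\<in>F. (b i)\<^sup>2) \<le> B\<^sup>2" "0 \<le> A" "0 \<le> B"
  shows "(\<Sum>i\<in>F. a i * b i) \<le> A * B"
proof -
  have "(\<Sum>i\<in>F. a i * b i)\<^sup>2 \<le> (\<Sum>i\<in>F. (a i)\<^sup>2) * (\<Sum>i\<in>F. (b i)\<^sup>2)"
    by (rule Cauchy_Schwarz_ineq_sum)
  also have "\<dots> \<le> A\<^sup>2 * B\<^sup>2"
    using assms by (intro mult_mono) (auto intro: sum_nonneg)
  finally show ?thesis
    using assms by (rule_tac power2_le_imp_le) (simp_all add: power_mult_distrib)
qed

text \<open>Convergence in l2 is required of \<open>a'\<close> alone: \<open>b\<close> is bounded in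
  l2, and \<open>c\<close> is uniformly bounded and tends to 0 index by index. A finite set
  \<open>F\<close> carries all but a small part of the limit \<open>a\<close>; on \<open>F\<close>
  the factor \<open>c\<close> does the work, off \<open>F\<close> the small tail.\<close>

lemma has_sum_tendsto_0:
  fixes a :: "'k \<Rightarrow> complex" and a' b c :: "nat \<Rightarrow> 'k \<Rightarrow> complex"
  assumes a: "(\<lambda>i. (norm (a i))\<^sup>2) summable_on UNIV"
    and a': "\<And>n F. finite F \<Longrightarrow> (\<Sum>i\<in>F. (norm (a' n i - a i))\<^sup>2) \<le> (\<epsilon> n)\<^sup>2"
    and \<epsilon>: "\<And>n. 0 \<le> \<epsilon> n" "\<epsilon> \<longlonglongrightarrow> 0"
    and b: "\<And>n F. finite F \<Longrightarrow> (\<Sum>i\<in>F. (norm (b n i))\<^sup>2) \<le> B\<^sup>2" and B: "0 \<le> B"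
    and c: "\<And>n i. norm (c n i) \<le> C" "\<And>i. (\<lambda>n. c n i) \<longlonglongrightarrow> 0"
    and s: "\<And>n. ((\<lambda>i. a' n i * c n i * b n i) has_sum s n) UNIV"
  shows "s \<longlonglongrightarrow> 0"
proof (rule LIMSEQ_I)
  fix e :: real assume e: "0 < e"
  have C: "0 \<le> C" using order_trans[OF norm_ge_zero c(1)] .
  \<comment> \<open>Chosen so that the tail contributes less than e / 2; the added 1 covers C B =
    0.\<close>
  define e' where "e' = e / (2 * (C * B + 1))"
  have CB: "0 < C * B + 1" using B C by (simp add: add_nonneg_pos)
  then have e': "0 < e'" using e by (simp add: e'_def)
  have "C * e' * B = (C * B) / (C * B + 1) * (e / 2)"
    using CB by (simp add: e'_def divide_simps)
  also have "\<dots> < 1 * (e / 2)"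
    using e CB by (intro mult_strict_right_mono) (auto simp: divide_less_eq)
  finally have e'2: "C * e' * B < e / 2" by simp
  obtain F where F: "finite F" "dist (\<Sum>i\<in>F. (norm (a i))\<^sup>2) (\<Sum>\<^sub>\<infinity>i. (norm (a i))\<^sup>2) \<le> e'\<^sup>2"
    using infsum_finite_approximation[OF a, of "e'\<^sup>2"] e' by auto
  have tail: "(\<Sum>i\<in>G. (norm (a i))\<^sup>2) \<le> e'\<^sup>2" if "finite G" "G \<inter> F = {}" for G
  proof -
    have "(\<Sum>i\<in>G. (norm (a i))\<^sup>2) + (\<Sum>i\<in>F. (norm (a i))\<^sup>2) = (\<Sum>i\<in>G \<union> F. (norm (a i))\<^sup>2)"
      using that F by (intro sum.union_disjoint[symmetric]) auto
    also have "\<dots> \<le> (\<Sum>\<^sub>\<infinity>i. (norm (a i))\<^sup>2)"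
      using that F by (intro finite_sum_le_infsum a) auto
    finally show ?thesis using F(2) by (simp add: dist_real_def)
  qed
  have b1: "norm (b n i) \<le> B" for n i
    using b[of "{i}" n] B by (simp add: power2_le_iff_abs_le)
  have CS: "(\<Sum>i\<in>G. norm (x i) * norm (c n i) * norm (b n i)) \<le> C * (r * B)"
    if G: "finite G" and r: "0 \<le> r" "(\<Sum>i\<in>G. (norm (x i))\<^sup>2) \<le> r\<^sup>2" for G n r and x :: "'k \<Rightarrow> complex"
  proof -
    have "(\<Sum>i\<in>G. norm (x i) * norm (c n i) * norm (b n i)) \<le> (\<Sum>i\<in>G. C * (norm (x i) * norm (b n i)))"
    proof (rule sum_mono)
      fix i
      have "norm (c n i) * (norm (x i) * norm (b n i)) \<le> C * (norm (x i) * norm (b n i))"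
        by (intro mult_right_mono c) auto
      then show "norm (x i) * norm (c n i) * norm (b n i) \<le> C * (norm (x i) * norm (b n i))"
        by (simp add: mult_ac)
    qed
    also have "\<dots> \<le> C * (r * B)"
      unfolding sum_distrib_left[symmetric]
      by (intro mult_left_mono sum_mult_le_sqrt r b G B C)
    finally show ?thesis .
  qed
  \<comment> \<open>The three terms are the part of \<open>a\<close> on \<open>F\<close>, its tail,
    and the error \<open>a' n - a\<close>. The bound holds for all finite sets containing
    \<open>F\<close> and therefore for the limit.\<close>
  have main: "norm (s n) \<le> (\<Sum>i\<in>F. norm (a i) * norm (c n i)) * B + C * e' * B + C * \<epsilon> n * B" for n
  proof (rule tendsto_upperbound)
    show "((\<lambda>G. norm (\<Sum>i\<in>G. a' n i * c n i * b n i)) \<longlongrightarrow> norm (s n)) (finite_subsets_at_top UNIV)"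
      using s[of n] unfolding has_sum_def by (intro tendsto_norm)
    have "norm (\<Sum>i\<in>G. a' n i * c n i * b n i) \<le> (\<Sum>i\<in>F. norm (a i) * norm (c n i)) * B + C * e' * B + C * \<epsilon> n * B"
      if G: "finite G" "F \<subseteq> G" for G
    proof -
      have "norm (\<Sum>i\<in>G. a' n i * c n i * b n i)
          \<le> (\<Sum>i\<in>G. norm (a i) * norm (c n i) * norm (b n i) + norm (a' n i - a i) * norm (c n i) * norm (b n i))"
      proof (rule sum_norm_le)
        fix i
        have "norm (a' n i) \<le> norm (a i) + norm (a' n i - a i)"
          using norm_triangle_ineq[of "a i" "a' n i - a i"] by simp
        then have "norm (a' n i) * (norm (c n i) * norm (b n i)) \<le> (norm (a i) + norm (a' n i - a i)) * (norm (c n i) * norm (b n i))"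
          by (intro mult_right_mono) auto
        then show "norm (a' n i * c n i * b n i)
            \<le> norm (a i) * norm (c n i) * norm (b n i) + norm (a' n i - a i) * norm (c n i) * norm (b n i)"
          by (simp add: norm_mult ring_distribs mult.assoc)
      qed
      also have "\<dots> = (\<Sum>i\<in>G. norm (a i) * norm (c n i) * norm (b n i))
          + (\<Sum>i\<in>G. norm (a' n i - a i) * norm (c n i) * norm (b n i))"
        by (rule sum.distrib)
      also have "(\<Sum>i\<in>G. norm (a' n i - a i) * norm (c n i) * norm (b n i)) \<le> C * (\<epsilon> n * B)"
        by (rule CS[OF G(1) \<epsilon>(1) a'[OF G(1)]])
      also have "(\<Sum>i\<in>G. norm (a i) * norm (c n i) * norm (b n i)) = (\<Sum>i\<in>F. norm (a i) * norm (c n i) * norm (b n i))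
          + (\<Sum>i\<in>G-F. norm (a i) * norm (c n i) * norm (b n i))"
        by (subst sum.subset_diff[OF G(2,1)]) (rule add.commute)
      also have "(\<Sum>i\<in>F. norm (a i) * norm (c n i) * norm (b n i)) \<le> (\<Sum>i\<in>F. norm (a i) * norm (c n i)) * B"
        unfolding sum_distrib_right by (intro sum_mono mult_left_mono b1) auto
      also have "(\<Sum>i\<in>G-F. norm (a i) * norm (c n i) * norm (b n i)) \<le> C * (e' * B)"
        using G e' by (intro CS tail) auto
      finally show ?thesis by (simp add: mult_ac)
    qed
    then show "\<forall>\<^sub>F G in finite_subsets_at_top UNIV.
        norm (\<Sum>i\<in>G. a' n i * c n i * b n i) \<le> (\<Sum>i\<in>F. norm (a i) * norm (c n i)) * B + C * e' * B + C * \<epsilon> n * B"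
      using F(1) by (auto simp: eventually_finite_subsets_at_top)
  qed simp
  have "(\<lambda>n. (\<Sum>i\<in>F. norm (a i) * norm (c n i)) * B + C * \<epsilon> n * B)
      \<longlonglongrightarrow> (\<Sum>i\<in>F. norm (a i) * norm (0::complex)) * B + C * 0 * B"
    by (intro tendsto_intros c \<epsilon>)
  then have "(\<lambda>n. (\<Sum>i\<in>F. norm (a i) * norm (c n i)) * B + C * \<epsilon> n * B) \<longlonglongrightarrow> 0" by simp
  then have "\<forall>\<^sub>F n in sequentially. (\<Sum>i\<in>F. norm (a i) * norm (c n i)) * B + C * \<epsilon> n * B < e / 2"
    using e by (auto dest!: order_tendstoD(2)[where a="e/2"])
  then obtain N where N: "\<And>n. n \<ge> N \<Longrightarrow> (\<Sum>i\<in>F. norm (a i) * norm (c n i)) * B + C * \<epsilon> n * B < e / 2"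
    by (auto simp: eventually_sequentially)
  then have "norm (s n) < e" if "n \<ge> N" for n
    using N[OF that] main[of n] e'2 by linarith
  then show "\<exists>no. \<forall>n\<ge>no. norm (s n - 0) < e" by auto
qed

section \<open>Continuity of translation\<close>

lemma integrable_translate:
  fixes f :: "'a::euclidean_space \<Rightarrow> 'b::{banach, second_countable_topology}"
  assumes "integrable lebesgue f" shows "integrable lebesgue (\<lambda>x. f (x + a))"
  using integrable_distr[OF measurable_lebesgue_translation[of a], of f] assms
  by (simp add: lebesgue_distr_translation)

lemma translate_L1_approx:
  fixes f h :: "'a::euclidean_space \<Rightarrow> complex"
  assumes [simp]: "integrable lebesgue f" "integrable lebesgue h"
  shows "(LINT x|lebesgue. norm (f (x + a) - f x))
      \<le> 2 * (LINT x|lebesgue. norm (f x - h x)) + (LINT x|lebesgue. norm (h (x + a) - h x))"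
proof -
  note [simp] = integrable_translate[OF assms(1)] integrable_translate[OF assms(2)]
  have "(LINT x|lebesgue. norm (f (x + a) - f x))
      \<le> (LINT x|lebesgue. norm (f (x + a) - h (x + a)) + norm (f x - h x) + norm (h (x + a) - h x))"
  proof (intro integral_mono)
    fix x
    have "f (x + a) - f x = (f (x + a) - h (x + a)) - (f x - h x) + (h (x + a) - h x)" by simp
    then show "norm (f (x + a) - f x) \<le> norm (f (x + a) - h (x + a)) + norm (f x - h x) + norm (h (x + a) - h x)"
      by (metis norm_triangle_ineq norm_triangle_ineq4 add_right_mono order_trans)
  qed auto
  also have "\<dots> = (LINT x|lebesgue. norm (f (x + a) - h (x + a))) + (LINT x|lebesgue. norm (f x - h x))
      + (LINT x|lebesgue. norm (h (x + a) - h x))"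
    by simp
  also have "(LINT x|lebesgue. norm (f (x + a) - h (x + a))) = (LINT x|lebesgue. norm (f x - h x))"
    by (rule integral_translate[of "\<lambda>x. norm (f x - h x)"]) (simp add: borel_measurable_integrable)
  finally show ?thesis by simp
qed

text \<open>The functions whose translates converge form an L1-closed set. This handles both the
  approximation of a measurable set by open sets and the limit step of the induction.\<close>

lemma translate_L1_closed:
  fixes f :: "'a::euclidean_space \<Rightarrow> complex"
  assumes f: "integrable lebesgue f"
    and approx: "\<And>e. 0 < e \<Longrightarrow> \<exists>h. integrable lebesgue h \<and> (LINT x|lebesgue. norm (f x - h x)) < e \<and>
      (\<lambda>n. LINT x|lebesgue. norm (h (x + u n) - h x)) \<longlonglongrightarrow> 0"
  shows "(\<lambda>n. LINT x|lebesgue. norm (f (x + u n) - f x)) \<longlonglongrightarrow> 0"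
proof (rule LIMSEQ_I)
  fix e :: real assume e: "0 < e"
  then obtain h where h: "integrable lebesgue h" "(LINT x|lebesgue. norm (f x - h x)) < e / 4"
      "(\<lambda>n. LINT x|lebesgue. norm (h (x + u n) - h x)) \<longlonglongrightarrow> 0"
    using approx[of "e/4"] by auto
  have "\<forall>\<^sub>F n in sequentially. (LINT x|lebesgue. norm (h (x + u n) - h x)) < e / 2"
    using order_tendstoD(2)[OF h(3), of "e/2"] e by simp
  then obtain N where N: "\<And>n. n \<ge> N \<Longrightarrow> (LINT x|lebesgue. norm (h (x + u n) - h x)) < e / 2"
    by (auto simp: eventually_sequentially)
  have "norm (LINT x|lebesgue. norm (f (x + u n) - f x)) < e" if "n \<ge> N" for n
    using translate_L1_approx[OF f h(1), of "u n"] N[OF that] h(2) by (simp add: integral_nonneg)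
  then show "\<exists>N. \<forall>n\<ge>N. norm ((LINT x|lebesgue. norm (f (x + u n) - f x)) - 0) < e" by auto
qed

text \<open>The indicator of an open set is lower semicontinuous, so the positive part of the difference
  tends to 0 pointwise; both parts have the same integral by translation invariance.\<close>

lemma translate_indicator_open:
  fixes U :: "'a::euclidean_space set"
  assumes U: "open U" "U \<in> lmeasurable" and u: "u \<longlonglongrightarrow> 0"
  shows "(\<lambda>n. LINT x|lebesgue. \<bar>indicator U (x + u n) - indicator U x\<bar> :: real) \<longlonglongrightarrow> 0"
proof -
  let ?i = "indicator U :: 'a \<Rightarrow> real"
  have i: "integrable lebesgue ?i" using U(2) by (simp add: lmeasurable_iff_integrable)
  have it: "integrable lebesgue (\<lambda>x. ?i (x + a))" for a
    by (rule integrable_translate[OF i])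
  have [measurable]: "?i \<in> borel_measurable lebesgue" "(\<lambda>x. ?i (x + a)) \<in> borel_measurable lebesgue" for a
    using i it by (auto intro: borel_measurable_integrable)
  have "(\<lambda>n. LINT x|lebesgue. max 0 (?i x - ?i (x + u n))) \<longlonglongrightarrow> (LINT x|(lebesgue :: 'a measure). (0::real))"
  proof (rule integral_dominated_convergence[where w="?i"])
    show "AE x in lebesgue. (\<lambda>n. max 0 (?i x - ?i (x + u n))) \<longlonglongrightarrow> 0"
    proof (intro AE_I2)
      fix x
      show "(\<lambda>n. max 0 (?i x - ?i (x + u n))) \<longlonglongrightarrow> 0"
      proof (cases "x \<in> U")
        case True
        have "(\<lambda>n. x + u n) \<longlonglongrightarrow> x + 0" by (intro tendsto_intros u)
        then have "\<forall>\<^sub>F n in sequentially. x + u n \<in> U"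
          using U(1) True by (auto dest: topological_tendstoD)
        then have "\<forall>\<^sub>F n in sequentially. max 0 (?i x - ?i (x + u n)) = 0"
          by (rule eventually_mono) (auto simp: indicator_def)
        then show ?thesis by (simp add: tendsto_eventually)
      qed (simp add: indicator_def)
    qed
    show "(\<lambda>x. max 0 (?i x - ?i (x + u n))) \<in> borel_measurable lebesgue" for n
      by measurable
  qed (auto intro!: i simp: indicator_def)
  then have lim: "(\<lambda>n. 2 * (LINT x|lebesgue. max 0 (?i x - ?i (x + u n)))) \<longlonglongrightarrow> 0"
    using tendsto_mult_right_zero by fastforce
  have "(LINT x|lebesgue. \<bar>?i (x + a) - ?i x\<bar>) = 2 * (LINT x|lebesgue. max 0 (?i x - ?i (x + a)))" for a
  proof -
    have m: "integrable lebesgue (\<lambda>x. max 0 (?i x - ?i (x + a)))"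
      by (intro Bochner_Integration.integrable_max Bochner_Integration.integrable_diff i it integrable_zero)
    have "(LINT x|lebesgue. \<bar>?i (x + a) - ?i x\<bar>)
        = (LINT x|lebesgue. 2 * max 0 (?i x - ?i (x + a)) + ?i (x + a) - ?i x)"
      by (intro Bochner_Integration.integral_cong) (auto simp: max_def)
    also have "\<dots> = 2 * (LINT x|lebesgue. max 0 (?i x - ?i (x + a)))
        + (LINT x|lebesgue. ?i (x + a)) - (LINT x|lebesgue. ?i x)"
      by (simp only: Bochner_Integration.integral_diff Bochner_Integration.integral_add integrable_mult_right Bochner_Integration.integrable_add m i it integral_mult_right_zero)
    also have "(LINT x|lebesgue. ?i (x + a)) = (LINT x|lebesgue. ?i x)"
      by (rule integral_translate) measurable
    finally show ?thesis by simp
  qed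
  then show ?thesis using lim by simp
qed

text \<open>Induction over integrable functions. Indicators are reduced to open sets by outer
  regularity, sums follow from the triangle inequality, and limits from dominated
  convergence.\<close>

lemma tendsto_translate_L1:
  fixes f :: "'a::euclidean_space \<Rightarrow> complex"
  assumes "integrable lebesgue f" and u: "u \<longlonglongrightarrow> 0"
  shows "(\<lambda>n. LINT x|lebesgue. norm (f (x + u n) - f x)) \<longlonglongrightarrow> 0"
  using assms(1)
proof (induction rule: integrable_induct)
  case (base A c)
  show ?case
  proof (rule translate_L1_closed)
    show fi: "integrable lebesgue (\<lambda>x. indicator A x *\<^sub>R c)"
      using base by (intro integrable_scaleR_left) (simp add: less_top)
    fix e :: real assume e: "0 < e"
    \<comment> \<open>The measure of \<open>U - A\<close> is to be multiplied by |c|; the added 1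
      covers c = 0.\<close>
    define d where "d = e / (norm c + 1)"
    have d: "0 < d" unfolding d_def using e by (simp add: add_nonneg_pos)
    obtain U where U: "open U" "A \<subseteq> U" "U - A \<in> lmeasurable" "emeasure lebesgue (U - A) < ennreal d"
      using sets_lebesgue_outer_open[OF base(1) d] by blast
    have "U = A \<union> (U - A)" using U by blast
    then have UL: "U \<in> lmeasurable"
      using base U(3) by (metis fmeasurable.Un fmeasurableI)
    have hi: "integrable lebesgue (\<lambda>x. indicator U x *\<^sub>R c)"
      using UL by (intro integrable_scaleR_left) (simp add: lmeasurable_iff_integrable)
    have "(LINT x|lebesgue. norm (indicator A x *\<^sub>R c - indicator U x *\<^sub>R c))
        = (LINT x|lebesgue. indicator (U - A) x * norm c)"
      using U(2) by (intro Bochner_Integration.integral_cong) (auto simp: indicator_def)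
    also have "\<dots> = measure lebesgue (U - A) * norm c" using U(3) by simp
    also have "\<dots> \<le> d * norm c"
      using U(3,4) d by (intro mult_right_mono) (auto simp: emeasure_eq_measure2 ennreal_less_iff)
    also have "\<dots> < e"
      using e by (simp add: d_def field_simps add_pos_nonneg)
    finally have small: "(LINT x|lebesgue. norm (indicator A x *\<^sub>R c - indicator U x *\<^sub>R c)) < e" .
    have "(LINT x|lebesgue. norm (indicator U (x + a) *\<^sub>R c - indicator U x *\<^sub>R c))
        = (LINT x|lebesgue. \<bar>indicator U (x + a) - indicator U x :: real\<bar>) * norm c" for a
      by (simp flip: scaleR_diff_left)
    moreover have "(\<lambda>n. (LINT x|lebesgue. \<bar>indicator U (x + u n) - indicator U x :: real\<bar>) * norm c) \<longlonglongrightarrow> 0"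
      by (intro tendsto_mult_left_zero translate_indicator_open U UL u)
    ultimately have "(\<lambda>n. LINT x|lebesgue. norm (indicator U (x + u n) *\<^sub>R c - indicator U x *\<^sub>R c)) \<longlonglongrightarrow> 0"
      by simp
    then show "\<exists>h. integrable lebesgue h \<and> (LINT x|lebesgue. norm (indicator A x *\<^sub>R c - h x)) < e \<and>
        (\<lambda>n. LINT x|lebesgue. norm (h (x + u n) - h x)) \<longlonglongrightarrow> 0"
      using hi small by blast
  qed
next
  case (add f g)
  have "(\<lambda>n. (LINT x|lebesgue. norm (f (x + u n) - f x)) + (LINT x|lebesgue. norm (g (x + u n) - g x))) \<longlonglongrightarrow> 0 + 0"
    by (intro tendsto_add add)
  then have lim: "(\<lambda>n. (LINT x|lebesgue. norm (f (x + u n) - f x)) + (LINT x|lebesgue. norm (g (x + u n) - g x))) \<longlonglongrightarrow> 0"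
    by simp
  show ?case
  proof (rule Lim_null_comparison[OF always_eventually, OF allI, OF _ lim])
    fix n
    note [simp] = add(1,2) integrable_translate[OF add(1)] integrable_translate[OF add(2)]
    have "(LINT x|lebesgue. norm ((f (x + u n) + g (x + u n)) - (f x + g x)))
        \<le> (LINT x|lebesgue. norm (f (x + u n) - f x) + norm (g (x + u n) - g x))"
      by (intro integral_mono norm_diff_triangle_ineq) auto
    also have "\<dots> = (LINT x|lebesgue. norm (f (x + u n) - f x)) + (LINT x|lebesgue. norm (g (x + u n) - g x))"
      by simp
    finally show "norm (LINT x|lebesgue. norm ((f (x + u n) + g (x + u n)) - (f x + g x)))
        \<le> (LINT x|lebesgue. norm (f (x + u n) - f x)) + (LINT x|lebesgue. norm (g (x + u n) - g x))"
      by (simp add: integral_nonneg)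
  qed
next
  case (lim f s)
  show ?case
  proof (rule translate_L1_closed[OF lim(4)])
    fix e :: real assume e: "0 < e"
    have [measurable]: "f \<in> borel_measurable lebesgue" "\<And>i. s i \<in> borel_measurable lebesgue"
      using lim by auto
    have "(\<lambda>i. LINT x|lebesgue. norm (f x - s i x)) \<longlonglongrightarrow> (LINT x|(lebesgue :: 'a measure). 0)"
    \<comment> \<open>The induction rule supplies |s i| \<le> 2 |f|, whence the factor 3.\<close>
    proof (rule integral_dominated_convergence[where w="\<lambda>x. 3 * norm (f x)"])
      show "AE x in lebesgue. (\<lambda>i. norm (f x - s i x)) \<longlonglongrightarrow> 0"
      proof (intro AE_I2)
        fix x
        have "(\<lambda>i. s i x) \<longlonglongrightarrow> f x" using lim(2) by simp
        then have "(\<lambda>i. norm (f x - s i x)) \<longlonglongrightarrow> norm (f x - f x)" by (intro tendsto_intros)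
        then show "(\<lambda>i. norm (f x - s i x)) \<longlonglongrightarrow> 0" by simp
      qed
      show "AE x in lebesgue. norm (norm (f x - s i x)) \<le> 3 * norm (f x)" for i
      proof (intro AE_I2)
        fix x
        have "norm (s i x) \<le> 2 * norm (f x)" using lim(3) by simp
        then show "norm (norm (f x - s i x)) \<le> 3 * norm (f x)"
          using norm_triangle_ineq4[of "f x" "s i x"] by simp
      qed
    qed (use lim(4) in auto)
    then have "\<forall>\<^sub>F i in sequentially. (LINT x|lebesgue. norm (f x - s i x)) < e"
      using e by (intro order_tendstoD(2)) auto
    then obtain i where "(LINT x|lebesgue. norm (f x - s i x)) < e"
      by (auto simp: eventually_sequentially)
    then show "\<exists>h. integrable lebesgue h \<and> (LINT x|lebesgue. norm (f x - h x)) < e \<and>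
        (\<lambda>n. LINT x|lebesgue. norm (h (x + u n) - h x)) \<longlonglongrightarrow> 0"
      using lim(1,5) by blast
  qed
qed

text \<open>Reduction to L1 by truncating the values: for a function bounded by k, the squared
  difference is at most 2 k times the difference, and the truncation error in L2 is invariant under
  translation.\<close>

lemma tendsto_translate_L2:
  fixes f :: "'a::euclidean_space \<Rightarrow> complex"
  assumes f1: "integrable lebesgue f" and f2: "f \<in> L2" and u: "u \<longlonglongrightarrow> 0"
  shows "(\<lambda>n. norm_L2 (\<lambda>x. f (x + u n) - f x)) \<longlonglongrightarrow> 0"
proof (rule LIMSEQ_I)
  note [measurable] = L2_measurable[OF f2]
  fix e :: real assume e: "0 < e"
  define h where "h k x = (if norm (f x) \<le> real k then f x else 0)" for k :: nat and x
  have [measurable]: "h k \<in> borel_measurable lebesgue" for k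
    unfolding h_def by measurable
  have h_le: "norm (h k x) \<le> norm (f x)" "norm (h k x) \<le> real k" for k x
    by (auto simp: h_def)
  have h2: "h k \<in> L2" for k by (rule L2_dominated[OF f2]) (auto simp: h_le)
  have h1: "integrable lebesgue (h k)" for k
    by (rule Bochner_Integration.integrable_bound[OF f1]) (auto simp: h_le)
  have "(\<lambda>k. LINT x|lebesgue. (norm (f x - h k x))\<^sup>2) \<longlonglongrightarrow> (LINT x|(lebesgue :: 'a measure). 0)"
  proof (rule integral_dominated_convergence[where w="\<lambda>x. (norm (f x))\<^sup>2"])
    show "AE x in lebesgue. (\<lambda>k. (norm (f x - h k x))\<^sup>2) \<longlonglongrightarrow> 0"
    proof (intro AE_I2)
      fix x
      obtain N :: nat where N: "norm (f x) \<le> real N" using real_arch_simple by blast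
      have "\<forall>\<^sub>F k in sequentially. (norm (f x - h k x))\<^sup>2 = 0"
        using N by (intro eventually_sequentiallyI[of N]) (auto simp: h_def)
      then show "(\<lambda>k. (norm (f x - h k x))\<^sup>2) \<longlonglongrightarrow> 0" by (simp add: tendsto_eventually)
    qed
    show "AE x in lebesgue. norm ((norm (f x - h k x))\<^sup>2) \<le> (norm (f x))\<^sup>2" for k
      by (intro AE_I2) (auto simp: h_def)
  qed (use L2_integrable_norm_sq[OF f2] in auto)
  then have "(\<lambda>k. sqrt (LINT x|lebesgue. (norm (f x - h k x))\<^sup>2)) \<longlonglongrightarrow> sqrt (LINT x|(lebesgue :: 'a measure). 0)"
    by (rule tendsto_real_sqrt)
  then have "(\<lambda>k. norm_L2 (\<lambda>x. f x - h k x)) \<longlonglongrightarrow> 0"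
    unfolding norm_L2_def by simp
  then have "\<forall>\<^sub>F k in sequentially. norm_L2 (\<lambda>x. f x - h k x) < e / 4"
    using e by (intro order_tendstoD(2)) auto
  then obtain k where k: "norm_L2 (\<lambda>x. f x - h k x) < e / 4"
    by (auto simp: eventually_sequentially)
  have sq: "(norm_L2 (\<lambda>x. h k (x + a) - h k x))\<^sup>2 \<le> 2 * real k * (LINT x|lebesgue. norm (h k (x + a) - h k x))" for a
  proof -
    have int: "integrable lebesgue (\<lambda>x. norm (h k (x + a) - h k x))"
      by (intro integrable_norm Bochner_Integration.integrable_diff integrable_translate h1)
    have "(norm_L2 (\<lambda>x. h k (x + a) - h k x))\<^sup>2 \<le> (LINT x|lebesgue. 2 * real k * norm (h k (x + a) - h k x))"
      unfolding norm_L2_sq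
    proof (intro integral_mono L2_integrable_norm_sq L2_diff L2_translate h2 integrable_mult_right int)
      fix x
      have "norm (h k (x + a) - h k x) \<le> 2 * real k"
        using norm_triangle_ineq4[of "h k (x + a)" "h k x"] h_le(2)[of k x] h_le(2)[of k "x + a"] by linarith
      then show "(norm (h k (x + a) - h k x))\<^sup>2 \<le> 2 * real k * norm (h k (x + a) - h k x)"
        unfolding power2_eq_square by (rule mult_right_mono) simp
    qed
    then show ?thesis by simp
  qed
  have "(\<lambda>n. sqrt (2 * real k * (LINT x|lebesgue. norm (h k (x + u n) - h k x)))) \<longlonglongrightarrow> sqrt (2 * real k * 0)"
    by (intro tendsto_real_sqrt tendsto_mult tendsto_const tendsto_translate_L1 h1 u)
  then have "\<forall>\<^sub>F n in sequentially. sqrt (2 * real k * (LINT x|lebesgue. norm (h k (x + u n) - h k x))) < e / 2"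
    using e by (intro order_tendstoD(2)) auto
  then obtain N where N: "\<And>n. n \<ge> N \<Longrightarrow> sqrt (2 * real k * (LINT x|lebesgue. norm (h k (x + u n) - h k x))) < e / 2"
    by (auto simp: eventually_sequentially)
  have "norm_L2 (\<lambda>x. f (x + u n) - f x) < e" if "n \<ge> N" for n
  proof -
    have "norm_L2 (\<lambda>x. h k (x + u n) - h k x) < e / 2"
      using real_le_rsqrt[OF sq[of "u n"]] N[OF that] by linarith
    moreover have "norm_L2 (\<lambda>x. f (x + u n) - h k (x + u n)) = norm_L2 (\<lambda>x. f x - h k x)"
      by (rule norm_L2_translate[of "\<lambda>x. f x - h k x"]) (intro L2_diff f2 h2)
    moreover have "norm_L2 (\<lambda>x. f (x + u n) - f x) \<le> norm_L2 (\<lambda>x. f (x + u n) - h k (x + u n))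
        + (norm_L2 (\<lambda>x. h k (x + u n) - h k x) + norm_L2 (\<lambda>x. h k x - f x))"
      by (rule order_trans[OF norm_L2_triangle_diff add_left_mono[OF norm_L2_triangle_diff]])
         (intro L2_translate f2 h2)+
    ultimately show ?thesis using k norm_L2_minus_commute[of f "h k"] by linarith
  qed
  then show "\<exists>N. \<forall>n\<ge>N. norm (norm_L2 (\<lambda>x. f (x + u n) - f x) - 0) < e" by auto
qed

section \<open>Plancherel's theorem\<close>

text \<open>Fubini in coordinates, with Lebesgue measure viewed as the image of a product of
  measures on the line.\<close>

lemma
  fixes f :: "'a::euclidean_space \<Rightarrow> real \<Rightarrow> complex"
  assumes f: "\<And>b. b \<in> Basis \<Longrightarrow> integrable lborel (f b)"
  shows lborel_integral_prod: "(LINT z|lborel. (\<Prod>b\<in>Basis. f b (z \<bullet> b))) = (\<Prod>b\<in>Basis. LINT x|lborel. f b x)"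
    and lborel_integrable_prod: "integrable lborel (\<lambda>z. \<Prod>b\<in>Basis. f b (z \<bullet> b))"
proof -
  interpret product_sigma_finite "\<lambda>_::'a. lborel :: real measure" ..
  let ?T = "\<lambda>g::'a \<Rightarrow> real. \<Sum>b\<in>Basis. g b *\<^sub>R b"
  have [measurable]: "f b \<in> borel_measurable borel" if "b \<in> Basis" for b
    using f[OF that] by (simp add: borel_measurable_integrable)
  have T: "?T \<in> measurable (\<Pi>\<^sub>M b\<in>Basis. lborel) borel"
    by measurable
  have prod_meas: "(\<lambda>z. \<Prod>b\<in>Basis. f b (z \<bullet> b)) \<in> borel_measurable borel"
    by measurable
  have eq: "(\<Prod>b\<in>Basis. f b (?T g \<bullet> b)) = (\<Prod>b\<in>Basis. f b (g b))" for g
    by (intro prod.cong) (simp_all add: inner_sum_left_Basis)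
  show "(LINT z|lborel. (\<Prod>b\<in>Basis. f b (z \<bullet> b))) = (\<Prod>b\<in>Basis. LINT x|lborel. f b x)"
    by (subst lborel_eq, subst integral_distr[OF T prod_meas], subst eq, rule product_integral_prod)
       (use f in auto)
  show "integrable lborel (\<lambda>z. \<Prod>b\<in>Basis. f b (z \<bullet> b))"
    by (subst lborel_eq, subst integrable_distr_eq[OF T prod_meas], subst eq, rule product_integrable_prod)
       (use f in auto)
qed

text \<open>The integral is the characteristic function of the standard normal distribution.\<close>

lemma
  fixes t :: real
  shows std_normal_fourier: "(LINT x|lborel. std_normal_density x * cis (t * x)) = exp (- t\<^sup>2 / 2)"
    and std_normal_fourier_integrable: "integrable lborel (\<lambda>x. std_normal_density x * cis (t * x))"
proof -
  have "char std_normal_distribution t = (LINT x|lborel. std_normal_density x *\<^sub>R iexp (t * x))"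
    unfolding char_def by (subst integral_density) (auto simp: normal_density_nonneg)
  then show "(LINT x|lborel. std_normal_density x * cis (t * x)) = exp (- t\<^sup>2 / 2)"
    unfolding char_std_normal_distribution by (simp add: cis_conv_exp scaleR_conv_of_real)
  show "integrable lborel (\<lambda>x. std_normal_density x * cis (t * x))"
    by (rule Bochner_Integration.integrable_bound[OF integrable_normal_density[of 1 0]])
       (auto simp: norm_mult cis_conv_exp)
qed

text \<open>The standard normal density of the space. The product over coordinates lets its Fourier
  integral factor into integrals on the line; \<open>gauss_exp\<close> gives the radial
  form.\<close>

definition gauss :: "'a::euclidean_space \<Rightarrow> real" where
  "gauss z = (\<Prod>b\<in>Basis. std_normal_density (z \<bullet> b))"

lemma borel_measurable_gauss [measurable]: "gauss \<in> borel_measurable borel"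
  unfolding gauss_def by measurable

lemma gauss_exp:
  "gauss (z::'a::euclidean_space) = (1 / sqrt (2 * pi)) ^ DIM('a) * exp (- (norm z)\<^sup>2 / 2)"
proof -
  have "(norm z)\<^sup>2 = (\<Sum>b\<in>Basis. (z \<bullet> b)\<^sup>2)"
    unfolding power2_norm_eq_inner by (subst euclidean_inner) (simp add: power2_eq_square)
  then have "exp (- (norm z)\<^sup>2 / 2) = (\<Prod>b\<in>Basis. exp (- (z \<bullet> b)\<^sup>2 / 2))"
    by (simp add: exp_sum[symmetric] sum_negf sum_divide_distrib)
  then show ?thesis
    by (simp only: gauss_def std_normal_density_def prod.distrib prod_constant)
qed

lemma gauss_pos: "0 < gauss z"
  by (simp add: gauss_exp)

lemma gauss_minus: "gauss (- z) = gauss z"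
  by (simp add: gauss_exp)

lemma
  fixes w :: "'a::euclidean_space"
  shows gauss_fourier: "(LINT z|lborel. gauss z * cis (w \<bullet> z)) = exp (- (norm w)\<^sup>2 / 2)"
    and gauss_fourier_integrable: "integrable lborel (\<lambda>z. gauss z * cis (w \<bullet> z))"
proof -
  have cis_sum: "cis (\<Sum>b\<in>S. h b) = (\<Prod>b\<in>S. cis (h b))" if "finite S" for S :: "'a set" and h
    using that by (induction S rule: finite_induct) (auto simp flip: cis_mult)
  have eq: "gauss z * cis (w \<bullet> z) = (\<Prod>b\<in>Basis. std_normal_density (z \<bullet> b) * cis ((w \<bullet> b) * (z \<bullet> b)))" for z
    by (subst euclidean_inner[of w]) (simp add: gauss_def prod.distrib cis_sum)
  have norm: "(norm w)\<^sup>2 = (\<Sum>b\<in>Basis. (w \<bullet> b)\<^sup>2)"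
    unfolding power2_norm_eq_inner by (subst euclidean_inner) (simp add: power2_eq_square)
  have "(LINT z|lborel. gauss z * cis (w \<bullet> z)) = (\<Prod>b\<in>Basis. complex_of_real (exp (- (w \<bullet> b)\<^sup>2 / 2)))"
    unfolding eq
    by (subst lborel_integral_prod[of "\<lambda>b x. std_normal_density x * cis ((w \<bullet> b) * x)"])
       (simp_all only: std_normal_fourier std_normal_fourier_integrable)
  also have "\<dots> = complex_of_real (exp (\<Sum>b\<in>Basis. - (w \<bullet> b)\<^sup>2 / 2))"
    by (simp only: exp_sum[OF finite_Basis] of_real_prod)
  also have "(\<Sum>b\<in>Basis. - (w \<bullet> b)\<^sup>2 / 2) = - (norm w)\<^sup>2 / 2"
    by (simp add: norm sum_negf sum_divide_distrib)
  finally show "(LINT z|lborel. gauss z * cis (w \<bullet> z)) = exp (- (norm w)\<^sup>2 / 2)" .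
  show "integrable lborel (\<lambda>z. gauss z * cis (w \<bullet> z))"
    unfolding eq
    by (rule lborel_integrable_prod[of "\<lambda>b x. std_normal_density x * cis ((w \<bullet> b) * x)"])
       (rule std_normal_fourier_integrable)
qed

lemma gauss_integrable: "integrable lborel (gauss :: 'a::euclidean_space \<Rightarrow> real)"
  using integrable_norm[OF gauss_fourier_integrable[of "0::'a"]]
  by (simp add: norm_mult abs_of_pos gauss_pos)

lemma gauss_integral: "(LINT z|lborel. gauss (z::'a::euclidean_space)) = 1"
proof -
  have "complex_of_real (LINT z|lborel. gauss (z::'a)) = 1"
    using gauss_fourier[of "0::'a"] by (simp flip: integral_complex_of_real)
  then show ?thesis by simp
qed

section \<open>Affine substitution and Gaussian weights\<close>

lemma integral_lborel_affine:
  fixes f :: "'a::euclidean_space \<Rightarrow> 'b::{banach, second_countable_topology}"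
  assumes [measurable]: "f \<in> borel_measurable borel" and c: "c \<noteq> 0"
  shows "(LINT x|lborel. f x) = \<bar>c\<bar> ^ DIM('a) *\<^sub>R (LINT x|lborel. f (t + c *\<^sub>R x))"
proof -
  have "(LINT x|lborel. f x) = (LINT x|density (distr lborel borel (\<lambda>x. t + c *\<^sub>R x)) (\<lambda>_. ennreal (\<bar>c\<bar> ^ DIM('a))). f x)"
    using lborel_affine[OF c, of t] by (simp add: ennreal_power)
  also have "\<dots> = (LINT x|distr lborel borel (\<lambda>x. t + c *\<^sub>R x). \<bar>c\<bar> ^ DIM('a) *\<^sub>R f x)"
    by (rule integral_density) auto
  also have "\<dots> = (LINT x|lborel. \<bar>c\<bar> ^ DIM('a) *\<^sub>R f (t + c *\<^sub>R x))"
    by (rule integral_distr) auto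
  finally show ?thesis by simp
qed

lemma integrable_lborel_affine:
  fixes f :: "'a::euclidean_space \<Rightarrow> 'b::{banach, second_countable_topology}"
  assumes f: "integrable lborel f" and c: "c \<noteq> 0"
  shows "integrable lborel (\<lambda>x. f (t + c *\<^sub>R x))"
proof -
  have [measurable]: "f \<in> borel_measurable borel" using f by (simp add: borel_measurable_integrable)
  have "integrable (density (distr lborel borel (\<lambda>x. t + c *\<^sub>R x)) (\<lambda>_. ennreal (\<bar>c\<bar> ^ DIM('a)))) f"
    using lborel_affine[OF c, of t] f by (simp add: ennreal_power)
  then have "integrable (distr lborel borel (\<lambda>x. t + c *\<^sub>R x)) (\<lambda>x. \<bar>c\<bar> ^ DIM('a) *\<^sub>R f x)"
    by (subst (asm) integrable_density) auto
  then have "integrable lborel (\<lambda>x. \<bar>c\<bar> ^ DIM('a) *\<^sub>R f (t + c *\<^sub>R x))"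
    by (subst (asm) integrable_distr_eq) auto
  from integrable_scaleR_right[OF this, of "inverse (\<bar>c\<bar> ^ DIM('a))"]
  show ?thesis using c by simp
qed

text \<open>A damping factor increasing to 1 as \<delta> decreases to 0, scaled so that its Fourier
  transform is the normal density with standard deviation \<delta>, an approximate identity.\<close>

definition gauss_weight :: "real \<Rightarrow> 'a::euclidean_space \<Rightarrow> real" where
  "gauss_weight \<delta> \<xi> = exp (- (2 * pi * \<delta> * norm \<xi>)\<^sup>2 / 2)"

lemma borel_measurable_gauss_weight [measurable]: "gauss_weight \<delta> \<in> borel_measurable borel"
  unfolding gauss_weight_def by measurable

lemma gauss_weight_eq:
  "gauss (0 + (2 * pi * \<delta>) *\<^sub>R \<xi>) = (1 / sqrt (2 * pi)) ^ DIM('a) * gauss_weight \<delta> (\<xi>::'a::euclidean_space)"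
  by (simp add: gauss_exp gauss_weight_def power_mult_distrib)

text \<open>Evaluate \<open>gauss_fourier\<close> at \<open>u /\<^sub>R \<delta>\<close> and
  substitute z = 2 pi \<delta> \<xi>, which turns its \<open>cis\<close> factor into
  \<open>phase (u \<bullet> \<xi>)\<close>.\<close>

lemma
  fixes u :: "'a::euclidean_space"
  assumes \<delta>: "0 < \<delta>"
  shows gauss_weight_fourier: "(LINT \<xi>|lborel. gauss_weight \<delta> \<xi> * phase (u \<bullet> \<xi>)) = gauss (u /\<^sub>R \<delta>) / \<delta> ^ DIM('a)"
    and gauss_weight_integrable: "integrable lborel (gauss_weight \<delta> :: 'a \<Rightarrow> real)"
proof -
  let ?c = "2 * pi * \<delta>" and ?d = "DIM('a)" and ?q = "1 / sqrt (2 * pi)"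
  have c: "?c \<noteq> 0" using \<delta> by simp
  have "complex_of_real (exp (- (norm (u /\<^sub>R \<delta>))\<^sup>2 / 2)) = (LINT z|lborel. gauss z * cis ((u /\<^sub>R \<delta>) \<bullet> z))"
    by (rule gauss_fourier[symmetric])
  also have "\<dots> = \<bar>?c\<bar> ^ ?d *\<^sub>R (LINT \<xi>|lborel. gauss (0 + ?c *\<^sub>R \<xi>) * cis ((u /\<^sub>R \<delta>) \<bullet> (0 + ?c *\<^sub>R \<xi>)))"
    by (rule integral_lborel_affine[OF _ c]) (simp add: cis_conv_exp)
  also have "(\<lambda>\<xi>. gauss (0 + ?c *\<^sub>R \<xi>) * cis ((u /\<^sub>R \<delta>) \<bullet> (0 + ?c *\<^sub>R \<xi>)))
      = (\<lambda>\<xi>. complex_of_real (?q ^ ?d) * (gauss_weight \<delta> \<xi> * phase (u \<bullet> \<xi>)))"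
  proof
    fix \<xi>
    have inner: "(u /\<^sub>R \<delta>) \<bullet> (0 + ?c *\<^sub>R \<xi>) = 2 * pi * (u \<bullet> \<xi>)" using \<delta> by simp
    show "gauss (0 + ?c *\<^sub>R \<xi>) * cis ((u /\<^sub>R \<delta>) \<bullet> (0 + ?c *\<^sub>R \<xi>))
        = complex_of_real (?q ^ ?d) * (gauss_weight \<delta> \<xi> * phase (u \<bullet> \<xi>))"
      unfolding inner gauss_weight_eq phase_def by (simp only: of_real_mult mult.assoc)
  qed
  also have "\<bar>?c\<bar> ^ ?d *\<^sub>R (LINT \<xi>|lborel. complex_of_real (?q ^ ?d) * (gauss_weight \<delta> \<xi> * phase (u \<bullet> \<xi>)))
      = complex_of_real (\<bar>?c\<bar> ^ ?d) * (complex_of_real (?q ^ ?d) * (LINT \<xi>|lborel. gauss_weight \<delta> \<xi> * phase (u \<bullet> \<xi>)))"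
    by (simp only: integral_mult_right_zero scaleR_conv_of_real)
  also have "\<dots> = complex_of_real ((?c * ?q) ^ ?d) * (LINT \<xi>|lborel. gauss_weight \<delta> \<xi> * phase (u \<bullet> \<xi>))"
  proof -
    have "\<bar>?c\<bar> ^ ?d * ?q ^ ?d = (?c * ?q) ^ ?d"
      using \<delta> by (simp only: power_mult_distrib[symmetric]) (simp add: abs_mult)
    then show ?thesis by (simp only: mult.assoc[symmetric] of_real_mult[symmetric])
  qed
  finally have *: "complex_of_real (exp (- (norm (u /\<^sub>R \<delta>))\<^sup>2 / 2))
      = complex_of_real ((?c * ?q) ^ ?d) * (LINT \<xi>|lborel. gauss_weight \<delta> \<xi> * phase (u \<bullet> \<xi>))" .
  \<comment> \<open>The square of \<open>?q\<close> is 1 / (2 pi). Hence dividing by the Jacobian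
    constant restores the normalisation of \<open>gauss\<close>.\<close>
  have "?c * ?q = \<delta> / ?q"
    by (simp add: field_simps)
  then have "(?c * ?q) ^ ?d = \<delta> ^ ?d / ?q ^ ?d"
    by (simp only: power_divide)
  then have "gauss (u /\<^sub>R \<delta>) / \<delta> ^ ?d = exp (- (norm (u /\<^sub>R \<delta>))\<^sup>2 / 2) / (?c * ?q) ^ ?d"
    unfolding gauss_exp by simp
  then have "complex_of_real (gauss (u /\<^sub>R \<delta>) / \<delta> ^ ?d)
      = complex_of_real (exp (- (norm (u /\<^sub>R \<delta>))\<^sup>2 / 2)) / complex_of_real ((?c * ?q) ^ ?d)"
    by (simp only: of_real_divide)
  also have "\<dots> = (LINT \<xi>|lborel. gauss_weight \<delta> \<xi> * phase (u \<bullet> \<xi>))"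
    unfolding * using \<delta> by simp
  finally show "(LINT \<xi>|lborel. gauss_weight \<delta> \<xi> * phase (u \<bullet> \<xi>)) = gauss (u /\<^sub>R \<delta>) / \<delta> ^ DIM('a)"
    by simp
  have "integrable lborel (\<lambda>\<xi>::'a. gauss (0 + ?c *\<^sub>R \<xi>))"
    by (rule integrable_lborel_affine[OF gauss_integrable c])
  then show "integrable lborel (gauss_weight \<delta> :: 'a \<Rightarrow> real)"
    unfolding gauss_weight_eq by simp
qed

text \<open>Fubini, with \<open>a x * b \<xi>\<close> as integrable majorant. The sign of
  \<open>c\<close> covers the transform and its conjugate.\<close>

lemma fourier_multiplication_formula:
  fixes a b :: "'a::euclidean_space \<Rightarrow> complex"
  assumes a: "integrable lborel a" and b: "integrable lborel b"
  shows "(LINT x|lborel. a x * (LINT \<xi>|lborel. b \<xi> * phase (c * (x \<bullet> \<xi>))))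
       = (LINT \<xi>|lborel. b \<xi> * (LINT x|lborel. a x * phase (c * (x \<bullet> \<xi>))))"
proof -
  have [measurable]: "a \<in> borel_measurable borel" "b \<in> borel_measurable borel"
    using a b by (auto simp: borel_measurable_integrable)
  have "integrable (lborel \<Otimes>\<^sub>M lborel) (\<lambda>(x, \<xi>). a x * b \<xi> * phase (c * (x \<bullet> \<xi>)))"
  proof (rule lborel_pair.Fubini_integrable)
    show "integrable lborel (\<lambda>x. LINT \<xi>|lborel. norm (case (x, \<xi>) of (x, \<xi>) \<Rightarrow> a x * b \<xi> * phase (c * (x \<bullet> \<xi>))))"
      using a by (simp add: norm_mult)
    show "AE x in lborel. integrable lborel (\<lambda>\<xi>. case (x, \<xi>) of (x, \<xi>) \<Rightarrow> a x * b \<xi> * phase (c * (x \<bullet> \<xi>)))"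
    proof (intro AE_I2)
      fix x
      have "integrable lborel (\<lambda>\<xi>. a x * b \<xi>)" using b by simp
      then show "integrable lborel (\<lambda>\<xi>. case (x, \<xi>) of (x, \<xi>) \<Rightarrow> a x * b \<xi> * phase (c * (x \<bullet> \<xi>)))"
        by (rule Bochner_Integration.integrable_bound) (auto simp: norm_mult)
    qed
  qed measurable
  from lborel_pair.Fubini_integral[OF this]
  show ?thesis
    by (simp add: mult.assoc mult.left_commute[of "b _"] flip: integral_mult_right_zero)
qed

section \<open>From Borel to Lebesgue measurability, and Plancherel for integrable functions\<close>

lemma borel_measurable_lebesgueI: "f \<in> borel_measurable borel \<Longrightarrow> f \<in> borel_measurable lebesgue"
  by (intro measurable_completion) simp

lemma integral_lebesgue_eq_lborel:
  fixes f :: "'a::euclidean_space \<Rightarrow> 'b::{banach, second_countable_topology}"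
  shows "f \<in> borel_measurable borel \<Longrightarrow> (LINT x|lebesgue. f x) = (LINT x|lborel. f x)"
  by (intro integral_completion) simp

lemma integrable_lebesgue_iff_lborel:
  fixes f :: "'a::euclidean_space \<Rightarrow> 'b::{banach, second_countable_topology}"
  shows "f \<in> borel_measurable borel \<Longrightarrow> integrable lebesgue f \<longleftrightarrow> integrable lborel f"
  by (intro integrable_completion) simp

text \<open>The bound does not depend on \<open>a\<close>; multiplied by the Gaussian it justifies
  exchanging the integrals over the point and over the translation.\<close>

lemma L2_translate_product:
  fixes f :: "'a::euclidean_space \<Rightarrow> complex"
  assumes f2: "f \<in> L2"
  shows "integrable lebesgue (\<lambda>x. norm (f x * cnj (f (x + a))))"
    and "(LINT x|lebesgue. norm (f x * cnj (f (x + a)))) \<le> (norm_L2 f)\<^sup>2"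
proof -
  note t2 = L2_translate[OF f2, of a]
  show int: "integrable lebesgue (\<lambda>x. norm (f x * cnj (f (x + a))))"
    by (intro integrable_norm L2_inner_integrable f2 t2)
  have i: "integrable lebesgue (\<lambda>x. ((norm (f x))\<^sup>2 + (norm (f (x + a)))\<^sup>2) / 2)"
    using L2_integrable_norm_sq[OF f2] L2_integrable_norm_sq[OF t2] by simp
  have "(LINT x|lebesgue. norm (f x * cnj (f (x + a))))
      \<le> (LINT x|lebesgue. ((norm (f x))\<^sup>2 + (norm (f (x + a)))\<^sup>2) / 2)"
  proof (intro integral_mono int i)
    fix x show "norm (f x * cnj (f (x + a))) \<le> ((norm (f x))\<^sup>2 + (norm (f (x + a)))\<^sup>2) / 2"
      using sum_squares_bound[of "norm (f x)" "norm (f (x + a))"] by (simp add: norm_mult)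
  qed
  also have "\<dots> = ((norm_L2 f)\<^sup>2 + (norm_L2 (\<lambda>x. f (x + a)))\<^sup>2) / 2"
    using L2_integrable_norm_sq[OF f2] L2_integrable_norm_sq[OF t2] by (simp add: norm_L2_sq)
  finally show "(LINT x|lebesgue. norm (f x * cnj (f (x + a)))) \<le> (norm_L2 f)\<^sup>2"
    by (simp add: norm_L2_translate[OF f2])
qed

text \<open>The weight makes the integral of |F|^2 converge, since F is merely known to be bounded
  by the L1 norm of \<open>f\<close>. Writing |F|^2 as F times its conjugate and using the
  multiplication formula twice gives a Gaussian average of the autocorrelation of
  \<open>f\<close>.\<close>

lemma plancherel_weighted:
  fixes f :: "'a::euclidean_space \<Rightarrow> complex"
  assumes f [measurable]: "f \<in> borel_measurable borel" and f1: "integrable lborel f" and f2: "f \<in> L2"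
    and \<delta>: "0 < \<delta>"
  defines "F \<equiv> \<lambda>\<xi>. LINT x|lborel. f x * phase (x \<bullet> \<xi>)"
  shows "(LINT \<xi>|lborel. complex_of_real ((norm (F \<xi>))\<^sup>2 * gauss_weight \<delta> \<xi>))
      = (LINT z|lborel. gauss z * inner_L2 f (\<lambda>x. f (x + \<delta> *\<^sub>R z)))"
    and "integrable lborel (\<lambda>\<xi>. (norm (F \<xi>))\<^sup>2 * gauss_weight \<delta> \<xi>)"
proof -
  let ?W = "gauss_weight \<delta> :: 'a \<Rightarrow> real"
  note W = gauss_weight_integrable[OF \<delta>, where 'a = 'a]
  have F_meas [measurable]: "F \<in> borel_measurable borel"
    unfolding F_def by measurable
  define C where "C = (LINT x|lborel. norm (f x))"
  have F_le: "norm (F \<xi>) \<le> C" for \<xi>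
    unfolding F_def C_def by (rule order_trans[OF integral_norm_bound]) (simp add: norm_mult)
  have C0: "0 \<le> C" using order_trans[OF norm_ge_zero F_le] .
  have W0: "0 \<le> ?W \<xi>" for \<xi> by (simp add: gauss_weight_def)
  have Wc: "integrable lborel (\<lambda>\<xi>. complex_of_real (?W \<xi>))" using W by simp
  have b: "integrable lborel (\<lambda>\<xi>. cnj (F \<xi>) * ?W \<xi>)"
    by (rule Bochner_Integration.integrable_bound[OF integrable_mult_right[OF W, of C]])
       (auto simp: norm_mult W0 C0 abs_mult intro!: mult_right_mono F_le)
  show "integrable lborel (\<lambda>\<xi>. (norm (F \<xi>))\<^sup>2 * ?W \<xi>)"
    by (rule Bochner_Integration.integrable_bound[OF integrable_mult_right[OF W, of "C\<^sup>2"]])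
       (auto simp: norm_mult W0 C0 abs_mult intro!: mult_right_mono power_mono F_le)
  have cnjF: "cnj (F \<xi>) = (LINT y|lborel. cnj (f y) * phase (- 1 * (y \<bullet> \<xi>)))" for \<xi>
    unfolding F_def by (subst Bochner_Integration.integral_cnj[symmetric]) (simp add: cnj_phase)
  \<comment> \<open>Fourier inversion up to smoothing: the multiplication formula replaces the
    weight by its transform, a normal density around \<open>x\<close>, and the substitution y = x +
    \<delta> z standardises it.\<close>
  have kernel: "(LINT \<xi>|lborel. cnj (F \<xi>) * ?W \<xi> * phase (1 * (x \<bullet> \<xi>)))
      = (LINT z|lborel. gauss z * cnj (f (x + \<delta> *\<^sub>R z)))" for x
  proof -
    let ?b = "\<lambda>\<xi>. complex_of_real (?W \<xi>) * phase (x \<bullet> \<xi>)"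
    have "(LINT \<xi>|lborel. cnj (F \<xi>) * ?W \<xi> * phase (1 * (x \<bullet> \<xi>)))
        = (LINT \<xi>|lborel. ?b \<xi> * (LINT y|lborel. cnj (f y) * phase (- 1 * (y \<bullet> \<xi>))))"
      unfolding cnjF[symmetric] by (simp add: mult_ac)
    also have "\<dots> = (LINT y|lborel. cnj (f y) * (LINT \<xi>|lborel. ?b \<xi> * phase (- 1 * (y \<bullet> \<xi>))))"
    proof (rule fourier_multiplication_formula[symmetric])
      show "integrable lborel (\<lambda>y. cnj (f y))" using f1 by simp
      show "integrable lborel ?b"
        by (rule Bochner_Integration.integrable_bound[OF W]) (auto simp: norm_mult)
    qed
    also have "(\<lambda>y. LINT \<xi>|lborel. ?b \<xi> * phase (- 1 * (y \<bullet> \<xi>)))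
        = (\<lambda>y. complex_of_real (gauss ((x - y) /\<^sub>R \<delta>) / \<delta> ^ DIM('a)))"
    proof
      fix y
      have eq: "?b \<xi> * phase (- 1 * (y \<bullet> \<xi>)) = ?W \<xi> * phase ((x - y) \<bullet> \<xi>)" for \<xi>
        using phase_add[of "x \<bullet> \<xi>" "- 1 * (y \<bullet> \<xi>)"] by (simp add: inner_diff_left)
      show "(LINT \<xi>|lborel. ?b \<xi> * phase (- 1 * (y \<bullet> \<xi>))) = complex_of_real (gauss ((x - y) /\<^sub>R \<delta>) / \<delta> ^ DIM('a))"
        unfolding eq using gauss_weight_fourier[OF \<delta>, of "x - y"] by simp
    qed
    also have "(LINT y|lborel. cnj (f y) * complex_of_real (gauss ((x - y) /\<^sub>R \<delta>) / \<delta> ^ DIM('a)))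
        = \<bar>\<delta>\<bar> ^ DIM('a) *\<^sub>R (LINT z|lborel. cnj (f (x + \<delta> *\<^sub>R z)) *
            complex_of_real (gauss ((x - (x + \<delta> *\<^sub>R z)) /\<^sub>R \<delta>) / \<delta> ^ DIM('a)))"
      by (rule integral_lborel_affine) (use \<delta> in auto)
    also have "(\<lambda>z. cnj (f (x + \<delta> *\<^sub>R z)) * complex_of_real (gauss ((x - (x + \<delta> *\<^sub>R z)) /\<^sub>R \<delta>) / \<delta> ^ DIM('a)))
        = (\<lambda>z. (gauss z * cnj (f (x + \<delta> *\<^sub>R z))) / of_real (\<delta> ^ DIM('a)))"
    proof
      fix z :: 'a
      have "(x - (x + \<delta> *\<^sub>R z)) /\<^sub>R \<delta> = - z" using \<delta> by simp
      then show "cnj (f (x + \<delta> *\<^sub>R z)) * complex_of_real (gauss ((x - (x + \<delta> *\<^sub>R z)) /\<^sub>R \<delta>) / \<delta> ^ DIM('a))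
          = (gauss z * cnj (f (x + \<delta> *\<^sub>R z))) / of_real (\<delta> ^ DIM('a))"
        by (simp only: gauss_minus of_real_divide) (simp add: mult.commute)
    qed
    also have "\<bar>\<delta>\<bar> ^ DIM('a) *\<^sub>R (LINT z|lborel. (gauss z * cnj (f (x + \<delta> *\<^sub>R z))) / of_real (\<delta> ^ DIM('a)))
        = (LINT z|lborel. gauss z * cnj (f (x + \<delta> *\<^sub>R z)))"
      using \<delta> by (simp add: scaleR_conv_of_real)
    finally show ?thesis .
  qed
  have "(LINT \<xi>|lborel. complex_of_real ((norm (F \<xi>))\<^sup>2 * ?W \<xi>))
      = (LINT \<xi>|lborel. (cnj (F \<xi>) * ?W \<xi>) * (LINT x|lborel. f x * phase (1 * (x \<bullet> \<xi>))))"
  proof -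
    have eq: "complex_of_real ((norm (F \<xi>))\<^sup>2 * ?W \<xi>) = (cnj (F \<xi>) * ?W \<xi>) * F \<xi>" for \<xi>
      unfolding of_real_mult complex_norm_square by (simp add: mult_ac)
    show ?thesis unfolding eq by (simp add: F_def)
  qed
  also have "\<dots> = (LINT x|lborel. f x * (LINT \<xi>|lborel. (cnj (F \<xi>) * ?W \<xi>) * phase (1 * (x \<bullet> \<xi>))))"
    by (rule fourier_multiplication_formula[symmetric, OF f1 b])
  also have "\<dots> = (LINT x|lborel. f x * (LINT z|lborel. gauss z * cnj (f (x + \<delta> *\<^sub>R z))))"
    by (simp only: kernel)
  also have "\<dots> = (LINT x|lborel. LINT z|lborel. gauss z * (f x * cnj (f (x + \<delta> *\<^sub>R z))))"
    by (simp add: mult.left_commute[of "f _"] flip: integral_mult_right_zero)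
  also have "\<dots> = (LINT z|lborel. LINT x|lborel. gauss z * (f x * cnj (f (x + \<delta> *\<^sub>R z))))"
  proof (rule lborel_pair.Fubini_integral, rule lborel_pair.Fubini_integrable)
    have prod: "integrable lborel (\<lambda>x. norm (f x * cnj (f (x + a))))"
        "(LINT x|lborel. norm (f x * cnj (f (x + a)))) \<le> (norm_L2 f)\<^sup>2" for a
      using L2_translate_product[OF f2, of a]
      by (simp_all add: integrable_lebesgue_iff_lborel integral_lebesgue_eq_lborel)
    show "integrable lborel (\<lambda>z::'a. LINT x|lborel. norm (case (z, x) of (z, x) \<Rightarrow> gauss z * (f x * cnj (f (x + \<delta> *\<^sub>R z)))))"
    proof (rule Bochner_Integration.integrable_bound[OF integrable_mult_right[OF gauss_integrable, of "(norm_L2 f)\<^sup>2"]])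
      show "AE z in lborel. norm (LINT x|lborel. norm (case (z, x) of (z, x) \<Rightarrow> gauss z * (f x * cnj (f (x + \<delta> *\<^sub>R z)))))
          \<le> norm ((norm_L2 f)\<^sup>2 * gauss z)"
      proof (intro AE_I2)
        fix z :: 'a
        have "(LINT x|lborel. norm (gauss z * (f x * cnj (f (x + \<delta> *\<^sub>R z)))))
            = gauss z * (LINT x|lborel. norm (f x * cnj (f (x + \<delta> *\<^sub>R z))))"
          by (simp add: norm_mult abs_of_pos gauss_pos)
        also have "\<dots> \<le> gauss z * (norm_L2 f)\<^sup>2"
          by (intro mult_left_mono prod less_imp_le gauss_pos)
        finally show "norm (LINT x|lborel. norm (case (z, x) of (z, x) \<Rightarrow> gauss z * (f x * cnj (f (x + \<delta> *\<^sub>R z)))))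
            \<le> norm ((norm_L2 f)\<^sup>2 * gauss z)"
          by (simp add: abs_mult gauss_pos abs_of_pos mult.commute abs_of_nonneg[OF integral_nonneg])
      qed
    qed measurable
    show "AE z in lborel. integrable lborel (\<lambda>x. case (z, x) of (z, x) \<Rightarrow> gauss z * (f x * cnj (f (x + \<delta> *\<^sub>R z))))"
    proof (intro AE_I2)
      fix z :: 'a
      have "integrable lborel (\<lambda>x. f x * cnj (f (x + \<delta> *\<^sub>R z)))"
        using prod(1)[of "\<delta> *\<^sub>R z"] by (subst (asm) integrable_norm_iff) auto
      then show "integrable lborel (\<lambda>x. case (z, x) of (z, x) \<Rightarrow> gauss z * (f x * cnj (f (x + \<delta> *\<^sub>R z))))"
        by simp
    qed
  qed measurable
  also have "\<dots> = (LINT z|lborel. gauss z * inner_L2 f (\<lambda>x. f (x + \<delta> *\<^sub>R z)))"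
    unfolding inner_L2_def by (simp add: integral_lebesgue_eq_lborel)
  finally show "(LINT \<xi>|lborel. complex_of_real ((norm (F \<xi>))\<^sup>2 * ?W \<xi>))
      = (LINT z|lborel. gauss z * inner_L2 f (\<lambda>x. f (x + \<delta> *\<^sub>R z)))" .
qed

text \<open>Let \<delta> tend to 0 in \<open>plancherel_weighted\<close>. The autocorrelation side
  converges by L2-continuity of translation and dominated convergence. On the frequency side the
  weights increase to 1, so monotone convergence applies and also yields square integrability of
  F.\<close>

lemma plancherel_borel:
  fixes f :: "'a::euclidean_space \<Rightarrow> complex"
  assumes f [measurable]: "f \<in> borel_measurable borel" and f1: "integrable lborel f" and f2: "f \<in> L2"
  defines "F \<equiv> \<lambda>\<xi>. LINT x|lborel. f x * phase (x \<bullet> \<xi>)"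
  shows "(\<integral>\<^sup>+\<xi>. ennreal ((norm (F \<xi>))\<^sup>2) \<partial>lborel) = ennreal ((norm_L2 f)\<^sup>2)"
proof -
  define \<delta> where "\<delta> n = 1 / (real n + 1)" for n
  have \<delta>: "0 < \<delta> n" for n by (simp add: \<delta>_def)
  have \<delta>0: "\<delta> \<longlonglongrightarrow> 0" unfolding \<delta>_def by real_asymp
  have F_meas [measurable]: "F \<in> borel_measurable borel"
    unfolding F_def by measurable
  have "(\<lambda>n. LINT z|lborel. gauss z * inner_L2 f (\<lambda>x. f (x + \<delta> n *\<^sub>R z)))
      \<longlonglongrightarrow> (LINT z|lborel. gauss (z::'a) * inner_L2 f f)"
  proof (rule integral_dominated_convergence[where w="\<lambda>z. (norm_L2 f)\<^sup>2 * gauss z"])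
    show "integrable lborel (\<lambda>z::'a. (norm_L2 f)\<^sup>2 * gauss z)" by (intro integrable_mult_right gauss_integrable)
    show "AE z::'a in lborel. (\<lambda>n. gauss z * inner_L2 f (\<lambda>x. f (x + \<delta> n *\<^sub>R z))) \<longlonglongrightarrow> gauss z * inner_L2 f f"
    proof (intro AE_I2 tendsto_mult tendsto_const)
      fix z :: 'a
      have "(\<lambda>n. \<delta> n *\<^sub>R z) \<longlonglongrightarrow> 0 *\<^sub>R z" by (intro tendsto_intros \<delta>0)
      then have "(\<lambda>n. norm_L2 (\<lambda>x. f (x + \<delta> n *\<^sub>R z) - f x)) \<longlonglongrightarrow> 0"
        using f1 by (intro tendsto_translate_L2 f2) (simp_all add: integrable_lebesgue_iff_lborel)
      then have "tendsto_L2 (\<lambda>n x. f (x + \<delta> n *\<^sub>R z)) f"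
        by (auto simp: tendsto_L2_def f2 L2_translate)
      then show "(\<lambda>n. inner_L2 f (\<lambda>x. f (x + \<delta> n *\<^sub>R z))) \<longlonglongrightarrow> inner_L2 f f"
        by (rule tendsto_L2_inner_right[OF _ f2])
    qed
    show "AE z::'a in lborel. norm (gauss z * inner_L2 f (\<lambda>x. f (x + \<delta> n *\<^sub>R z))) \<le> (norm_L2 f)\<^sup>2 * gauss z" for n
    proof (intro AE_I2)
      fix z :: 'a
      have "norm (inner_L2 f (\<lambda>x. f (x + \<delta> n *\<^sub>R z))) \<le> (norm_L2 f)\<^sup>2"
        using norm_inner_L2_le[OF f2 L2_translate[OF f2], of "\<delta> n *\<^sub>R z"]
        by (simp add: norm_L2_translate[OF f2] power2_eq_square)
      then show "norm (gauss z * inner_L2 f (\<lambda>x. f (x + \<delta> n *\<^sub>R z))) \<le> (norm_L2 f)\<^sup>2 * gauss z"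
        using gauss_pos[of z] by (simp add: norm_mult mult.commute)
    qed
    show "(\<lambda>z::'a. gauss z * inner_L2 f (\<lambda>x. f (x + \<delta> n *\<^sub>R z))) \<in> borel_measurable lborel" for n
    proof -
      have "inner_L2 f (\<lambda>x. f (x + \<delta> n *\<^sub>R z)) = (LINT x|lborel. f x * cnj (f (x + \<delta> n *\<^sub>R z)))" for z
        unfolding inner_L2_def by (simp add: integral_lebesgue_eq_lborel)
      then show ?thesis by simp
    qed
  qed measurable
  also have "(LINT z|lborel. gauss (z::'a) * inner_L2 f f) = of_real ((norm_L2 f)\<^sup>2)"
  proof -
    have "(LINT z|lborel. gauss (z::'a) * inner_L2 f f) = complex_of_real (LINT z|lborel. gauss (z::'a)) * inner_L2 f f"
      by (simp only: integral_mult_left_zero integral_complex_of_real)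
    then show ?thesis by (simp add: gauss_integral inner_L2_self)
  qed
  finally have "(\<lambda>n. complex_of_real (LINT \<xi>|lborel. (norm (F \<xi>))\<^sup>2 * gauss_weight (\<delta> n) \<xi>)) \<longlonglongrightarrow> of_real ((norm_L2 f)\<^sup>2)"
    using plancherel_weighted(1)[OF f f1 f2 \<delta>] unfolding F_def by (simp only: integral_complex_of_real)
  then have "(\<lambda>n. LINT \<xi>|lborel. (norm (F \<xi>))\<^sup>2 * gauss_weight (\<delta> n) \<xi>) \<longlonglongrightarrow> (norm_L2 f)\<^sup>2"
    by (simp only: tendsto_of_real_iff)
  then have "(\<lambda>n. ennreal (LINT \<xi>|lborel. (norm (F \<xi>))\<^sup>2 * gauss_weight (\<delta> n) \<xi>)) \<longlonglongrightarrow> ennreal ((norm_L2 f)\<^sup>2)"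
    by (rule tendsto_ennrealI)
  moreover have "ennreal (LINT \<xi>|lborel. (norm (F \<xi>))\<^sup>2 * gauss_weight (\<delta> n) \<xi>)
      = (\<integral>\<^sup>+\<xi>. ennreal ((norm (F \<xi>))\<^sup>2 * gauss_weight (\<delta> n) \<xi>) \<partial>lborel)" for n
    using plancherel_weighted(2)[OF f f1 f2 \<delta>[of n]] unfolding F_def
    by (intro nn_integral_eq_integral[symmetric]) (auto simp: gauss_weight_def)
  ultimately have lim1: "(\<lambda>n. \<integral>\<^sup>+\<xi>. ennreal ((norm (F \<xi>))\<^sup>2 * gauss_weight (\<delta> n) \<xi>) \<partial>lborel) \<longlonglongrightarrow> ennreal ((norm_L2 f)\<^sup>2)"
    by simp
  have lim2: "(\<lambda>n. \<integral>\<^sup>+\<xi>. ennreal ((norm (F \<xi>))\<^sup>2 * gauss_weight (\<delta> n) \<xi>) \<partial>lborel) \<longlonglongrightarrow> (\<integral>\<^sup>+\<xi>. ennreal ((norm (F \<xi>))\<^sup>2) \<partial>lborel)"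
  proof (rule nn_integral_LIMSEQ)
    show "incseq (\<lambda>n \<xi>. ennreal ((norm (F \<xi>))\<^sup>2 * gauss_weight (\<delta> n) \<xi>))"
    proof (intro incseq_SucI le_funI ennreal_leI mult_left_mono)
      fix n :: nat and \<xi> :: 'a
      have "2 * pi * \<delta> (Suc n) * norm \<xi> \<le> 2 * pi * \<delta> n * norm \<xi>"
        by (intro mult_right_mono mult_left_mono) (auto simp: \<delta>_def field_simps)
      then have "(2 * pi * \<delta> (Suc n) * norm \<xi>)\<^sup>2 \<le> (2 * pi * \<delta> n * norm \<xi>)\<^sup>2"
        using \<delta>[of "Suc n"] by (intro power_mono) auto
      then show "gauss_weight (\<delta> n) \<xi> \<le> gauss_weight (\<delta> (Suc n)) \<xi>"
        unfolding gauss_weight_def by simp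
    qed simp
    fix \<xi> :: 'a
    have "(\<lambda>n. ennreal ((norm (F \<xi>))\<^sup>2 * exp (- (2 * pi * \<delta> n * norm \<xi>)\<^sup>2 / 2)))
        \<longlonglongrightarrow> ennreal ((norm (F \<xi>))\<^sup>2 * exp (- (2 * pi * 0 * norm \<xi>)\<^sup>2 / 2))"
      by (intro tendsto_intros \<delta>0) auto
    then show "(\<lambda>n. ennreal ((norm (F \<xi>))\<^sup>2 * gauss_weight (\<delta> n) \<xi>)) \<longlonglongrightarrow> ennreal ((norm (F \<xi>))\<^sup>2)"
      by (simp add: gauss_weight_def)
  qed measurable
  show ?thesis using LIMSEQ_unique[OF lim2 lim1] .
qed

text \<open>Supplies the Borel representative for the Fubini arguments, which take place on products
  of \<open>lborel\<close>.\<close>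

lemma lebesgue_ex_borel_complex:
  fixes f :: "'a::euclidean_space \<Rightarrow> complex"
  assumes [measurable]: "f \<in> borel_measurable lebesgue"
  obtains f' where "f' \<in> borel_measurable borel" "AE x in lebesgue. f x = f' x"
proof -
  obtain a b where ab: "a \<in> borel_measurable lborel" "b \<in> borel_measurable lborel"
    "AE x in lborel. Re (f x) = a x" "AE x in lborel. Im (f x) = b x"
    using completion_ex_borel_measurable_real[of "\<lambda>x. Re (f x)" lborel]
      completion_ex_borel_measurable_real[of "\<lambda>x. Im (f x)" lborel] by auto
  show ?thesis
  proof (rule that[of "\<lambda>x. Complex (a x) (b x)"])
    have "(\<lambda>x. complex_of_real (a x) + \<i> * complex_of_real (b x)) \<in> borel_measurable borel"
      using ab(1,2) by simp
    then show "(\<lambda>x. Complex (a x) (b x)) \<in> borel_measurable borel"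
      by (simp add: Complex_eq)
    show "AE x in lebesgue. f x = Complex (a x) (b x)"
      using AE_completion[OF ab(3)] AE_completion[OF ab(4)] by eventually_elim (simp add: complex_eq_iff)
  qed
qed

lemma fourier_L1_eq: "fourier_L1 f \<xi> = (LINT x|lebesgue. f x * phase (x \<bullet> \<xi>))"
  by (simp add: fourier_L1_def phase_exp)

lemma borel_measurable_phase_inner' [measurable]:
  "(\<lambda>x. phase (x \<bullet> w)) \<in> borel_measurable lebesgue"
  using borel_measurable_phase_inner[of w] by (simp add: inner_commute)

text \<open>Neither the transform nor the norms see null sets, so \<open>f\<close> may be replaced
  by a Borel representative.\<close>

lemma plancherel_L1:
  fixes f :: "'a::euclidean_space \<Rightarrow> complex"
  assumes f1: "integrable lebesgue f" and f2: "f \<in> L2"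
  shows "fourier_L1 f \<in> L2" and "norm_L2 (fourier_L1 f) = norm_L2 f"
proof -
  have f_meas [measurable]: "f \<in> borel_measurable lebesgue" using f2 by (rule L2_measurable)
  obtain f' where f' [measurable]: "f' \<in> borel_measurable borel" and ae: "AE x in lebesgue. f x = f' x"
    using lebesgue_ex_borel_complex[OF f_meas] by blast
  note [measurable] = borel_measurable_lebesgueI[OF f']
  have f'1: "integrable lebesgue f'"
    using f1 ae by (subst integrable_cong_AE[of f' _ f]) (auto intro: AE_symmetric)
  have sq: "AE x in lebesgue. (norm (f x))\<^sup>2 = (norm (f' x))\<^sup>2"
    using ae by eventually_elim simp
  have f'2: "f' \<in> L2"
    using L2_integrable_norm_sq[OF f2] integrable_cong_AE[OF _ _ sq] unfolding L2_def by simp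
  have norm: "norm_L2 f = norm_L2 f'"
    unfolding norm_L2_def using integral_cong_AE[OF _ _ sq] by simp
  define F where "F \<xi> = (LINT x|lborel. f' x * phase (x \<bullet> \<xi>))" for \<xi>
  have F: "fourier_L1 f = F"
  proof
    fix \<xi>
    have "fourier_L1 f \<xi> = (LINT x|lebesgue. f' x * phase (x \<bullet> \<xi>))"
      unfolding fourier_L1_eq using ae by (intro integral_cong_AE) auto
    also have "\<dots> = F \<xi>"
      unfolding F_def by (rule integral_lebesgue_eq_lborel) measurable
    finally show "fourier_L1 f \<xi> = F \<xi>" .
  qed
  have [measurable]: "F \<in> borel_measurable borel" unfolding F_def by measurable
  have Fl: "F \<in> borel_measurable lebesgue" by (rule borel_measurable_lebesgueI) measurable
  have nn: "(\<integral>\<^sup>+\<xi>. ennreal ((norm (F \<xi>))\<^sup>2) \<partial>lebesgue) = ennreal ((norm_L2 f)\<^sup>2)"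
    unfolding norm F_def nn_integral_completion
    by (rule plancherel_borel[OF f' _ f'2]) (use f'1 in \<open>simp add: integrable_lebesgue_iff_lborel\<close>)
  show "fourier_L1 f \<in> L2" unfolding F by (rule L2_I[OF Fl]) (simp add: nn)
  show "norm_L2 (fourier_L1 f) = norm_L2 f"
    unfolding F using norm_L2_sq_enn2real[OF Fl] by (simp add: nn)
qed

section \<open>The Fourier transform on L2\<close>

lemma fourier_L1_diff:
  assumes "integrable lebesgue f" "integrable lebesgue g"
  shows "fourier_L1 (\<lambda>x. f x - g x) \<xi> = fourier_L1 f \<xi> - fourier_L1 g \<xi>"
proof -
  have i: "integrable lebesgue (\<lambda>x. h x * phase (x \<bullet> \<xi>))" if h: "integrable lebesgue h" for h
  proof -
    note [measurable] = borel_measurable_integrable[OF h]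
    show ?thesis by (rule Bochner_Integration.integrable_bound[OF h]) (auto simp: norm_mult)
  qed
  show ?thesis
    unfolding fourier_L1_eq left_diff_distrib by (intro Bochner_Integration.integral_diff i assms)
qed

lemma fourier_L1_translate:
  assumes "integrable lebesgue f"
  shows "fourier_L1 (\<lambda>x. f (x + a)) \<xi> = phase (- (a \<bullet> \<xi>)) * fourier_L1 f \<xi>"
proof -
  note [measurable] = borel_measurable_integrable[OF assms]
  have "fourier_L1 (\<lambda>x. f (x + a)) \<xi> = (LINT x|lebesgue. f (x + a) * (phase (- (a \<bullet> \<xi>)) * phase ((x + a) \<bullet> \<xi>)))"
    unfolding fourier_L1_eq by (simp add: inner_add_left flip: phase_add)
  also have "\<dots> = (LINT x|lebesgue. f x * (phase (- (a \<bullet> \<xi>)) * phase (x \<bullet> \<xi>)))"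
    by (rule integral_translate[of "\<lambda>x. f x * (phase (- (a \<bullet> \<xi>)) * phase (x \<bullet> \<xi>))"]) measurable
  also have "\<dots> = phase (- (a \<bullet> \<xi>)) * fourier_L1 f \<xi>"
    unfolding fourier_L1_eq by (simp only: mult.left_commute[of _ "phase (- (a \<bullet> \<xi>))"] integral_mult_right_zero)
  finally show ?thesis .
qed

text \<open>Existence behind the choice operator: truncations to balls converge to \<open>f\<close>
  and, by Plancherel applied to their differences, have a Cauchy sequence of transforms.\<close>

lemma is_fourier_L2_fourier_L2:
  fixes f :: "'a::euclidean_space \<Rightarrow> complex"
  assumes f: "f \<in> L2"
  shows "is_fourier_L2 f (fourier_L2 f)"
proof -
  note [measurable] = L2_measurable[OF f]
  define s where "s n x = f x * indicator (cball 0 (real n)) x" for n :: nat and x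
  have [measurable]: "cball (0::'a) r \<in> sets lebesgue" for r by simp
  have [measurable]: "s n \<in> borel_measurable lebesgue" for n unfolding s_def by measurable
  have s2: "s n \<in> L2" for n
    by (rule L2_dominated[OF f]) (auto simp: s_def indicator_def)
  \<comment> \<open>A truncation of \<open>f\<close> is a product of two L2 functions and hence
    integrable.\<close>
  have ind2: "(\<lambda>x. indicator (cball (0::'a) (real n)) x :: complex) \<in> L2" for n
  proof (rule L2_I)
    have "(\<integral>\<^sup>+x. ennreal ((norm (indicator (cball (0::'a) (real n)) x :: complex))\<^sup>2) \<partial>lebesgue)
        = (\<integral>\<^sup>+x. indicator (cball (0::'a) (real n)) x \<partial>lebesgue)"
      by (intro nn_integral_cong) (auto simp: indicator_def)
    also have "\<dots> = emeasure lebesgue (cball (0::'a) (real n))" by (rule nn_integral_indicator) simp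
    also have "\<dots> < \<infinity>" using lmeasurable_cball[of "0::'a" "real n"] by (simp add: fmeasurable_def)
    finally show "(\<integral>\<^sup>+x. ennreal ((norm (indicator (cball (0::'a) (real n)) x :: complex))\<^sup>2) \<partial>lebesgue) < \<infinity>" .
  qed measurable
  have s1: "integrable lebesgue (s n)" for n
  proof -
    have "cnj (indicator (cball 0 (real n)) x) = indicator (cball 0 (real n)) x" for x :: 'a
      by (simp add: indicator_def)
    then show ?thesis using L2_inner_integrable[OF f ind2[of n]] unfolding s_def[abs_def] by simp
  qed
  have "(\<lambda>k. LINT x|lebesgue. (norm (s k x - f x))\<^sup>2) \<longlonglongrightarrow> (LINT x|(lebesgue :: 'a measure). 0)"
  proof (rule integral_dominated_convergence[where w="\<lambda>x. (norm (f x))\<^sup>2"])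
    show "AE x in lebesgue. (\<lambda>k. (norm (s k x - f x))\<^sup>2) \<longlonglongrightarrow> 0"
    proof (intro AE_I2)
      fix x :: 'a
      obtain N :: nat where N: "norm x \<le> real N" using real_arch_simple by blast
      have "\<forall>\<^sub>F k in sequentially. (norm (s k x - f x))\<^sup>2 = 0"
        using N by (intro eventually_sequentiallyI[of N]) (auto simp: s_def)
      then show "(\<lambda>k. (norm (s k x - f x))\<^sup>2) \<longlonglongrightarrow> 0" by (simp add: tendsto_eventually)
    qed
    show "AE x in lebesgue. norm ((norm (s k x - f x))\<^sup>2) \<le> (norm (f x))\<^sup>2" for k
      by (intro AE_I2) (auto simp: s_def indicator_def)
  qed (use L2_integrable_norm_sq[OF f] in auto)
  then have "(\<lambda>k. sqrt (LINT x|lebesgue. (norm (s k x - f x))\<^sup>2)) \<longlonglongrightarrow> sqrt (LINT x|(lebesgue :: 'a measure). 0)"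
    by (rule tendsto_real_sqrt)
  then have lim: "(\<lambda>k. norm_L2 (\<lambda>x. s k x - f x)) \<longlonglongrightarrow> 0"
    unfolding norm_L2_def by simp
  then have sf: "tendsto_L2 s f" by (simp add: tendsto_L2_def s2 f)
  have dist: "norm_L2 (\<lambda>x. fourier_L1 (s m) x - fourier_L1 (s n) x) = norm_L2 (\<lambda>x. s m x - s n x)" for m n
  proof -
    have "fourier_L1 (\<lambda>x. s m x - s n x) = (\<lambda>\<xi>. fourier_L1 (s m) \<xi> - fourier_L1 (s n) \<xi>)"
      by (intro ext fourier_L1_diff s1)
    then show ?thesis
      using plancherel_L1(2)[of "\<lambda>x. s m x - s n x"] s1 s2 by (simp add: L2_diff)
  qed
  obtain F where "tendsto_L2 (\<lambda>n. fourier_L1 (s n)) F"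
  proof (rule L2_complete)
    show "fourier_L1 (s n) \<in> L2" for n by (rule plancherel_L1(1)[OF s1 s2])
    fix e :: real assume e: "0 < e"
    have "\<forall>\<^sub>F k in sequentially. norm_L2 (\<lambda>x. s k x - f x) < e / 2"
      using e by (intro order_tendstoD(2)[OF lim]) auto
    then obtain N where N: "\<And>k. k \<ge> N \<Longrightarrow> norm_L2 (\<lambda>x. s k x - f x) < e / 2"
      by (auto simp: eventually_sequentially)
    have "norm_L2 (\<lambda>x. fourier_L1 (s m) x - fourier_L1 (s n) x) < e" if "m \<ge> N" "n \<ge> N" for m n
      using norm_L2_triangle_diff[OF s2[of m] f s2[of n]] norm_L2_minus_commute[of f "s n"] N[OF that(1)] N[OF that(2)]
      unfolding dist by linarith
    then show "\<exists>N. \<forall>m\<ge>N. \<forall>n\<ge>N. norm_L2 (\<lambda>x. fourier_L1 (s m) x - fourier_L1 (s n) x) < e" by blast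
  qed
  then have "\<exists>F. is_fourier_L2 f F"
    unfolding is_fourier_L2_def using s1 sf by blast
  then show ?thesis unfolding fourier_L2_def by (rule someI_ex)
qed

text \<open>All three facts hold along the approximating sequence by \<open>plancherel_L1\<close>
  and pass to the limit, since translation is isometric and the multiplier \<open>?c\<close> is
  bounded by 2. The last one transfers translation differences to the frequency side.\<close>

lemma
  fixes f :: "'a::euclidean_space \<Rightarrow> complex"
  assumes f: "f \<in> L2"
  shows fourier_L2_L2: "fourier_L2 f \<in> L2"
    and norm_L2_fourier_L2: "norm_L2 (fourier_L2 f) = norm_L2 f"
    and norm_L2_translate_diff:
      "norm_L2 (\<lambda>x. f (x + a) - f x) = norm_L2 (\<lambda>\<xi>. (phase (- (a \<bullet> \<xi>)) - 1) * fourier_L2 f \<xi>)"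
proof -
  let ?F = "fourier_L2 f" and ?c = "\<lambda>\<xi>. phase (- (a \<bullet> \<xi>)) - 1"
  obtain s where s1: "\<And>n. integrable lebesgue (s n)" and s: "tendsto_L2 s f"
    and sF: "tendsto_L2 (\<lambda>n. fourier_L1 (s n)) ?F"
    using is_fourier_L2_fourier_L2[OF f] unfolding is_fourier_L2_def by blast
  have s2: "s n \<in> L2" for n using s by (simp add: tendsto_L2_def)
  have S2: "fourier_L1 (s n) \<in> L2" for n using sF by (simp add: tendsto_L2_def)
  show F2: "?F \<in> L2" using sF by (simp add: tendsto_L2_def)
  have "(\<lambda>n. norm_L2 (s n)) \<longlonglongrightarrow> norm_L2 ?F"
    using tendsto_L2_norm[OF sF] by (simp add: plancherel_L1(2)[OF s1 s2])
  then show "norm_L2 ?F = norm_L2 f"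
    using tendsto_L2_norm[OF s] LIMSEQ_unique by blast
  have c_meas [measurable]: "?c \<in> borel_measurable lebesgue"
    by (intro borel_measurable_lebesgue_continuous continuous_intros)
  have c_le: "norm (?c \<xi>) \<le> 2" for \<xi>
    using norm_triangle_ineq4[of "phase (- (a \<bullet> \<xi>))" 1] by simp
  have c2: "(\<lambda>\<xi>. ?c \<xi> * G \<xi>) \<in> L2" and c_norm: "norm_L2 (\<lambda>\<xi>. ?c \<xi> * G \<xi>) \<le> 2 * norm_L2 G"
    if G: "G \<in> L2" for G
  proof -
    note [measurable] = L2_measurable[OF G]
    have le: "norm (?c \<xi> * G \<xi>) \<le> norm (2 * G \<xi>)" for \<xi>
      using c_le[of \<xi>] by (simp add: norm_mult mult_right_mono)
    show m: "(\<lambda>\<xi>. ?c \<xi> * G \<xi>) \<in> L2"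
      by (rule L2_dominated[OF L2_scale[OF G, of 2]]) (use le in auto)
    have "(norm_L2 (\<lambda>\<xi>. ?c \<xi> * G \<xi>))\<^sup>2 \<le> (norm_L2 (\<lambda>\<xi>. 2 * G \<xi>))\<^sup>2"
      unfolding norm_L2_sq by (intro integral_mono L2_integrable_norm_sq m L2_scale G power_mono le) auto
    then have "norm_L2 (\<lambda>\<xi>. ?c \<xi> * G \<xi>) \<le> norm_L2 (\<lambda>\<xi>. 2 * G \<xi>)"
      by (rule power2_le_imp_le) simp
    then show "norm_L2 (\<lambda>\<xi>. ?c \<xi> * G \<xi>) \<le> 2 * norm_L2 G"
      by (simp add: norm_L2_scale)
  qed
  have eq: "norm_L2 (\<lambda>x. s n (x + a) - s n x) = norm_L2 (\<lambda>\<xi>. ?c \<xi> * fourier_L1 (s n) \<xi>)" for n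
  proof -
    have "norm_L2 (\<lambda>x. s n (x + a) - s n x) = norm_L2 (fourier_L1 (\<lambda>x. s n (x + a) - s n x))"
      by (rule plancherel_L1(2)[symmetric])
         (intro Bochner_Integration.integrable_diff integrable_translate s1 L2_diff L2_translate s2)+
    also have "fourier_L1 (\<lambda>x. s n (x + a) - s n x) = (\<lambda>\<xi>. ?c \<xi> * fourier_L1 (s n) \<xi>)"
      using s1[of n] by (intro ext)
        (simp add: fourier_L1_diff integrable_translate fourier_L1_translate left_diff_distrib)
    finally show ?thesis .
  qed
  have "tendsto_L2 (\<lambda>n x. s n (x + a) - s n x) (\<lambda>x. f (x + a) - f x)"
    unfolding tendsto_L2_def
  proof (intro conjI allI L2_diff L2_translate s2 f)
    have bound: "norm_L2 (\<lambda>x. (s n (x + a) - s n x) - (f (x + a) - f x)) \<le> 2 * norm_L2 (\<lambda>x. s n x - f x)" for n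
    proof -
      have d: "(\<lambda>x. s n x - f x) \<in> L2" by (intro L2_diff s2 f)
      have "norm_L2 (\<lambda>x. (s n (x + a) - f (x + a)) - (s n x - f x))
          \<le> norm_L2 (\<lambda>x. s n (x + a) - f (x + a)) + norm_L2 (\<lambda>x. s n x - f x)"
        using L2_translate[OF d, of a] d by (intro norm_L2_diff_le)
      then show ?thesis using norm_L2_translate[OF d, of a] by (simp add: algebra_simps)
    qed
    show "(\<lambda>n. norm_L2 (\<lambda>x. (s n (x + a) - s n x) - (f (x + a) - f x))) \<longlonglongrightarrow> 0"
      by (rule Lim_null_comparison[OF always_eventually[OF allI], of _ "\<lambda>n. 2 * norm_L2 (\<lambda>x. s n x - f x)"])
         (use s bound in \<open>auto simp: tendsto_L2_def intro!: tendsto_mult_right_zero\<close>)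
  qed
  then have l1: "(\<lambda>n. norm_L2 (\<lambda>x. s n (x + a) - s n x)) \<longlonglongrightarrow> norm_L2 (\<lambda>x. f (x + a) - f x)"
    by (rule tendsto_L2_norm)
  have "tendsto_L2 (\<lambda>n \<xi>. ?c \<xi> * fourier_L1 (s n) \<xi>) (\<lambda>\<xi>. ?c \<xi> * ?F \<xi>)"
    unfolding tendsto_L2_def
  proof (intro conjI allI c2 S2 F2)
    have bound: "norm_L2 (\<lambda>x. ?c x * fourier_L1 (s n) x - ?c x * ?F x) \<le> 2 * norm_L2 (\<lambda>x. fourier_L1 (s n) x - ?F x)" for n
      using c_norm[OF L2_diff[OF S2[of n] F2]] by (simp add: right_diff_distrib)
    show "(\<lambda>n. norm_L2 (\<lambda>x. ?c x * fourier_L1 (s n) x - ?c x * ?F x)) \<longlonglongrightarrow> 0"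
      by (rule Lim_null_comparison[OF always_eventually[OF allI], of _ "\<lambda>n. 2 * norm_L2 (\<lambda>x. fourier_L1 (s n) x - ?F x)"])
         (use sF bound in \<open>auto simp: tendsto_L2_def intro!: tendsto_mult_right_zero\<close>)
  qed
  then have l2: "(\<lambda>n. norm_L2 (\<lambda>x. s n (x + a) - s n x)) \<longlonglongrightarrow> norm_L2 (\<lambda>\<xi>. ?c \<xi> * ?F \<xi>)"
    unfolding eq by (rule tendsto_L2_norm)
  show "norm_L2 (\<lambda>x. f (x + a) - f x) = norm_L2 (\<lambda>\<xi>. ?c \<xi> * ?F \<xi>)"
    using LIMSEQ_unique[OF l1 l2] .
qed

text \<open>On the frequency side the translation difference is a multiplier of size at most 2 pi
  |t| |v \<bullet> \<xi>|, so C is 2 pi times the norm of (v \<bullet> \<xi>) times the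
  transform.\<close>

lemma norm_L2_translate_diff_le:
  fixes f :: "'a::euclidean_space \<Rightarrow> complex"
  assumes f: "f \<in> L2"
    and fin: "(\<integral>\<^sup>+\<xi>. ennreal ((v \<bullet> \<xi>)\<^sup>2 * (norm (fourier_L2 f \<xi>))\<^sup>2) \<partial>lebesgue) < \<infinity>"
  obtains C where "0 \<le> C" "\<And>t. norm_L2 (\<lambda>x. f (x + t *\<^sub>R v) - f x) \<le> C * \<bar>t\<bar>"
proof -
  let ?F = "fourier_L2 f"
  note [measurable] = L2_measurable[OF fourier_L2_L2[OF f]]
  have vm [measurable]: "(\<lambda>\<xi>. v \<bullet> \<xi>) \<in> borel_measurable lebesgue"
    by (intro borel_measurable_lebesgue_continuous continuous_intros)
  define G where "G = (\<lambda>\<xi>. complex_of_real (v \<bullet> \<xi>) * ?F \<xi>)"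
  have Gm [measurable]: "G \<in> borel_measurable lebesgue" unfolding G_def by measurable
  have G: "G \<in> L2"
    by (rule L2_I[OF Gm]) (use fin in \<open>simp add: G_def norm_mult power_mult_distrib\<close>)
  have "norm_L2 (\<lambda>x. f (x + t *\<^sub>R v) - f x) \<le> 2 * pi * norm_L2 G * \<bar>t\<bar>" for t
  proof -
    let ?c = "\<lambda>\<xi>. phase (- ((t *\<^sub>R v) \<bullet> \<xi>)) - 1"
    have cm [measurable]: "?c \<in> borel_measurable lebesgue"
      by (intro borel_measurable_lebesgue_continuous continuous_intros)
    have le: "norm (?c \<xi> * ?F \<xi>) \<le> norm (complex_of_real (2 * pi * t) * G \<xi>)" for \<xi>
    proof -
      have "norm (?c \<xi>) * norm (?F \<xi>) \<le> (2 * pi * \<bar>- ((t *\<^sub>R v) \<bullet> \<xi>)\<bar>) * norm (?F \<xi>)"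
        by (intro mult_right_mono norm_phase_minus_1_le) simp
      then show ?thesis by (simp add: G_def norm_mult abs_mult mult_ac)
    qed
    have m: "(\<lambda>\<xi>. ?c \<xi> * ?F \<xi>) \<in> L2"
      by (rule L2_dominated[OF L2_scale[OF G]]) (use le in auto)
    have "(norm_L2 (\<lambda>\<xi>. ?c \<xi> * ?F \<xi>))\<^sup>2 \<le> (norm_L2 (\<lambda>\<xi>. complex_of_real (2 * pi * t) * G \<xi>))\<^sup>2"
      unfolding norm_L2_sq by (intro integral_mono L2_integrable_norm_sq m L2_scale G power_mono le) auto
    then have "norm_L2 (\<lambda>\<xi>. ?c \<xi> * ?F \<xi>) \<le> norm_L2 (\<lambda>\<xi>. complex_of_real (2 * pi * t) * G \<xi>)"
      by (rule power2_le_imp_le) simp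
    also have "\<dots> = 2 * pi * norm_L2 G * \<bar>t\<bar>"
      by (simp add: norm_L2_scale abs_mult norm_mult)
    finally show ?thesis by (simp only: norm_L2_translate_diff[OF f])
  qed
  then show ?thesis by (intro that[of "2 * pi * norm_L2 G"]) auto
qed

section \<open>Gabor systems\<close>

lemma int_vec_simps:
  "int_vec (m + n) = int_vec m + int_vec n" "int_vec (m - n) = int_vec m - int_vec n"
  "int_vec (- m) = - int_vec m" "int_vec 0 = 0"
  by (simp_all add: int_vec_def vec_eq_iff)

lemma int_vec_inner_Ints: "int_vec m \<bullet> int_vec n \<in> \<int>"
  by (simp add: inner_vec_def int_vec_def flip: of_int_mult of_int_sum)

lemma gabor_eq: "gabor g k = (\<lambda>x. phase (int_vec (snd k) \<bullet> x) * g (x - int_vec (fst k)))"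
  by (cases k) (simp add: gabor_def phase_exp)

lemma gabor_0 [simp]: "gabor g 0 = g"
  by (simp add: gabor_eq int_vec_simps)

text \<open>Reordering a translation and a modulation costs the phase of the inner product of two
  integer vectors, which is 1. The system is thus an orbit of an abelian group of unitary
  operators.\<close>

lemma gabor_gabor: "gabor (gabor g k) l = gabor g (k + l)"
proof
  fix x
  have "phase (int_vec (snd k) \<bullet> (x - int_vec (fst l))) = phase (int_vec (snd k) \<bullet> x)"
    using phase_add[of "int_vec (snd k) \<bullet> x" "- (int_vec (snd k) \<bullet> int_vec (fst l))"]
    by (simp add: inner_diff_right phase_Ints int_vec_inner_Ints)
  then show "gabor (gabor g k) l x = gabor g (k + l) x"
    by (simp add: gabor_eq int_vec_simps inner_add_left phase_add diff_diff_add add.commute)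
qed

lemma gabor_L2: "f \<in> L2 \<Longrightarrow> gabor f k \<in> L2"
  unfolding gabor_eq using L2_translate[of f "- int_vec (fst k)"]
  by (intro L2_unimodular) auto

lemma inner_L2_gabor_gabor:
  assumes "f \<in> L2" "h \<in> L2"
  shows "inner_L2 (gabor f k) (gabor h k) = inner_L2 f h"
  unfolding gabor_eq using inner_L2_translate[OF assms, of "- int_vec (fst k)"]
  by (subst inner_L2_unimodular) auto

text \<open>The adjoint of the shift by \<open>k\<close> is the shift by \<open>-k\<close> with no
  extra phase, so biorthogonality of both systems reduces to pairings with the single vector
  \<open>g\<close>.\<close>

lemma inner_L2_gabor_left:
  assumes "f \<in> L2" "h \<in> L2"
  shows "inner_L2 (gabor f k) h = inner_L2 f (gabor h (- k))"
  using inner_L2_gabor_gabor[OF assms(1) gabor_L2[OF assms(2)], of k "- k"]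
  by (simp add: gabor_gabor)

section \<open>Modulation and translation in one direction\<close>

definition modulate :: "'a::euclidean_space \<Rightarrow> real \<Rightarrow> ('a \<Rightarrow> complex) \<Rightarrow> 'a \<Rightarrow> complex" where
  "modulate v t f = (\<lambda>x. phase (t * (v \<bullet> x)) * f x)"

text \<open>It moves along the very \<open>v\<close> used in \<open>modulate\<close>, so the
  exponent in their commutation phase contains v \<bullet> v, which is positive for v \<noteq>
  0.\<close>

definition shift :: "'a::euclidean_space \<Rightarrow> real \<Rightarrow> ('a \<Rightarrow> complex) \<Rightarrow> 'a \<Rightarrow> complex" where
  "shift v t f = (\<lambda>x. f (x + t *\<^sub>R v))"

lemma modulate_measurable: "(\<lambda>x. phase (t * (v \<bullet> x))) \<in> borel_measurable lebesgue"
  by (intro borel_measurable_lebesgue_continuous continuous_intros)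

lemma modulate_L2: "f \<in> L2 \<Longrightarrow> modulate v t f \<in> L2"
  unfolding modulate_def by (intro L2_unimodular modulate_measurable) auto

lemma shift_L2: "f \<in> L2 \<Longrightarrow> shift v t f \<in> L2"
  unfolding shift_def by (rule L2_translate)

lemma modulate_inverse: "modulate v t (modulate v (- t) f) = f"
  by (auto simp: modulate_def mult.assoc[symmetric] simp flip: phase_add)

lemma shift_inverse: "shift v t (shift v (- t) f) = f"
  by (simp add: shift_def)

lemma inner_L2_modulate: "inner_L2 (modulate v t f) h = inner_L2 f (modulate v (- t) h)"
proof -
  have "inner_L2 (modulate v t f) (modulate v t (modulate v (- t) h)) = inner_L2 f (modulate v (- t) h)"
    unfolding modulate_def[of v t] by (rule inner_L2_unimodular) simp
  then show ?thesis by (simp add: modulate_inverse)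
qed

lemma inner_L2_shift:
  assumes "f \<in> L2" "h \<in> L2"
  shows "inner_L2 (shift v t f) h = inner_L2 f (shift v (- t) h)"
proof -
  have "inner_L2 (shift v t f) (shift v t (shift v (- t) h)) = inner_L2 f (shift v (- t) h)"
    unfolding shift_def[of v t] by (rule inner_L2_translate[OF assms(1) shift_L2[OF assms(2)]])
  then show ?thesis by (simp add: shift_inverse)
qed

text \<open>The phase is constant in \<open>x\<close> and comes from the translation part of
  \<open>k\<close>. In \<open>shift_gabor\<close> it comes from the modulation part, so each phase
  tends to 1 for fixed \<open>k\<close>.\<close>

lemma modulate_gabor:
  "modulate v t (gabor f k) = (\<lambda>x. phase (t * (v \<bullet> int_vec (fst k))) * gabor (modulate v t f) k x)"
proof
  fix x
  have "phase (t * (v \<bullet> x)) = phase (t * (v \<bullet> int_vec (fst k))) * phase (t * (v \<bullet> (x - int_vec (fst k))))"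
    by (simp add: inner_diff_right algebra_simps flip: phase_add)
  then show "modulate v t (gabor f k) x = phase (t * (v \<bullet> int_vec (fst k))) * gabor (modulate v t f) k x"
    by (simp add: modulate_def gabor_eq mult_ac)
qed

lemma shift_gabor:
  "shift v t (gabor f k) = (\<lambda>x. phase (t * (int_vec (snd k) \<bullet> v)) * gabor (shift v t f) k x)"
proof
  fix x
  have "phase (int_vec (snd k) \<bullet> (x + t *\<^sub>R v)) = phase (t * (int_vec (snd k) \<bullet> v)) * phase (int_vec (snd k) \<bullet> x)"
    by (simp add: inner_add_right algebra_simps flip: phase_add)
  then show "shift v t (gabor f k) x = phase (t * (int_vec (snd k) \<bullet> v)) * gabor (shift v t f) k x"
    by (simp add: shift_def gabor_eq algebra_simps)
qed

text \<open>The Weyl commutation relation; its scalar yields the nonzero limit of the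
  commutator.\<close>

lemma shift_modulate: 
  "shift v t (modulate v s f) = (\<lambda>x. phase (s * t * (v \<bullet> v)) * modulate v s (shift v t f) x)"
proof
  fix x
  have "phase (s * (v \<bullet> (x + t *\<^sub>R v))) = phase (s * t * (v \<bullet> v)) * phase (s * (v \<bullet> x))"
    by (simp add: inner_add_right algebra_simps flip: phase_add)
  then show "shift v t (modulate v s f) x = phase (s * t * (v \<bullet> v)) * modulate v s (shift v t f) x"
    by (simp add: shift_def modulate_def)
qed

text \<open>Both \<open>\<langle>(U - 1) g, (R\<^sup>* - 1) d\<rangle>\<close> and \<open>\<langle>(R - 1) g, (U\<^sup>* - 1) d\<rangle>\<close>, for \<open>U\<close> the modulation and \<open>R\<close>
  the shift, are expanded in the biorthogonal system. After \<open>k \<mapsto> - k\<close> in the second sum they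
  differ only by phases, while the difference of the two inner products is the commutator of
  \<open>U\<close> and \<open>R\<close>.\<close>

lemma commutator_expansion:
  fixes g d :: "real ^ 'd::finite \<Rightarrow> complex"
  assumes g: "g \<in> L2" and d: "d \<in> L2" and A: "0 < A"
    and summ: "\<And>f. f \<in> L2 \<Longrightarrow> (\<lambda>k. (norm (inner_L2 f (gabor g k)))\<^sup>2) summable_on UNIV"
    and lower: "\<And>f. f \<in> L2 \<Longrightarrow> A * (norm_L2 f)\<^sup>2 \<le> (\<Sum>\<^sub>\<infinity>k. (norm (inner_L2 f (gabor g k)))\<^sup>2)"
    and biorth: "\<And>k. inner_L2 g (gabor d k) = (if k = 0 then 1 else 0)"
  shows "((\<lambda>k. inner_L2 (\<lambda>x. modulate v s g x - g x) (gabor d k)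
        * (phase (t * (int_vec (snd k) \<bullet> v)) - phase (- s * (v \<bullet> int_vec (fst k))))
        * inner_L2 (\<lambda>x. shift v t g x - g x) (gabor d (- k)))
      has_sum (phase (s * t * (v \<bullet> v)) - 1) * inner_L2 (modulate v s (shift v t g)) d) UNIV"
proof -
  let ?U = "\<lambda>x. modulate v s g x - g x" and ?R = "\<lambda>x. shift v t g x - g x"
  let ?U' = "\<lambda>x. modulate v (- s) d x - d x" and ?R' = "\<lambda>x. shift v (- t) d x - d x"
  have U: "?U \<in> L2" "?U' \<in> L2" and R: "?R \<in> L2" "?R' \<in> L2"
    by (intro L2_diff modulate_L2 shift_L2 g d)+
  have biorth': "inner_L2 (gabor g k) (gabor d l) = (if k = l then 1 else 0)" for k l
    by (simp add: inner_L2_gabor_left g d gabor_L2 gabor_gabor biorth)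
  have expansion: "((\<lambda>k. inner_L2 f (gabor d k) * inner_L2 (gabor g k) p) has_sum inner_L2 f p) UNIV"
    if "f \<in> L2" "p \<in> L2" for f p
    by (rule biorthogonal_expansion[OF gabor_L2[OF g] gabor_L2[OF d] A summ lower biorth' that])
  \<comment> \<open>The adjoint translation is moved from \<open>d\<close> back to \<open>g\<close>
    through the \<open>k\<close>-th shift, so that only increments of \<open>g\<close>
    remain.\<close>
  have gR: "inner_L2 (gabor g k) ?R' = phase (t * (int_vec (snd k) \<bullet> v)) * inner_L2 ?R (gabor d (- k))" for k
  proof -
    have "inner_L2 (gabor g k) (shift v (- t) d) = inner_L2 (shift v t (gabor g k)) d"
      by (simp add: inner_L2_shift gabor_L2 g d)
    also have "\<dots> = phase (t * (int_vec (snd k) \<bullet> v)) * inner_L2 (shift v t g) (gabor d (- k))"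
      unfolding shift_gabor by (simp add: inner_L2_scale_left inner_L2_gabor_left shift_L2 g d)
    finally have "inner_L2 (gabor g k) ?R'
        = phase (t * (int_vec (snd k) \<bullet> v)) * inner_L2 (shift v t g) (gabor d (- k)) - inner_L2 g (gabor d (- k))"
      by (simp add: inner_L2_diff_right shift_L2 g d gabor_L2 inner_L2_gabor_left)
    \<comment> \<open>The pairing vanishes except at k = 0, where the phase is 1; so the phase may
      be inserted and factored out of the whole difference.\<close>
    also have "inner_L2 g (gabor d (- k)) = phase (t * (int_vec (snd k) \<bullet> v)) * inner_L2 g (gabor d (- k))"
      by (auto simp: biorth int_vec_simps)
    finally show ?thesis
      by (simp add: inner_L2_diff_left shift_L2 g d gabor_L2 right_diff_distrib)
  qed
  have gU: "inner_L2 (gabor g k) ?U' = phase (s * (v \<bullet> int_vec (fst k))) * inner_L2 ?U (gabor d (- k))" for k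
  proof -
    have "inner_L2 (gabor g k) (modulate v (- s) d) = inner_L2 (modulate v s (gabor g k)) d"
      by (simp add: inner_L2_modulate)
    also have "\<dots> = phase (s * (v \<bullet> int_vec (fst k))) * inner_L2 (modulate v s g) (gabor d (- k))"
      unfolding modulate_gabor by (simp add: inner_L2_scale_left inner_L2_gabor_left modulate_L2 g d)
    finally have "inner_L2 (gabor g k) ?U'
        = phase (s * (v \<bullet> int_vec (fst k))) * inner_L2 (modulate v s g) (gabor d (- k)) - inner_L2 g (gabor d (- k))"
      by (simp add: inner_L2_diff_right modulate_L2 g d gabor_L2 inner_L2_gabor_left)
    also have "inner_L2 g (gabor d (- k)) = phase (s * (v \<bullet> int_vec (fst k))) * inner_L2 g (gabor d (- k))"
      by (auto simp: biorth int_vec_simps)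
    finally show ?thesis
      by (simp add: inner_L2_diff_left modulate_L2 g d gabor_L2 right_diff_distrib)
  qed
  have D: "((\<lambda>k. inner_L2 ?U (gabor d k) * phase (t * (int_vec (snd k) \<bullet> v)) * inner_L2 ?R (gabor d (- k)))
      has_sum inner_L2 ?U ?R') UNIV"
    using expansion[OF U(1) R(2)] unfolding gR by (simp add: mult.assoc)
  have "((\<lambda>k. inner_L2 ?R (gabor d k) * (phase (s * (v \<bullet> int_vec (fst k))) * inner_L2 ?U (gabor d (- k))))
      has_sum inner_L2 ?R ?U') UNIV"
    using expansion[OF R(1) U(2)] unfolding gU .
  then have "((\<lambda>k. inner_L2 ?R (gabor d (- k)) * (phase (s * (v \<bullet> int_vec (fst (- k)))) * inner_L2 ?U (gabor d (- (- k)))))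
      has_sum inner_L2 ?R ?U') UNIV"
    by (subst (asm) has_sum_reindex_bij_betw[OF bij_uminus, symmetric])
  then have E: "((\<lambda>k. inner_L2 ?U (gabor d k) * phase (- s * (v \<bullet> int_vec (fst k))) * inner_L2 ?R (gabor d (- k)))
      has_sum inner_L2 ?R ?U') UNIV"
    by (simp add: int_vec_simps mult_ac)
  have "((\<lambda>k. inner_L2 ?U (gabor d k)
        * (phase (t * (int_vec (snd k) \<bullet> v)) - phase (- s * (v \<bullet> int_vec (fst k))))
        * inner_L2 ?R (gabor d (- k))) has_sum inner_L2 ?U ?R' - inner_L2 ?R ?U') UNIV"
    using has_sum_add[OF D has_sum_cmult_right[OF E, of "- 1"]] by (simp add: algebra_simps)
  moreover have "inner_L2 ?U ?R' - inner_L2 ?R ?U' = (phase (s * t * (v \<bullet> v)) - 1) * inner_L2 (modulate v s (shift v t g)) d"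
  proof -
    \<comment> \<open>After expanding both products, the terms with at most one operator cancel in
      the difference. The two mixed terms differ by the Weyl phase.\<close>
    have 1: "inner_L2 (modulate v s g) (shift v (- t) d) = phase (s * t * (v \<bullet> v)) * inner_L2 (modulate v s (shift v t g)) d"
    proof -
      have "inner_L2 (modulate v s g) (shift v (- t) d) = inner_L2 (shift v t (modulate v s g)) d"
        by (simp add: inner_L2_shift modulate_L2 g d)
      then show ?thesis unfolding shift_modulate by (simp add: inner_L2_scale_left)
    qed
    have 2: "inner_L2 (shift v t g) (modulate v (- s) d) = inner_L2 (modulate v s (shift v t g)) d"
      by (simp add: inner_L2_modulate)
    have 3: "inner_L2 g (shift v (- t) d) = inner_L2 (shift v t g) d"
      by (simp add: inner_L2_shift g d)
    have 4: "inner_L2 g (modulate v (- s) d) = inner_L2 (modulate v s g) d"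
      by (simp add: inner_L2_modulate)
    have UR: "inner_L2 ?U ?R' = inner_L2 (modulate v s g) (shift v (- t) d) - inner_L2 (modulate v s g) d
        - (inner_L2 g (shift v (- t) d) - inner_L2 g d)"
      by (simp add: inner_L2_diff_left inner_L2_diff_right R(2) modulate_L2 shift_L2 g d)
    have RU: "inner_L2 ?R ?U' = inner_L2 (shift v t g) (modulate v (- s) d) - inner_L2 (shift v t g) d
        - (inner_L2 g (modulate v (- s) d) - inner_L2 g d)"
      by (simp add: inner_L2_diff_left inner_L2_diff_right U(2) modulate_L2 shift_L2 g d)
    show ?thesis unfolding UR RU 1 2 3 4 by (simp add: algebra_simps)
  qed
  ultimately show ?thesis by simp
qed

text \<open>Dominated convergence: the Lipschitz bound for \<open>phase\<close> dominates every
  quotient by the modulus of the limit, so the squared errors are at most four times its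
  square.\<close>

lemma modulate_difference_quotient:
  fixes g :: "'a::euclidean_space \<Rightarrow> complex" and \<tau> :: "nat \<Rightarrow> real"
  assumes g: "g \<in> L2" and \<tau>: "\<tau> \<longlonglongrightarrow> 0" "\<And>n. \<tau> n \<noteq> 0"
    and fin: "(\<integral>\<^sup>+x. ennreal ((v \<bullet> x)\<^sup>2 * (norm (g x))\<^sup>2) \<partial>lebesgue) < \<infinity>"
  shows "tendsto_L2 (\<lambda>n x. (modulate v (\<tau> n) g x - g x) / \<tau> n) (\<lambda>x. 2 * pi * \<i> * (v \<bullet> x) * g x)"
proof -
  note [measurable] = L2_measurable[OF g]
  have [measurable]: "(\<lambda>x. v \<bullet> x) \<in> borel_measurable lebesgue"
    by (intro borel_measurable_lebesgue_continuous continuous_intros)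
  let ?h = "\<lambda>x. 2 * pi * \<i> * (v \<bullet> x) * g x" and ?w = "\<lambda>n x. (modulate v (\<tau> n) g x - g x) / \<tau> n"
  have nh: "(norm (?h x))\<^sup>2 = (2 * pi)\<^sup>2 * ((v \<bullet> x)\<^sup>2 * (norm (g x))\<^sup>2)" for x
    by (simp add: norm_mult power_mult_distrib)
  have h: "?h \<in> L2"
  proof (rule L2_I)
    show "(\<integral>\<^sup>+x. ennreal ((norm (?h x))\<^sup>2) \<partial>lebesgue) < \<infinity>"
      unfolding nh using fin by (subst ennreal_mult) (auto simp: nn_integral_cmult ennreal_mult_less_top)
  qed measurable
  have w: "?w n \<in> L2" for n
  proof -
    have "(\<lambda>x. inverse (complex_of_real (\<tau> n)) * (modulate v (\<tau> n) g x - g x)) \<in> L2"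
      by (intro L2_scale L2_diff modulate_L2 g)
    then show ?thesis by (simp add: divide_inverse mult.commute)
  qed
  note [measurable] = L2_measurable[OF w] L2_measurable[OF h]
  have w_eq: "?w n x = ((phase (\<tau> n * (v \<bullet> x)) - 1) / \<tau> n) * g x" for n x
    by (simp add: modulate_def field_simps)
  have w_le: "norm (?w n x) \<le> norm (?h x)" for n x
  proof -
    have "norm (phase (\<tau> n * (v \<bullet> x)) - 1) / \<bar>\<tau> n\<bar> \<le> 2 * pi * \<bar>\<tau> n * (v \<bullet> x)\<bar> / \<bar>\<tau> n\<bar>"
      by (intro divide_right_mono norm_phase_minus_1_le) auto
    also have "\<dots> = 2 * pi * \<bar>v \<bullet> x\<bar>" using \<tau>(2)[of n] by (simp add: abs_mult)
    finally have "norm ((phase (\<tau> n * (v \<bullet> x)) - 1) / \<tau> n) \<le> 2 * pi * \<bar>v \<bullet> x\<bar>"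
      by (simp add: norm_divide)
    then show ?thesis
      unfolding w_eq norm_mult by (intro mult_right_mono) (auto simp: abs_mult)
  qed
  have "(\<lambda>n. LINT x|lebesgue. (norm (?w n x - ?h x))\<^sup>2) \<longlonglongrightarrow> (LINT x|(lebesgue :: 'a measure). 0)"
  proof (rule integral_dominated_convergence[where w="\<lambda>x. 4 * (norm (?h x))\<^sup>2"])
    show "integrable lebesgue (\<lambda>x. 4 * (norm (?h x))\<^sup>2)"
      by (intro integrable_mult_right L2_integrable_norm_sq h)
    show "AE x in lebesgue. norm ((norm (?w n x - ?h x))\<^sup>2) \<le> 4 * (norm (?h x))\<^sup>2" for n
    proof (intro AE_I2)
      fix x
      have "norm (?w n x - ?h x) \<le> 2 * norm (?h x)"
        using norm_triangle_ineq4[of "?w n x" "?h x"] w_le[of n x] by linarith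
      then have "(norm (?w n x - ?h x))\<^sup>2 \<le> (2 * norm (?h x))\<^sup>2" by (intro power_mono) auto
      then show "norm ((norm (?w n x - ?h x))\<^sup>2) \<le> 4 * (norm (?h x))\<^sup>2"
        by (simp only: power_mult_distrib real_norm_def abs_power2) simp
    qed
    show "AE x in lebesgue. (\<lambda>n. (norm (?w n x - ?h x))\<^sup>2) \<longlonglongrightarrow> 0"
    proof (intro AE_I2)
      fix x
      have "(\<lambda>n. norm (?w n x - ?h x)) \<longlonglongrightarrow> 0"
      proof (rule Lim_null_comparison[OF always_eventually[OF allI]])
        fix n
        have "?w n x - ?h x = ((phase (\<tau> n * (v \<bullet> x)) - 1) / \<tau> n - 2 * pi * \<i> * (v \<bullet> x)) * g x"
          unfolding w_eq by (simp add: left_diff_distrib)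
        then show "norm (norm (?w n x - ?h x)) \<le> 2 * (pi * (v \<bullet> x))\<^sup>2 * \<bar>\<tau> n\<bar> * norm (g x)"
          using phase_difference_quotient[OF \<tau>(2), of n "v \<bullet> x"]
          by (simp only: norm_mult real_norm_def abs_norm_cancel abs_mult) (intro mult_right_mono norm_ge_zero)
        have "(\<lambda>n. 2 * (pi * (v \<bullet> x))\<^sup>2 * \<bar>\<tau> n\<bar> * norm (g x)) \<longlonglongrightarrow> 2 * (pi * (v \<bullet> x))\<^sup>2 * \<bar>0\<bar> * norm (g x)"
          by (intro tendsto_intros \<tau>)
        then show "(\<lambda>n. 2 * (pi * (v \<bullet> x))\<^sup>2 * \<bar>\<tau> n\<bar> * norm (g x)) \<longlonglongrightarrow> 0" by simp
      qed
      then have "(\<lambda>n. (norm (?w n x - ?h x))\<^sup>2) \<longlonglongrightarrow> 0\<^sup>2" by (rule tendsto_power)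
      then show "(\<lambda>n. (norm (?w n x - ?h x))\<^sup>2) \<longlonglongrightarrow> 0" by simp
    qed
  qed measurable
  then have "(\<lambda>n. sqrt (LINT x|lebesgue. (norm (?w n x - ?h x))\<^sup>2)) \<longlonglongrightarrow> sqrt (LINT x|(lebesgue :: 'a measure). 0)"
    by (rule tendsto_real_sqrt)
  then have "(\<lambda>n. norm_L2 (\<lambda>x. ?w n x - ?h x)) \<longlonglongrightarrow> 0"
    unfolding norm_L2_def by simp
  then show ?thesis using w h by (simp add: tendsto_L2_def)
qed

text \<open>The same sequence \<open>S\<close> is evaluated twice: as an infinite sum, where
  \<open>has_sum_tendsto_0\<close> gives the limit 0, and as a scalar times an inner product, where
  the derivative of \<open>phase\<close> gives a nonzero limit.\<close>

lemma balian_low_biorthogonal: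
  fixes g :: "real ^ 'd::finite \<Rightarrow> complex" and v :: "real ^ 'd"
  assumes g: "g \<in> L2" and d: "d \<in> L2" and A: "0 < A"
    and summ: "\<And>f. f \<in> L2 \<Longrightarrow> (\<lambda>k. (norm (inner_L2 f (gabor g k)))\<^sup>2) summable_on UNIV"
    and lower: "\<And>f. f \<in> L2 \<Longrightarrow> A * (norm_L2 f)\<^sup>2 \<le> (\<Sum>\<^sub>\<infinity>k. (norm (inner_L2 f (gabor g k)))\<^sup>2)"
    and biorth: "\<And>k. inner_L2 g (gabor d k) = (if k = 0 then 1 else 0)"
    and v: "v \<noteq> 0"
    and fin1: "(\<integral>\<^sup>+x. ennreal ((v \<bullet> x)\<^sup>2 * (norm (g x))\<^sup>2) \<partial>lebesgue) < \<infinity>"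
    and fin2: "(\<integral>\<^sup>+\<xi>. ennreal ((v \<bullet> \<xi>)\<^sup>2 * (norm (fourier_L2 g \<xi>))\<^sup>2) \<partial>lebesgue) < \<infinity>"
  shows False
proof -
  define \<tau> where "\<tau> n = 1 / (real n + 1)" for n
  have \<tau>_pos: "0 < \<tau> n" for n by (simp add: \<tau>_def)
  then have \<tau>_nz: "\<tau> n \<noteq> 0" for n by (metis less_irrefl)
  have \<tau>0: "\<tau> \<longlonglongrightarrow> 0" unfolding \<tau>_def by real_asymp
  define h where "h = (\<lambda>x. 2 * pi * \<i> * (v \<bullet> x) * g x)"
  define w where "w n x = (modulate v (\<tau> n) g x - g x) / \<tau> n" for n x
  have wh: "tendsto_L2 w h"
    unfolding w_def h_def by (rule modulate_difference_quotient[OF g \<tau>0 \<tau>_nz fin1])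
  then have w: "w n \<in> L2" and h: "h \<in> L2" for n by (auto simp: tendsto_L2_def)
  define R where "R n x = (shift v (\<tau> n) g x - g x) / \<tau> n" for n x
  have R_eq: "R n = (\<lambda>x. inverse (complex_of_real (\<tau> n)) * (shift v (\<tau> n) g x - g x))" for n
    by (simp add: R_def fun_eq_iff divide_inverse mult.commute)
  have w_eq: "w n = (\<lambda>x. inverse (complex_of_real (\<tau> n)) * (modulate v (\<tau> n) g x - g x))" for n
    by (simp add: w_def fun_eq_iff divide_inverse mult.commute)
  have R: "R n \<in> L2" for n
    unfolding R_eq by (intro L2_scale L2_diff shift_L2 g)
  obtain C where C: "0 \<le> C" "\<And>t. norm_L2 (\<lambda>x. g (x + t *\<^sub>R v) - g x) \<le> C * \<bar>t\<bar>"
    using norm_L2_translate_diff_le[OF g fin2] by blast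
  have R_le: "norm_L2 (R n) \<le> C" for n
  proof -
    have "norm_L2 (R n) = norm_L2 (\<lambda>x. g (x + \<tau> n *\<^sub>R v) - g x) / \<tau> n"
      unfolding R_eq norm_L2_scale using \<tau>_pos[of n] by (simp add: shift_def norm_inverse divide_inverse mult.commute)
    also have "\<dots> \<le> C * \<bar>\<tau> n\<bar> / \<tau> n"
      using \<tau>_pos[of n] by (intro divide_right_mono C) auto
    finally show ?thesis using \<tau>_pos[of n] by simp
  qed
  have biorth': "inner_L2 (gabor g k) (gabor d l) = (if k = l then 1 else 0)" for k l
    by (simp add: inner_L2_gabor_left g d gabor_L2 gabor_gabor biorth)
  have bessel: "(\<Sum>k\<in>F. (norm (inner_L2 f (gabor d k)))\<^sup>2) \<le> (norm_L2 f)\<^sup>2 / A"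
    if "f \<in> L2" "finite F" for f F
    by (rule biorthogonal_bessel[OF gabor_L2[OF g] gabor_L2[OF d] A lower biorth' that])
  define c where "c n k = phase (\<tau> n * (int_vec (snd k) \<bullet> v)) - phase (- \<tau> n * (v \<bullet> int_vec (fst k)))"
    for n and k :: "(int ^ 'd) \<times> (int ^ 'd)"
  \<comment> \<open>The value of the commutator expansion for s = t = \<open>\<tau> n\<close>,
    divided by the square of \<open>\<tau> n\<close>; one factor goes to \<open>w\<close>, the other
    to \<open>R\<close>.\<close>
  define S where "S n = ((phase (\<tau> n * \<tau> n * (v \<bullet> v)) - 1) / of_real (\<tau> n * \<tau> n)) * inner_L2 (modulate v (\<tau> n) (shift v (\<tau> n) g)) d" for n
  have "S \<longlonglongrightarrow> 0"
  \<comment> \<open>The dual Bessel inequality transfers norm convergence of \<open>w\<close> and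
    norm boundedness of \<open>R\<close> to l2, hence the factors \<open>sqrt A\<close>. The
    constant 2 bounds a difference of two unit phases.\<close>
  proof (rule has_sum_tendsto_0[where a="\<lambda>k. inner_L2 h (gabor d k)" and a'="\<lambda>n k. inner_L2 (w n) (gabor d k)"
        and b="\<lambda>n k. inner_L2 (R n) (gabor d (- k))" and c=c and \<epsilon>="\<lambda>n. norm_L2 (\<lambda>x. w n x - h x) / sqrt A"
        and B="C / sqrt A" and C=2])
    show "(\<lambda>k. (norm (inner_L2 h (gabor d k)))\<^sup>2) summable_on UNIV"
      by (rule nonneg_bounded_partial_sums_imp_summable_on[where C="(norm_L2 h)\<^sup>2 / A"])
         (auto intro!: eventually_finite_subsets_at_top_weakI bessel h)
    show "(\<Sum>k\<in>F. (norm (inner_L2 (w n) (gabor d k) - inner_L2 h (gabor d k)))\<^sup>2)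
        \<le> (norm_L2 (\<lambda>x. w n x - h x) / sqrt A)\<^sup>2" if "finite F" for n F
      using bessel[OF L2_diff[OF w[of n] h] that] A
      by (simp add: inner_L2_diff_left w h gabor_L2 d power_divide)
    show "0 \<le> norm_L2 (\<lambda>x. w n x - h x) / sqrt A" for n using A by simp
    have "(\<lambda>n. norm_L2 (\<lambda>x. w n x - h x) / sqrt A) \<longlonglongrightarrow> 0 / sqrt A"
      using wh A by (intro tendsto_divide tendsto_const) (auto simp: tendsto_L2_def)
    then show "(\<lambda>n. norm_L2 (\<lambda>x. w n x - h x) / sqrt A) \<longlonglongrightarrow> 0" by simp
    show "(\<Sum>k\<in>F. (norm (inner_L2 (R n) (gabor d (- k))))\<^sup>2) \<le> (C / sqrt A)\<^sup>2"
      if F: "finite F" for n and F :: "((int ^ 'd) \<times> (int ^ 'd)) set"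
    proof -
      have "(\<Sum>k\<in>F. (norm (inner_L2 (R n) (gabor d (- k))))\<^sup>2) = (\<Sum>k\<in>uminus ` F. (norm (inner_L2 (R n) (gabor d k)))\<^sup>2)"
        by (subst sum.reindex) (auto simp: inj_on_def)
      also have "\<dots> \<le> (norm_L2 (R n))\<^sup>2 / A"
        by (intro bessel R finite_imageI F)
      also have "\<dots> \<le> C\<^sup>2 / A"
        using A by (intro divide_right_mono power_mono R_le) auto
      finally show ?thesis using A by (simp add: power_divide)
    qed
    show "0 \<le> C / sqrt A" using C A by simp
    show "norm (c n k) \<le> 2" for n k
      unfolding c_def by (rule order_trans[OF norm_triangle_ineq4]) simp
    show "(\<lambda>n. c n k) \<longlonglongrightarrow> 0" for k
    proof -
      have "(\<lambda>n. c n k) \<longlonglongrightarrow> phase (0 * (int_vec (snd k) \<bullet> v)) - phase (- 0 * (v \<bullet> int_vec (fst k)))"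
        unfolding c_def by (intro tendsto_intros \<tau>0)
      then show ?thesis by simp
    qed
    fix n
    have "((\<lambda>k. inverse (of_real (\<tau> n * \<tau> n)) * (inner_L2 (\<lambda>x. modulate v (\<tau> n) g x - g x) (gabor d k) * c n k
        * inner_L2 (\<lambda>x. shift v (\<tau> n) g x - g x) (gabor d (- k))))
      has_sum inverse (of_real (\<tau> n * \<tau> n)) * ((phase (\<tau> n * \<tau> n * (v \<bullet> v)) - 1) * inner_L2 (modulate v (\<tau> n) (shift v (\<tau> n) g)) d)) UNIV"
      unfolding c_def by (intro has_sum_cmult_right commutator_expansion[OF g d A summ lower biorth])
    then show "((\<lambda>k. inner_L2 (w n) (gabor d k) * c n k * inner_L2 (R n) (gabor d (- k))) has_sum S n) UNIV"
      unfolding S_def w_eq R_eq inner_L2_scale_left by (simp add: divide_inverse mult_ac)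
  qed
  moreover have "S \<longlonglongrightarrow> 2 * pi * \<i> * (v \<bullet> v) * 1"
    unfolding S_def
  proof (rule tendsto_mult)
    have "(\<lambda>n. (phase (\<tau> n * \<tau> n * (v \<bullet> v)) - 1) / of_real (\<tau> n * \<tau> n) - 2 * pi * \<i> * (v \<bullet> v)) \<longlonglongrightarrow> 0"
    proof (rule Lim_null_comparison[OF always_eventually[OF allI]])
      show "norm ((phase (\<tau> n * \<tau> n * (v \<bullet> v)) - 1) / of_real (\<tau> n * \<tau> n) - 2 * pi * \<i> * (v \<bullet> v))
          \<le> 2 * (pi * (v \<bullet> v))\<^sup>2 * \<bar>\<tau> n * \<tau> n\<bar>" for n
        using \<tau>_nz[of n] by (intro phase_difference_quotient) simp
      have "(\<lambda>n. 2 * (pi * (v \<bullet> v))\<^sup>2 * \<bar>\<tau> n * \<tau> n\<bar>) \<longlonglongrightarrow> 2 * (pi * (v \<bullet> v))\<^sup>2 * \<bar>0 * 0\<bar>"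
        by (intro tendsto_intros \<tau>0)
      then show "(\<lambda>n. 2 * (pi * (v \<bullet> v))\<^sup>2 * \<bar>\<tau> n * \<tau> n\<bar>) \<longlonglongrightarrow> 0" by simp
    qed
    then show "(\<lambda>n. (phase (\<tau> n * \<tau> n * (v \<bullet> v)) - 1) / of_real (\<tau> n * \<tau> n)) \<longlonglongrightarrow> 2 * pi * \<i> * (v \<bullet> v)"
      by (simp only: LIM_zero_iff)
    \<comment> \<open>Modulation is isometric, so the two errors add: the translation error is at
      most C \<open>\<tau> n\<close>, and the modulation error is \<open>\<tau> n\<close> times the
      convergent norm of \<open>w n\<close>.\<close>
    have "tendsto_L2 (\<lambda>n. modulate v (\<tau> n) (shift v (\<tau> n) g)) g"
      unfolding tendsto_L2_def
    proof (intro conjI allI modulate_L2 shift_L2 g)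
      have bound: "norm_L2 (\<lambda>x. modulate v (\<tau> n) (shift v (\<tau> n) g) x - g x) \<le> \<tau> n * C + \<tau> n * norm_L2 (w n)" for n
      proof -
        have "norm_L2 (\<lambda>x. modulate v (\<tau> n) (shift v (\<tau> n) g) x - g x)
            \<le> norm_L2 (\<lambda>x. modulate v (\<tau> n) (shift v (\<tau> n) g) x - modulate v (\<tau> n) g x)
              + norm_L2 (\<lambda>x. modulate v (\<tau> n) g x - g x)"
          by (intro norm_L2_triangle_diff modulate_L2 shift_L2 g)
        also have "norm_L2 (\<lambda>x. modulate v (\<tau> n) g x - g x) = \<tau> n * norm_L2 (w n)"
          unfolding w_eq norm_L2_scale using \<tau>_pos[of n] by (simp add: norm_inverse)
        also have "norm_L2 (\<lambda>x. modulate v (\<tau> n) (shift v (\<tau> n) g) x - modulate v (\<tau> n) g x)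
            = norm_L2 (\<lambda>x. phase (\<tau> n * (v \<bullet> x)) * (shift v (\<tau> n) g x - g x))"
          by (simp add: modulate_def right_diff_distrib)
        also have "\<dots> = norm_L2 (\<lambda>x. g (x + \<tau> n *\<^sub>R v) - g x)"
          by (subst norm_L2_unimodular) (simp_all add: shift_def)
        also have "\<dots> \<le> \<tau> n * C"
          using C(2)[of "\<tau> n"] \<tau>_pos[of n] by (simp add: mult.commute)
        finally show ?thesis by simp
      qed
      have "(\<lambda>n. \<tau> n * C + \<tau> n * norm_L2 (w n)) \<longlonglongrightarrow> 0 * C + 0 * norm_L2 h"
        by (intro tendsto_intros \<tau>0 tendsto_L2_norm wh)
      then have "(\<lambda>n. \<tau> n * C + \<tau> n * norm_L2 (w n)) \<longlonglongrightarrow> 0" by simp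
      then show "(\<lambda>n. norm_L2 (\<lambda>x. modulate v (\<tau> n) (shift v (\<tau> n) g) x - g x)) \<longlonglongrightarrow> 0"
        by (rule Lim_null_comparison[OF always_eventually[OF allI], rotated]) (use bound in simp)
    qed
    from tendsto_L2_inner_left[OF this d]
    show "(\<lambda>n. inner_L2 (modulate v (\<tau> n) (shift v (\<tau> n) g)) d) \<longlonglongrightarrow> 1"
      using biorth[of 0] by simp
  qed
  ultimately have "2 * pi * \<i> * (v \<bullet> v) * 1 = 0"
    using LIMSEQ_unique by blast
  then show False using v by simp
qed

text \<open>The weight vanishes only on the hyperplane orthogonal to \<open>v\<close>, a null set.
  This excludes a zero factor in the product of the two integrals.\<close>

lemma norm_L2_eq_0_if_weighted:
  fixes f :: "'a::euclidean_space \<Rightarrow> complex"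
  assumes f: "f \<in> L2" and v: "v \<noteq> 0"
    and zero: "(\<integral>\<^sup>+x. ennreal ((v \<bullet> x)\<^sup>2 * (norm (f x))\<^sup>2) \<partial>lebesgue) = 0"
  shows "norm_L2 f = 0"
proof -
  note [measurable] = L2_measurable[OF f]
  have [measurable]: "(\<lambda>x. v \<bullet> x) \<in> borel_measurable lebesgue"
    by (intro borel_measurable_lebesgue_continuous continuous_intros)
  have "AE x in lebesgue. ennreal ((v \<bullet> x)\<^sup>2 * (norm (f x))\<^sup>2) = 0"
    using zero by (subst (asm) nn_integral_0_iff_AE) auto
  moreover have "AE x in lebesgue. x \<notin> {x. v \<bullet> x = 0}"
    using negligible_hyperplane[of v 0] v by (intro AE_not_in) (simp add: negligible_iff_null_sets)
  ultimately have "AE x in lebesgue. f x = 0"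
    by eventually_elim (simp add: ennreal_eq_0_iff mult_le_0_iff)
  then show ?thesis by (simp add: norm_L2_eq_0_iff[OF f])
qed

theorem corollary2p3:
  fixes \<omega> :: "real ^ 'd::finite \<Rightarrow> real" and g :: "real ^ 'd \<Rightarrow> complex"
  assumes "positive_quadratic_form \<omega>"
    and "g \<in> L2"
    and "is_exact_frame (UNIV :: ((int ^ 'd) \<times> (int ^ 'd)) set) (gabor g)"
  shows "(\<integral>\<^sup>+ x. ennreal (\<omega> x * (norm (g x))\<^sup>2) \<partial>lebesgue) *
         (\<integral>\<^sup>+ \<xi>. ennreal (\<omega> \<xi> * (norm (fourier_L2 g \<xi>))\<^sup>2) \<partial>lebesgue) = \<infinity>"
proof -
  note g = assms(2)
  obtain v where v: "v \<noteq> 0" "\<And>x. (v \<bullet> x)\<^sup>2 \<le> \<omega> x"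
    using positive_quadratic_form_ge_square[OF assms(1)] by blast
  obtain A where A: "0 < A"
    and summ: "\<And>f. f \<in> L2 \<Longrightarrow> (\<lambda>k. (norm (inner_L2 f (gabor g k)))\<^sup>2) summable_on UNIV"
    and lower: "\<And>f. f \<in> L2 \<Longrightarrow> A * (norm_L2 f)\<^sup>2 \<le> (\<Sum>\<^sub>\<infinity>k. (norm (inner_L2 f (gabor g k)))\<^sup>2)"
    using assms(3) unfolding is_exact_frame_def is_frame_def by blast
  obtain d where d: "d \<in> L2" "inner_L2 (gabor g 0) d = 1" "\<And>k. k \<noteq> 0 \<Longrightarrow> inner_L2 (gabor g k) d = 0"
    using exact_frame_biorthogonal[OF assms(3), of 0] by auto
  have biorth: "inner_L2 g (gabor d k) = (if k = 0 then 1 else 0)" for k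
    using inner_L2_gabor_left[OF g d(1), of "- k"] d(2) d(3)[of "- k"] by (cases "k = 0") simp_all
  let ?I = "\<lambda>f::real ^ 'd \<Rightarrow> complex. \<integral>\<^sup>+ x. ennreal (\<omega> x * (norm (f x))\<^sup>2) \<partial>lebesgue"
  let ?J = "\<lambda>f::real ^ 'd \<Rightarrow> complex. \<integral>\<^sup>+ x. ennreal ((v \<bullet> x)\<^sup>2 * (norm (f x))\<^sup>2) \<partial>lebesgue"
  have JI: "?J f \<le> ?I f" for f
    by (intro nn_integral_mono ennreal_leI mult_right_mono v) auto
  have "norm_L2 g \<noteq> 0"
    using norm_inner_L2_le[OF g d(1)] d(2) by auto
  \<comment> \<open>Needed because 0 times infinity is 0 in \<open>ennreal\<close>. For the
    transform, Plancherel carries over the nonzero norm.\<close>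
  then have "?I g \<noteq> 0" "?I (fourier_L2 g) \<noteq> 0"
    using norm_L2_eq_0_if_weighted[OF g v(1)] norm_L2_eq_0_if_weighted[OF fourier_L2_L2[OF g] v(1)]
      JI[of g] JI[of "fourier_L2 g"] norm_L2_fourier_L2[OF g] by auto
  moreover have "?I g = \<infinity> \<or> ?I (fourier_L2 g) = \<infinity>"
  proof (rule ccontr)
    assume "\<not> ?thesis"
    then have "?J g < \<infinity>" "?J (fourier_L2 g) < \<infinity>"
      using JI[of g] JI[of "fourier_L2 g"] by (auto simp: less_top order_le_less_trans)
    then show False
      using balian_low_biorthogonal[OF g d(1) A summ lower biorth v(1)] by blast
  qed
  ultimately show ?thesis by (auto simp: ennreal_mult_eq_top_iff)
qed

end
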